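(* Let $q\ge 0$ and let $t$ be a filtration value. For each $u\in\mathcal D_t^{(q)}$, let $$\kappa_u:=[z_u]_{t^-}-\sum_{v\in\mathcal S_t^{(q)}}w_{uv}[z_v]_{t^-}.$$ Then $\{\kappa_u\mid u\in\mathcal D_t^{(q)}\}$ is a basis of $\ker(i_t)_*$, where $(i_t)_*:H_q(K_{t^-};\Bbbk)\to H_q(K_t;\Bbbk)$ is induced by inclusion.
   Context: $K$ is a finite CW complex with fixed cell orientations and set of open cells $\mathcal K$; $\Bbbk$ is a field. $C_q$, $\partial_q$, $H_q$ denote cellular chains, boundary and homology with coefficients in $\Bbbk$. A filtration function $f:\mathcal K\to\mathbb R$ is fixed, i.e. $\tau\subseteq\overline\sigma$ implies $f(\tau)\le f(\sigma)$; its values are called filtration values. $K_t$ (resp. $K_{t^-}$) is the union of the cells $\sigma$ with $f(\sigma)\le t$ (resp. $f(\sigma)<t$), and $i_t:K_{t^-}\hookrightarrow K_t$ is the inclusion. The cells are totally ordered $\sigma_1\prec\dots\prec\sigma_N$ so that $f(\sigma_i)<f(\sigma_j)$ implies $i<j$, and $\sigma_i\subseteq\overline{\sigma_j}$, $\sigma_i\ne\sigma_j$ implies $i<j$. The sets $K_t$, $K_{t^-}$ and $\bigcup_{\ell\le p}\sigma_\ell$ are CW subcomplexes. The boundary matrix $D\in\Bbbk^{N\times N}$ has entries $D_{ij}=[\sigma_j:\sigma_i]$ (cellular incidence coefficients), so its $j$-th column is the coordinate vector of $\partial\sigma_j$. For a nonzero column $c$, $\operatorname{low}(c)=\max\{i\mid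 c_i\neq 0\}$. A matrix is reduced if no two of its nonzero columns have the same low. Fix a factorization $R=DV$ with $R$ reduced and $V$ upper unitriangular and dimension preserving (column $V_i$ is supported only on cells of the same dimension as $\sigma_i$). Columns are identified with cellular chains. A cell $\sigma_i$ is positive if $R_i=0$; then $z_i:=V_i$ is its selected birth cycle. For positive $\sigma_i$, $\operatorname{pair}(i)=j$ if $\operatorname{low}(R_j)=i$ for some (necessarily unique) $j$ with $R_j\ne0$, and $\operatorname{pair}(i)=\infty$ otherwise. $\mathcal V^{(q)}$ is the set of labeled nonzero $q$-th persistence intervals: each $u\in\mathcal V^{(q)}$ corresponds to a positive $q$-cell with index $i(u)$, with $b_u=f(\sigma_{i(u)})$, $d_u=f(\sigma_{\operatorname{pair}(i(u))})$ if $\operatorname{pair}(i(u))<\infty$ and $d_u=\infty$ otherwise, and only those with $b_u<d_u$ are included. Put $z_u:=z_{i(u)}$. Define $\mathcal D_t^{(q)}=\{u\in\mathcal V^{(q)}\mid b_u<t,\ d_u=t\}$ and $\mathcal S_t^{(q)}=\{v\in\mathcal V^{(q)}\mid b_v<t<d_v\}$. $[\cdot]_t$ and $[\cdot]_{t^-}$ denote classes in $H_q(K_t;\Bbbk)$ and $H_q(K_{t^-};\Bbbk)$. The classes $[z_v]_t$, $v\in\mathcal S_t^{(q)}$, form a basis of $\operatorname{im}(i_t)_*$; the transition coefficients $w_{uv}\in\Bbbk$ ($u\in\mathcal D_t^{(q)}$, $v\in\mathcal S_t^{(q)}$) are the unique scalars with $(i_t)_*[z_u]_{t^-}=\sum_{v\in\mathcal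 S_t^{(q)}}w_{uv}[z_v]_t$. *)

theory Defs
  imports "HOL-Homology.Homology" "HOL-Library.Extended_Real" "Jordan_Normal_Form.Matrix_Kernel"
begin

unbundle no vec_syntax

section \<open>Finite CW complexes with oriented cells\<close>

text \<open>
  The carrier of a complex is a topological space together with its set of open cells. The
  orientation of a cell \<open>\<sigma>\<close> of dimension \<open>n\<close> is a generator of the infinite cyclic group
  \<open>H\<^sub>n(cl \<sigma>, cl \<sigma> - \<sigma>; \<int>)\<close>.
\<close>

record 'a cw_complex =
  cw_space :: "'a topology"
  cw_cells :: "'a set set"
  cw_dim :: "'a set \<Rightarrow> nat"
  cw_orient :: "'a set \<Rightarrow> 'a chain set"

definition closed_disc :: "nat \<Rightarrow> (nat \<Rightarrow> real) topology" where
  "closed_disc n = subtopology (Euclidean_space n) {x. (\<Sum>i<n. (x i)\<^sup>2) \<le> 1}"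

definition disc_interior :: "nat \<Rightarrow> (nat \<Rightarrow> real) set" where
  "disc_interior n = {x \<in> topspace (closed_disc n). (\<Sum>i<n. (x i)\<^sup>2) < 1}"

definition disc_sphere :: "nat \<Rightarrow> (nat \<Rightarrow> real) set" where
  "disc_sphere n = {x \<in> topspace (closed_disc n). (\<Sum>i<n. (x i)\<^sup>2) = 1}"

definition characteristic_map ::
    "('a, 'm) cw_complex_scheme \<Rightarrow> 'a set \<Rightarrow> ((nat \<Rightarrow> real) \<Rightarrow> 'a) \<Rightarrow> bool" where
  "characteristic_map K \<sigma> \<phi> \<longleftrightarrow>
     continuous_map (closed_disc (cw_dim K \<sigma>)) (cw_space K) \<phi> \<and>
     homeomorphic_map (subtopology (closed_disc (cw_dim K \<sigma>)) (disc_interior (cw_dim K \<sigma>)))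
       (subtopology (cw_space K) \<sigma>) \<phi> \<and>
     \<phi> ` disc_sphere (cw_dim K \<sigma>) \<subseteq> \<Union>{\<tau> \<in> cw_cells K. cw_dim K \<tau> < cw_dim K \<sigma>}"

text \<open>For finitely many cells, closure finiteness and the weak topology are automatic.\<close>

definition finite_cw_complex :: "('a, 'm) cw_complex_scheme \<Rightarrow> bool" where
  "finite_cw_complex K \<longleftrightarrow>
     Hausdorff_space (cw_space K) \<and>
     finite (cw_cells K) \<and>
     \<Union>(cw_cells K) = topspace (cw_space K) \<and>
     pairwise disjnt (cw_cells K) \<and>
     (\<forall>\<sigma>\<in>cw_cells K. \<exists>\<phi>. characteristic_map K \<sigma> \<phi>)"

definition cell_closure :: "('a, 'm) cw_complex_scheme \<Rightarrow> 'a set \<Rightarrow> 'a set" where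
  "cell_closure K \<sigma> = cw_space K closure_of \<sigma>"

definition cell_frontier :: "('a, 'm) cw_complex_scheme \<Rightarrow> 'a set \<Rightarrow> 'a set" where
  "cell_frontier K \<sigma> = cell_closure K \<sigma> - \<sigma>"

definition cell_homology_group :: "('a, 'm) cw_complex_scheme \<Rightarrow> 'a set \<Rightarrow> 'a chain set monoid" where
  "cell_homology_group K \<sigma> =
     relative_homology_group (int (cw_dim K \<sigma>))
       (subtopology (cw_space K) (cell_closure K \<sigma>)) (cell_frontier K \<sigma>)"

definition oriented_cells :: "('a, 'm) cw_complex_scheme \<Rightarrow> bool" where
  "oriented_cells K \<longleftrightarrow>
     (\<forall>\<sigma>\<in>cw_cells K.
        cw_orient K \<sigma> \<in> carrier (cell_homology_group K \<sigma>) \<and>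
        generate (cell_homology_group K \<sigma>) {cw_orient K \<sigma>} = carrier (cell_homology_group K \<sigma>))"

definition cw_subcomplex :: "('a, 'm) cw_complex_scheme \<Rightarrow> 'a set \<Rightarrow> bool" where
  "cw_subcomplex K L \<longleftrightarrow>
     (\<exists>\<C>\<subseteq>cw_cells K. L = \<Union>\<C> \<and> (\<forall>\<sigma>\<in>\<C>. cell_closure K \<sigma> \<subseteq> L))"

definition skeleton :: "('a, 'm) cw_complex_scheme \<Rightarrow> nat \<Rightarrow> 'a set" where
  "skeleton K n = \<Union>{\<sigma> \<in> cw_cells K. cw_dim K \<sigma> \<le> n}"


section \<open>Incidence coefficients and cellular homology\<close>

text \<open>
  For \<open>dim \<tau> = n + 1\<close>, \<open>dim \<sigma> = n\<close>, the coefficient \<open>[\<tau> : \<sigma>]\<close> is the degree of the attaching map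
  of \<open>\<tau>\<close> over \<open>\<sigma>\<close>: both the boundary of the orientation of \<open>\<tau>\<close> and the orientation of \<open>\<sigma>\<close> are
  pushed into the infinite cyclic group \<open>H\<^sub>n(K\<^sup>n, K\<^sup>n - \<sigma>; \<int>)\<close>, where \<open>K\<^sup>n\<close> is the \<open>n\<close>-skeleton; the latter
  is a generator there, and \<open>[\<tau> : \<sigma>]\<close> is the multiple of it given by the former. (Homology groups of
  HOL-Homology are written multiplicatively.)
\<close>

definition incidence :: "('a, 'm) cw_complex_scheme \<Rightarrow> 'a set \<Rightarrow> 'a set \<Rightarrow> int" where
  "incidence K \<tau> \<sigma> =
     (if cw_dim K \<tau> = Suc (cw_dim K \<sigma>) then
        let n = cw_dim K \<sigma>;
            X = cw_space K;
            Y = subtopology X (skeleton K n);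
            A = skeleton K n - \<sigma>
        in THE m :: int.
             hom_induced (int n) (subtopology X (cell_frontier K \<tau>)) {} Y A id
               (hom_boundary (int (cw_dim K \<tau>)) (subtopology X (cell_closure K \<tau>)) (cell_frontier K \<tau>)
                 (cw_orient K \<tau>)) =
             hom_induced (int n) (subtopology X (cell_closure K \<sigma>)) (cell_frontier K \<sigma>) Y A id
               (cw_orient K \<sigma>) [^]\<^bsub>relative_homology_group (int n) Y A\<^esub> m
      else 0)"

text \<open>
  A cellular chain is the function giving its coefficient at each cell. For a subcomplex \<open>L\<close>, its
  cellular chain complex is the subcomplex of that of \<open>K\<close> spanned by the cells in \<open>L\<close>.
\<close>

definition cell_chains ::
    "('a, 'm) cw_complex_scheme \<Rightarrow> nat \<Rightarrow> 'a set \<Rightarrow> ('k::field, 'a set \<Rightarrow> 'k) module" where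
  "cell_chains K q L =
     \<lparr>carrier = {c. \<forall>\<sigma>. c \<sigma> \<noteq> 0 \<longrightarrow> \<sigma> \<in> cw_cells K \<and> \<sigma> \<subseteq> L \<and> cw_dim K \<sigma> = q},
      mult = (\<lambda>c d. undefined), one = undefined,
      zero = (\<lambda>\<sigma>. 0), add = (\<lambda>c d \<sigma>. c \<sigma> + d \<sigma>),
      smult = (\<lambda>a c \<sigma>. a * c \<sigma>)\<rparr>"

definition cell_boundary ::
    "('a, 'm) cw_complex_scheme \<Rightarrow> ('a set \<Rightarrow> 'k::field) \<Rightarrow> 'a set \<Rightarrow> 'k" where
  "cell_boundary K c =
     (\<lambda>\<sigma>. if \<sigma> \<in> cw_cells K then \<Sum>\<tau>\<in>cw_cells K. c \<tau> * of_int (incidence K \<tau> \<sigma>) else 0)"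

definition cell_cycles ::
    "('a, 'm) cw_complex_scheme \<Rightarrow> nat \<Rightarrow> 'a set \<Rightarrow> ('a set \<Rightarrow> 'k::field) set" where
  "cell_cycles K q L = {c \<in> carrier (cell_chains K q L). cell_boundary K c = (\<lambda>\<sigma>. 0)}"

definition cell_boundaries ::
    "('a, 'm) cw_complex_scheme \<Rightarrow> nat \<Rightarrow> 'a set \<Rightarrow> ('a set \<Rightarrow> 'k::field) set" where
  "cell_boundaries K q L = cell_boundary K ` carrier (cell_chains K (Suc q) L)"

definition homology_class ::
    "('a, 'm) cw_complex_scheme \<Rightarrow> nat \<Rightarrow> 'a set \<Rightarrow> ('a set \<Rightarrow> 'k::field) \<Rightarrow> ('a set \<Rightarrow> 'k) set" where
  "homology_class K q L c = cell_boundaries K q L +>\<^bsub>cell_chains K q L\<^esub> c"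

text \<open>The quotient space of cycles by boundaries, with cosets as elements.\<close>

definition cell_homology ::
    "('a, 'm) cw_complex_scheme \<Rightarrow> nat \<Rightarrow> 'a set \<Rightarrow> ('k::field, ('a set \<Rightarrow> 'k) set) module" where
  "cell_homology K q L =
     \<lparr>carrier = homology_class K q L ` cell_cycles K q L,
      mult = (\<lambda>x y. undefined), one = undefined,
      zero = cell_boundaries K q L, add = (\<lambda>x y. x <+>\<^bsub>cell_chains K q L\<^esub> y),
      smult = (\<lambda>a x. \<Union>c\<in>x. homology_class K q L (a \<odot>\<^bsub>cell_chains K q L\<^esub> c))\<rparr>"

text \<open>The map \<open>[c] \<mapsto> [c]\<close> from the homology of a subcomplex into that of a larger complex \<open>L\<close>.\<close>

definition incl_induced ::
    "('a, 'm) cw_complex_scheme \<Rightarrow> nat \<Rightarrow> 'a set \<Rightarrow> ('a set \<Rightarrow> 'k::field) set \<Rightarrow> ('a set \<Rightarrow> 'k) set" where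
  "incl_induced K q L x = (\<Union>c\<in>x. homology_class K q L c)"


section \<open>Filtrations and compatible cell orderings\<close>

definition filtration_function :: "('a, 'm) cw_complex_scheme \<Rightarrow> ('a set \<Rightarrow> real) \<Rightarrow> bool" where
  "filtration_function K f \<longleftrightarrow>
     (\<forall>\<sigma>\<in>cw_cells K. \<forall>\<tau>\<in>cw_cells K. \<tau> \<subseteq> cell_closure K \<sigma> \<longrightarrow> f \<tau> \<le> f \<sigma>)"

definition sublevel :: "('a, 'm) cw_complex_scheme \<Rightarrow> ('a set \<Rightarrow> real) \<Rightarrow> real \<Rightarrow> 'a set" where
  "sublevel K f t = \<Union>{\<sigma> \<in> cw_cells K. f \<sigma> \<le> t}"

definition strict_sublevel :: "('a, 'm) cw_complex_scheme \<Rightarrow> ('a set \<Rightarrow> real) \<Rightarrow> real \<Rightarrow> 'a set" where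
  "strict_sublevel K f t = \<Union>{\<sigma> \<in> cw_cells K. f \<sigma> < t}"

text \<open>Cells, and matrix rows and columns, are numbered from \<open>0\<close> to \<open>N - 1\<close>.\<close>

definition compatible_order ::
    "('a, 'm) cw_complex_scheme \<Rightarrow> ('a set \<Rightarrow> real) \<Rightarrow> 'a set list \<Rightarrow> bool" where
  "compatible_order K f cs \<longleftrightarrow>
     distinct cs \<and> set cs = cw_cells K \<and>
     (\<forall>i<length cs. \<forall>j<length cs. f (cs ! i) < f (cs ! j) \<longrightarrow> i < j) \<and>
     (\<forall>i<length cs. \<forall>j<length cs.
        cs ! i \<subseteq> cell_closure K (cs ! j) \<and> cs ! i \<noteq> cs ! j \<longrightarrow> i < j)"

text \<open>
  A condition of its own: the closure of a cell need not be a union of cells, and then a filtration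
  function may have sublevel sets that are not closed.
\<close>

definition filtration_by_subcomplexes ::
    "('a, 'm) cw_complex_scheme \<Rightarrow> ('a set \<Rightarrow> real) \<Rightarrow> 'a set list \<Rightarrow> bool" where
  "filtration_by_subcomplexes K f cs \<longleftrightarrow>
     (\<forall>t. cw_subcomplex K (sublevel K f t) \<and> cw_subcomplex K (strict_sublevel K f t)) \<and>
     (\<forall>p<length cs. cw_subcomplex K (\<Union>l\<in>{..p}. cs ! l))"


section \<open>Matrix reduction and persistence intervals\<close>

definition boundary_matrix :: "('a, 'm) cw_complex_scheme \<Rightarrow> 'a set list \<Rightarrow> 'k::field mat" where
  "boundary_matrix K cs =
     mat (length cs) (length cs) (\<lambda>(i, j). of_int (incidence K (cs ! j) (cs ! i)))"

text \<open>Only meaningful for nonzero columns.\<close>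

definition low :: "'k::zero vec \<Rightarrow> nat" where
  "low c = Max {i. i < dim_vec c \<and> c $ i \<noteq> 0}"

definition reduced :: "'k::zero mat \<Rightarrow> bool" where
  "reduced R \<longleftrightarrow>
     (\<forall>i<dim_col R. \<forall>j<dim_col R.
        col R i \<noteq> 0\<^sub>v (dim_row R) \<and> col R j \<noteq> 0\<^sub>v (dim_row R) \<and> i \<noteq> j
        \<longrightarrow> low (col R i) \<noteq> low (col R j))"

definition upper_unitriangular :: "'k::{zero,one} mat \<Rightarrow> bool" where
  "upper_unitriangular V \<longleftrightarrow> upper_triangular V \<and> (\<forall>i<dim_row V. V $$ (i, i) = 1)"

definition dimension_preserving ::
    "('a, 'm) cw_complex_scheme \<Rightarrow> 'a set list \<Rightarrow> 'k::zero mat \<Rightarrow> bool" where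
  "dimension_preserving K cs V \<longleftrightarrow>
     (\<forall>i<length cs. \<forall>k<length cs. V $$ (k, i) \<noteq> 0 \<longrightarrow> cw_dim K (cs ! k) = cw_dim K (cs ! i))"

definition chain_of_vec :: "'a set list \<Rightarrow> 'k::comm_monoid_add vec \<Rightarrow> 'a set \<Rightarrow> 'k" where
  "chain_of_vec cs c = (\<lambda>\<sigma>. \<Sum>i<length cs. if cs ! i = \<sigma> then c $ i else 0)"

definition positive :: "'k::zero mat \<Rightarrow> nat \<Rightarrow> bool" where
  "positive R i \<longleftrightarrow> i < dim_col R \<and> col R i = 0\<^sub>v (dim_row R)"

definition birth_cycle :: "'a set list \<Rightarrow> 'k::comm_monoid_add mat \<Rightarrow> nat \<Rightarrow> 'a set \<Rightarrow> 'k" where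
  "birth_cycle cs V i = chain_of_vec cs (col V i)"

definition is_pair :: "'k::zero mat \<Rightarrow> nat \<Rightarrow> nat \<Rightarrow> bool" where
  "is_pair R i j \<longleftrightarrow> j < dim_col R \<and> col R j \<noteq> 0\<^sub>v (dim_row R) \<and> low (col R j) = i"

definition pair :: "'k::zero mat \<Rightarrow> nat \<Rightarrow> enat" where
  "pair R i = (if \<exists>j. is_pair R i j then enat (THE j. is_pair R i j) else \<infinity>)"

definition birth :: "('a set \<Rightarrow> real) \<Rightarrow> 'a set list \<Rightarrow> nat \<Rightarrow> real" where
  "birth f cs u = f (cs ! u)"

definition death :: "('a set \<Rightarrow> real) \<Rightarrow> 'a set list \<Rightarrow> 'k::zero mat \<Rightarrow> nat \<Rightarrow> ereal" where
  "death f cs R u = (case pair R u of enat j \<Rightarrow> ereal (f (cs ! j)) | \<infinity> \<Rightarrow> \<infinity>)"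

text \<open>A labeled interval is represented by the index of its positive cell.\<close>

definition intervals ::
    "('a, 'm) cw_complex_scheme \<Rightarrow> ('a set \<Rightarrow> real) \<Rightarrow> 'a set list \<Rightarrow> 'k::zero mat \<Rightarrow> nat \<Rightarrow> nat set"
  where
  "intervals K f cs R q =
     {u. positive R u \<and> cw_dim K (cs ! u) = q \<and> ereal (birth f cs u) < death f cs R u}"

definition dying ::
    "('a, 'm) cw_complex_scheme \<Rightarrow> ('a set \<Rightarrow> real) \<Rightarrow> 'a set list \<Rightarrow> 'k::zero mat \<Rightarrow> nat \<Rightarrow> real \<Rightarrow> nat set"
  where
  "dying K f cs R q t =
     {u \<in> intervals K f cs R q. birth f cs u < t \<and> death f cs R u = ereal t}"

definition surviving ::
    "('a, 'm) cw_complex_scheme \<Rightarrow> ('a set \<Rightarrow> real) \<Rightarrow> 'a set list \<Rightarrow> 'k::zero mat \<Rightarrow> nat \<Rightarrow> real \<Rightarrow> nat set"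
  where
  "surviving K f cs R q t =
     {v \<in> intervals K f cs R q. birth f cs v < t \<and> ereal t < death f cs R v}"

text \<open>The coefficients \<open>w u v\<close>, as a function of \<open>v\<close> extended by \<open>0\<close> outside the surviving intervals.\<close>

definition transition_coeffs ::
    "('a, 'm) cw_complex_scheme \<Rightarrow> ('a set \<Rightarrow> real) \<Rightarrow> 'a set list \<Rightarrow> 'k::field mat \<Rightarrow> 'k mat
      \<Rightarrow> nat \<Rightarrow> real \<Rightarrow> nat \<Rightarrow> nat \<Rightarrow> 'k" where
  "transition_coeffs K f cs R V q t u =
     (let H = cell_homology K q (sublevel K f t) in
      THE w. (\<forall>v. v \<notin> surviving K f cs R q t \<longrightarrow> w v = 0) \<and>
        incl_induced K q (sublevel K f t)
          (homology_class K q (strict_sublevel K f t) (birth_cycle cs V u)) =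
        (\<Oplus>\<^bsub>H\<^esub>v\<in>surviving K f cs R q t.
           w v \<odot>\<^bsub>H\<^esub> homology_class K q (sublevel K f t) (birth_cycle cs V v)))"

definition kernel_class ::
    "('a, 'm) cw_complex_scheme \<Rightarrow> ('a set \<Rightarrow> real) \<Rightarrow> 'a set list \<Rightarrow> 'k::field mat \<Rightarrow> 'k mat
      \<Rightarrow> nat \<Rightarrow> real \<Rightarrow> nat \<Rightarrow> ('a set \<Rightarrow> 'k) set" where
  "kernel_class K f cs R V q t u =
     (let H = cell_homology K q (strict_sublevel K f t);
          cls = (\<lambda>i. homology_class K q (strict_sublevel K f t) (birth_cycle cs V i))
      in cls u \<ominus>\<^bsub>H\<^esub>
           (\<Oplus>\<^bsub>H\<^esub>v\<in>surviving K f cs R q t. transition_coeffs K f cs R V q t u v \<odot>\<^bsub>H\<^esub> cls v))"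

end

theory Submission
  imports Defs
begin

text \<open>
  Two topological facts make the cellular chains usable: \<open>\<partial> \<circ> \<partial> = 0\<close>, and the boundary of a chain in a
  subcomplex stays in it. Stretching a cell radially outwards and excising its outside shows
  \<open>H(X, X - \<sigma>) \<cong> H(D\<^sup>n, S\<^sup>n\<^sup>-\<^sup>1)\<close> whenever \<open>\<sigma>\<close> is open in \<open>X\<close>. So orientations have infinite order, and a class of
  \<open>H(K\<^sup>n, K\<^sup>n\<^sup>-\<^sup>1)\<close> is determined by its images in the groups \<open>H(K\<^sup>n, K\<^sup>n - \<sigma>)\<close>; hence the attaching class of an
  \<open>(n + 1)\<close>-cell \<open>\<tau>\<close> is \<open>\<Sum>\<^sub>\<sigma> [\<tau> : \<sigma>] \<sigma>\<close> there, and it has boundary \<open>0\<close> because it comes from \<open>H\<^sub>n(K\<^sup>n)\<close>.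

  The rest is linear algebra. As the nonzero reduced columns have distinct lows, for every stage \<open>L\<close> of the
  filtration the classes of the birth cycles whose pair is not in \<open>L\<close> form a basis of \<open>H\<^sub>q(L)\<close>. For \<open>K\<^sub>t\<^sub>-\<close> these are
  the dying and the surviving cycles, and the surviving ones remain independent in \<open>K\<^sub>t\<close>. Subtracting from
  a kernel element its combination of the \<open>\<kappa>\<^sub>u\<close> leaves a combination of surviving cycles that vanishes in
  \<open>H\<^sub>q(K\<^sub>t)\<close>, hence is zero.
\<close>

section \<open>Homology of a space relative to the complement of an open cell\<close>

text \<open>\<open>incidence\<close> is a definite description in a homology group, so no identity
  between incidence numbers is available before the topology of cells is settled. Two obstacles
  shape that part. A cell is usually not open in the complex, so local homology is taken in a
  skeleton, or in a skeleton with some top cells removed, where a cell of maximal dimension is open.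
  And the closure of a cell need not be a union of cells, so closedness of such sets rests on the
  dimension bound for frontiers alone. The algebra uses \<partial>\<partial> = 0 in one place:
  reduced columns are cycles, so multiples of them can be subtracted from a cycle without leaving
  the cycles. The transition coefficients are a definite description as well. Their uniqueness is
  the independence of the surviving classes in K_t; their existence needs the expansion of a dying
  cycle in K_t to avoid the classes born at t itself, which follows from a bound on the indices that
  occur.\<close>

lemma topspace_closed_disc:
  "topspace (closed_disc n) = {x. (\<forall>i\<ge>n. x i = 0) \<and> (\<Sum>i<n. (x i)\<^sup>2) \<le> 1}"
  by (auto simp: closed_disc_def topspace_Euclidean_space)

lemma closed_disc_eq:
  "closed_disc n = subtopology (powertop_real UNIV) {x. (\<forall>i\<ge>n. x i = 0) \<and> (\<Sum>i<n. (x i)\<^sup>2) \<le> 1}"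
  by (simp add: closed_disc_def Euclidean_space_def subtopology_subtopology Collect_conj_eq)

lemma continuous_map_closed_disc_component:
  "continuous_map (closed_disc n) euclideanreal (\<lambda>x. x i)"
  unfolding closed_disc_eq
  by (intro continuous_map_from_subtopology continuous_map_product_projection) auto

lemma continuous_map_into_closed_disc:
  assumes "\<And>i. continuous_map Z euclideanreal (\<lambda>z. f z i)"
    and "f ` topspace Z \<subseteq> topspace (closed_disc n)"
  shows "continuous_map Z (closed_disc n) f"
proof -
  have "continuous_map Z (powertop_real UNIV) f"
    by (subst continuous_map_componentwise_UNIV) (use assms(1) in simp)
  then show ?thesis
    using assms(2) unfolding closed_disc_eq by (auto simp: continuous_map_in_subtopology)
qed

text \<open>By Tychonoff: Euclidean space is modelled inside a product of countably many lines, and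
  the disc is a closed subset of the cube with all coordinates in [-1, 1].\<close>

lemma compact_space_closed_disc: "compact_space (closed_disc n)"
proof -
  let ?P = "powertop_real UNIV"
  let ?D = "{x::nat \<Rightarrow> real. (\<forall>i\<ge>n. x i = 0) \<and> (\<Sum>i<n. (x i)\<^sup>2) \<le> 1}"
  have comp: "compactin ?P (PiE UNIV (\<lambda>i. {-1..1::real}))"
    by (subst compactin_PiE) auto
  have sub: "?D \<subseteq> PiE UNIV (\<lambda>i. {-1..1::real})"
  proof
    fix x assume x: "x \<in> ?D"
    have "\<bar>x i\<bar> \<le> 1" for i
    proof (cases "i < n")
      case True
      then have "(x i)\<^sup>2 \<le> (\<Sum>i<n. (x i)\<^sup>2)"
        by (intro member_le_sum) auto
      also have "\<dots> \<le> 1"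
        using x by simp
      finally show ?thesis
        by (simp only: abs_square_le_1)
    qed (use x in auto)
    then show "x \<in> PiE UNIV (\<lambda>i. {-1..1::real})"
      by (auto simp: abs_le_iff)
  qed
  have cl: "closedin ?P ?D"
  proof -
    have 1: "closedin ?P {x \<in> topspace ?P. (\<Sum>i<n. (x i)\<^sup>2) \<in> {..1}}"
      by (rule closedin_continuous_map_preimage [where Y = euclideanreal])
        (auto intro!: continuous_intros)
    have 2: "{x. (\<forall>i\<ge>n. x i = 0) \<and> (\<Sum>i<n. (x i)\<^sup>2) \<le> 1} =
      topspace (Euclidean_space n) \<inter> {x \<in> topspace ?P. (\<Sum>i<n. (x i)\<^sup>2) \<in> {..1}}"
      by (auto simp: topspace_Euclidean_space)
    show ?thesis
      unfolding 2 by (intro closedin_Int closedin_Euclidean_space 1)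
  qed
  show ?thesis
    unfolding closed_disc_eq
    using closed_compactin [OF comp sub cl] by (simp add: compactin_subspace)
qed

lemma Hausdorff_space_closed_disc: "Hausdorff_space (closed_disc n)"
  unfolding closed_disc_def
  by (simp add: Hausdorff_Euclidean_space Hausdorff_space_subtopology)

lemma disc_interior_Un_sphere: "disc_interior n \<union> disc_sphere n = topspace (closed_disc n)"
  and disc_interior_Int_sphere: "disc_interior n \<inter> disc_sphere n = {}"
  by (auto simp: disc_interior_def disc_sphere_def topspace_closed_disc)

lemma disc_interior_subset: "disc_interior n \<subseteq> topspace (closed_disc n)"
  and disc_sphere_subset: "disc_sphere n \<subseteq> topspace (closed_disc n)"
  by (auto simp: disc_interior_def disc_sphere_def)

section \<open>Radial stretching of the disc\<close>

definition disc_norm :: "nat \<Rightarrow> (nat \<Rightarrow> real) \<Rightarrow> real" where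
  "disc_norm n x = sqrt (\<Sum>i<n. (x i)\<^sup>2)"

text \<open>Dividing by the maximum rather than by the norm keeps the stretch continuous at the centre.\<close>

definition disc_stretch :: "nat \<Rightarrow> real \<Rightarrow> (nat \<Rightarrow> real) \<Rightarrow> nat \<Rightarrow> real" where
  "disc_stretch n s x = (\<lambda>i. (1 + s) / max 1 ((1 + s) * disc_norm n x) * x i)"

lemma disc_norm_nonneg [simp]: "0 \<le> disc_norm n x"
  by (simp add: disc_norm_def sum_nonneg)

lemma disc_norm_scale: "disc_norm n (\<lambda>i. c * x i) = \<bar>c\<bar> * disc_norm n x"
  by (simp add: disc_norm_def power_mult_distrib real_sqrt_mult flip: sum_distrib_left)

lemma mem_closed_disc: "x \<in> topspace (closed_disc n) \<longleftrightarrow> (\<forall>i\<ge>n. x i = 0) \<and> disc_norm n x \<le> 1"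
  by (auto simp: topspace_closed_disc disc_norm_def)

lemma mem_disc_interior: "x \<in> disc_interior n \<longleftrightarrow> x \<in> topspace (closed_disc n) \<and> disc_norm n x < 1"
  by (auto simp: disc_interior_def disc_norm_def)

lemma mem_disc_sphere: "x \<in> disc_sphere n \<longleftrightarrow> x \<in> topspace (closed_disc n) \<and> disc_norm n x = 1"
  by (auto simp: disc_sphere_def disc_norm_def)

text \<open>The factor \<open>1 + s\<close> grows to 2, so at time 1 exactly the points of norm at
  least 1/2 have reached the sphere. This is the origin of the radius 1/2 in
  \<open>core\<close>.\<close>

lemma disc_norm_stretch:
  assumes "0 \<le> s" shows "disc_norm n (disc_stretch n s x) = min 1 ((1 + s) * disc_norm n x)"
proof -
  have "0 \<le> (1 + s) / max 1 ((1 + s) * disc_norm n x)"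
    using assms by (simp add: max_def)
  then show ?thesis
    unfolding disc_stretch_def disc_norm_scale
    by (auto simp: max_def min_def field_simps)
qed

lemma disc_stretch_in_disc:
  "x \<in> topspace (closed_disc n) \<Longrightarrow> 0 \<le> s \<Longrightarrow> disc_stretch n s x \<in> topspace (closed_disc n)"
  by (auto simp: mem_closed_disc disc_norm_stretch) (simp add: disc_stretch_def)

lemma disc_stretch_0: "x \<in> topspace (closed_disc n) \<Longrightarrow> disc_stretch n 0 x = x"
  by (auto simp: disc_stretch_def mem_closed_disc max_def)

lemma disc_stretch_sphere: "x \<in> disc_sphere n \<Longrightarrow> 0 \<le> s \<Longrightarrow> disc_stretch n s x = x"
  by (auto simp: disc_stretch_def mem_disc_sphere max_def)

lemma continuous_map_disc_norm:
  "continuous_map (closed_disc n) euclideanreal (disc_norm n)"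
  unfolding disc_norm_def [abs_def]
  by (intro continuous_intros continuous_map_closed_disc_component) auto

lemma continuous_map_disc_stretch:
  "continuous_map (prod_topology (top_of_set {0..1}) (closed_disc n)) (closed_disc n)
     (\<lambda>(s, x). disc_stretch n s x)"
proof (rule continuous_map_into_closed_disc)
  let ?P = "prod_topology (top_of_set {0..1::real}) (closed_disc n)"
  have f: "continuous_map ?P euclideanreal fst"
    using continuous_map_fst continuous_map_into_fulltopology by blast
  have x: "continuous_map ?P euclideanreal (\<lambda>z. snd z i)" for i
    using continuous_map_compose [OF continuous_map_snd continuous_map_closed_disc_component]
    by (simp add: o_def)
  have nrm: "continuous_map ?P euclideanreal (\<lambda>z. disc_norm n (snd z))"
    using continuous_map_compose [OF continuous_map_snd continuous_map_disc_norm]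
    by (simp add: o_def)
  have "continuous_map ?P euclideanreal
      (\<lambda>z. (1 + fst z) / max 1 ((1 + fst z) * disc_norm n (snd z)) * snd z i)" for i
    by (intro continuous_intros f x nrm continuous_map_real_max) (auto simp: max_def)
  then show "continuous_map ?P euclideanreal (\<lambda>z. (case z of (s, x) \<Rightarrow> disc_stretch n s x) i)" for i
    by (simp add: disc_stretch_def case_prod_unfold)
  show "(\<lambda>(s, x). disc_stretch n s x) ` topspace ?P \<subseteq> topspace (closed_disc n)"
    by (auto intro: disc_stretch_in_disc)
qed


section \<open>The stretch transported to an open cell of a Hausdorff space\<close>

lemma closed_map_compact_Hausdorff:
  "compact_space X \<Longrightarrow> Hausdorff_space Y \<Longrightarrow> continuous_map X Y f \<Longrightarrow> closed_map X Y f"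
  by (meson closed_map_def closedin_compact_space compactin_imp_closedin image_compactin)

text \<open>The interface is kept free of CW structure so that it can be instantiated with the
  closure of a cell, with a union of cells in which \<sigma> has top dimension, and with the disc
  itself.\<close>

locale open_cell =
  fixes X :: "'a topology" and \<sigma> :: "'a set" and n :: nat and \<phi> :: "(nat \<Rightarrow> real) \<Rightarrow> 'a"
  assumes Hausdorff: "Hausdorff_space X"
    and open_cell: "openin X \<sigma>"
    and continuous: "continuous_map (closed_disc n) X \<phi>"
    and homeomorphic:
      "homeomorphic_map (subtopology (closed_disc n) (disc_interior n)) (subtopology X \<sigma>) \<phi>"
    and sphere: "\<phi> ` disc_sphere n \<inter> \<sigma> = {}"
begin

text \<open>Excision cannot remove all of \<open>X - \<sigma>\<close> from the pair
  \<open>(X, X - \<sigma>)\<close>, since that would need room between the two sets. Shrinking the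
  cell to its open part of radius 1/2 creates this room.\<close>

definition core :: "'a set" where
  "core = \<phi> ` {x \<in> topspace (closed_disc n). disc_norm n x < 1/2}"

text \<open>
  As \<open>\<phi>\<close> need not be injective on the sphere, \<open>push\<close> is defined through the interior; its continuity comes
  from the closed quotient map \<open>id \<times> \<phi>\<close>.
\<close>

definition push :: "real \<times> 'a \<Rightarrow> 'a" where
  "push = (\<lambda>(s, y). if y \<in> \<sigma> then \<phi> (disc_stretch n s (inv_into (disc_interior n) \<phi> y)) else y)"

lemma cell_subset: "\<sigma> \<subseteq> topspace X"
  using open_cell openin_subset by blast

lemma image_interior: "\<phi> ` disc_interior n = \<sigma>"
  using homeomorphic_imp_surjective_map [OF homeomorphic] cell_subset disc_interior_subset [of n]
  by (simp add: Int_absorb1)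

lemma inj_interior: "inj_on \<phi> (disc_interior n)"
  using homeomorphic_imp_injective_map [OF homeomorphic] disc_interior_subset [of n]
  by (simp add: Int_absorb1)

lemma in_cell_iff: "x \<in> topspace (closed_disc n) \<Longrightarrow> \<phi> x \<in> \<sigma> \<longleftrightarrow> x \<in> disc_interior n"
  using image_interior sphere disc_interior_Un_sphere [of n] by blast

lemma image_subset: "\<phi> ` topspace (closed_disc n) \<subseteq> topspace X"
  using continuous by (simp add: continuous_map_image_subset_topspace)

text \<open>On the sphere both sides are \<open>\<phi> x\<close>, because the stretch fixes the
  sphere pointwise and \<open>\<phi> x\<close> lies outside the cell. So the identity holds on the
  whole disc although \<phi> may identify points there.\<close>

lemma push_phi:
  assumes "x \<in> topspace (closed_disc n)" "0 \<le> s"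
  shows "push (s, \<phi> x) = \<phi> (disc_stretch n s x)"
proof (cases "x \<in> disc_interior n")
  case True
  then show ?thesis
    using in_cell_iff assms inj_interior by (simp add: push_def inv_into_f_f)
next
  case False
  then show ?thesis
    using in_cell_iff [OF assms(1)] assms disc_interior_Un_sphere [of n]
    by (auto simp: push_def disc_stretch_sphere)
qed

lemma push_outside: "y \<notin> \<sigma> \<Longrightarrow> push (s, y) = y"
  by (simp add: push_def)

lemma push_0: "push (0, y) = y"
proof (cases "y \<in> \<sigma>")
  case True
  then obtain x where "x \<in> disc_interior n" "y = \<phi> x"
    using image_interior by blast
  then show ?thesis
    using push_phi [of x 0] disc_interior_subset [of n] by (auto simp: disc_stretch_0)
qed (simp add: push_outside)

lemma closedin_image:
  assumes "closedin (closed_disc n) S" shows "closedin X (\<phi> ` S)"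
  using assms closed_map_compact_Hausdorff [OF compact_space_closed_disc Hausdorff continuous]
  unfolding closed_map_def by blast

lemma continuous_map_push: "continuous_map (prod_topology (top_of_set {0..1}) X) X push"
proof -
  let ?I = "top_of_set {0..1::real}" and ?D = "closed_disc n"
  let ?E = "\<phi> ` topspace ?D"
  let ?T = "\<lambda>b::bool. {0..1::real} \<times> (if b then topspace X - \<sigma> else ?E)"
  have closedE: "closedin X ?E"
    by (simp add: closedin_image)
  have closed: "closedin (prod_topology ?I X) (?T b)" for b
    using closedE open_cell by (auto simp: closedin_prod_Times_iff)
  have contE: "continuous_map (prod_topology ?I (subtopology X ?E)) X push"
  proof (rule continuous_compose_quotient_map)
    let ?q = "\<lambda>(s, x). (s, \<phi> x)"
    have cq: "continuous_map (prod_topology ?I ?D) (prod_topology ?I (subtopology X ?E)) ?q"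
      using continuous by (auto intro!: continuous_map_prod_top [THEN iffD2] simp: continuous_map_in_subtopology)
    have haus: "Hausdorff_space (prod_topology ?I (subtopology X ?E))"
      by (simp add: Hausdorff_space_prod_topology Hausdorff Hausdorff_space_subtopology)
    have comp: "compact_space (prod_topology ?I ?D)"
      by (simp add: compact_space_prod_topology compact_space_closed_disc compact_space_subtopology)
    \<comment> \<open>A continuous surjection from a compact space to a Hausdorff space is closed,
      hence a quotient map. Applied directly to the product with the interval, this gives continuity
      of \<open>push\<close> in both variables at once.\<close>
    show "quotient_map (prod_topology ?I ?D) (prod_topology ?I (subtopology X ?E)) ?q"
    proof (rule continuous_closed_imp_quotient_map [OF cq closed_map_compact_Hausdorff [OF comp haus cq]])
      show "?q ` topspace (prod_topology ?I ?D) = topspace (prod_topology ?I (subtopology X ?E))"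
        using image_subset by (auto simp: image_iff)
    qed
    have "continuous_map (prod_topology ?I ?D) X (\<phi> \<circ> (\<lambda>(s, x). disc_stretch n s x))"
      by (rule continuous_map_compose [OF continuous_map_disc_stretch continuous])
    then show "continuous_map (prod_topology ?I ?D) X (push \<circ> ?q)"
      by (rule continuous_map_eq) (auto simp: push_phi)
  qed
  have contO: "continuous_map (prod_topology ?I (subtopology X (topspace X - \<sigma>))) X push"
  proof -
    have "continuous_map (prod_topology ?I (subtopology X (topspace X - \<sigma>))) X snd"
      using continuous_map_snd continuous_map_into_fulltopology by blast
    then show ?thesis
      by (rule continuous_map_eq) (auto simp: push_outside)
  qed
  have top: "subtopology (prod_topology ?I X) ({0..1} \<times> S) = prod_topology ?I (subtopology X S)" for S
    by (simp add: prod_topology_subtopology subtopology_subtopology Times_Int_Times)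
  show ?thesis
  proof (rule pasting_lemma_closed [of "UNIV :: bool set" _ ?T _ "\<lambda>_. push"])
    show "continuous_map (subtopology (prod_topology ?I X) (?T b)) X push" for b
      using contE contO by (cases b) (simp_all add: top)
    have "topspace X \<subseteq> (topspace X - \<sigma>) \<union> ?E"
      using image_interior disc_interior_subset [of n] by blast
    then show "\<exists>j. j \<in> UNIV \<and> x \<in> ?T j \<and> push x = push x"
      if "x \<in> topspace (prod_topology ?I X)" for x
      using that by (auto intro: exI [of _ True] exI [of _ False])
  qed (use closed in auto)
qed

lemma core_subset: "core \<subseteq> \<sigma>"
  unfolding core_def using image_interior by (auto simp: mem_disc_interior)

lemma phi_in_core_iff:
  assumes "x \<in> topspace (closed_disc n)" shows "\<phi> x \<in> core \<longleftrightarrow> disc_norm n x < 1/2"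
proof
  assume *: "\<phi> x \<in> core"
  then have "x \<in> disc_interior n"
    using assms core_subset in_cell_iff by blast
  with * show "disc_norm n x < 1/2"
    unfolding core_def using inj_onD [OF inj_interior, of x] by (force simp: mem_disc_interior)
qed (use assms in \<open>auto simp: core_def\<close>)

text \<open>\<open>push\<close> is a homotopy from the identity to \<open>g\<close> that preserves
  both \<open>X - \<sigma>\<close> and \<open>X - core\<close> throughout, and \<open>g\<close> maps
  the larger complement into the smaller one. Hence \<open>g\<close> is a homotopy inverse of the
  inclusion of pairs.\<close>

lemma iso_shrink_cell:
  "hom_induced p X (topspace X - \<sigma>) X (topspace X - core) id \<in>
     iso (relative_homology_group p X (topspace X - \<sigma>)) (relative_homology_group p X (topspace X - core))"
proof -
  let ?I = "top_of_set {0..1::real}"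
  define g where "g = (\<lambda>y. push (1, y))"
  \<comment> \<open>The boolean selects one of the two complements. Norms never decrease under the
    stretch, so a point outside the core stays outside; points outside the cell do not move.\<close>
  have out: "push (s, y) \<in> topspace X - (if b then \<sigma> else core)"
    if "y \<in> topspace X - (if b then \<sigma> else core)" "s \<in> {0..1}" for s y b
  proof (cases "y \<in> \<sigma>")
    case True
    with that have b: "\<not> b" and y: "y \<notin> core" and s: "0 \<le> s"
      by (auto split: if_splits)
    from True obtain x where x: "x \<in> topspace (closed_disc n)" "y = \<phi> x"
      using image_interior disc_interior_subset [of n] by blast
    have "\<not> disc_norm n x < 1/2"
      using phi_in_core_iff x y by blast
    moreover have "disc_norm n x * 1 \<le> (1 + s) * disc_norm n x"
      using mult_right_mono [of 1 "1 + s" "disc_norm n x"] s by simp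
    ultimately have "\<not> disc_norm n (disc_stretch n s x) < 1/2"
      unfolding disc_norm_stretch [OF s] by linarith
    then have "\<phi> (disc_stretch n s x) \<notin> core"
      using phi_in_core_iff [OF disc_stretch_in_disc [OF x(1) s]] by blast
    moreover have "\<phi> (disc_stretch n s x) \<in> topspace X"
      using image_subset disc_stretch_in_disc [OF x(1) s] by blast
    ultimately show ?thesis
      using b by (simp add: x(2) push_phi [OF x(1) s])
  qed (use that in \<open>auto simp: push_outside\<close>)
  \<comment> \<open>A point of the cell outside the core has norm at least 1/2, so doubling carries
    it to the sphere, whose image misses \<sigma>.\<close>
  have g: "g \<in> (topspace X - core) \<rightarrow> topspace X - \<sigma>"
  proof
    fix y assume y: "y \<in> topspace X - core"
    show "g y \<in> topspace X - \<sigma>"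
    proof (cases "y \<in> \<sigma>")
      case True
      from True obtain x where x: "x \<in> topspace (closed_disc n)" "y = \<phi> x"
        using image_interior disc_interior_subset [of n] by blast
      have "\<not> disc_norm n x < 1/2"
        using phi_in_core_iff x y by blast
      then have "disc_norm n (disc_stretch n 1 x) = 1"
        by (simp add: disc_norm_stretch)
      then have "disc_stretch n 1 x \<in> disc_sphere n"
        using disc_stretch_in_disc [OF x(1)] by (simp add: mem_disc_sphere)
      then have "\<phi> (disc_stretch n 1 x) \<notin> \<sigma>"
        using sphere by blast
      moreover have "\<phi> (disc_stretch n 1 x) \<in> topspace X"
        using image_subset disc_stretch_in_disc [OF x(1), of 1] by auto
      ultimately show ?thesis
        using push_phi [OF x(1), of 1] by (simp add: x(2) g_def)
    qed (use y in \<open>auto simp: g_def push_outside\<close>)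
  qed
  have homot: "homotopic_with (\<lambda>h. h \<in> T \<rightarrow> T) X X id g"
    if T: "T = topspace X - \<sigma> \<or> T = topspace X - core" for T
    unfolding homotopic_with_def
  proof (intro exI conjI allI ballI)
    show "continuous_map (prod_topology ?I X) X push"
      by (rule continuous_map_push)
    show "push (0, x) = id x" "push (1, x) = g x" for x
      by (simp_all add: push_0 g_def)
    show "(\<lambda>x. push (t, x)) \<in> T \<rightarrow> T" if "t \<in> {0..1}" for t
      using T out [of _ True t] out [of _ False t] that by auto
  qed
  have cg: "continuous_map X X g"
    using homotopic_with_imp_continuous_maps [OF homot [of "topspace X - core"]] by simp
  show ?thesis
  proof (rule homotopy_equivalence_relative_homology_group_isomorphism)
    show "continuous_map X X id"
      by simp
    show "id \<in> (topspace X - \<sigma>) \<rightarrow> topspace X - core"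
      using core_subset by auto
    show "homotopic_with (\<lambda>h. h \<in> topspace X - \<sigma> \<rightarrow> topspace X - \<sigma>) X X (g \<circ> id) id"
      unfolding comp_id by (rule homotopic_with_symD, rule homot) simp
    show "homotopic_with (\<lambda>h. h \<in> topspace X - core \<rightarrow> topspace X - core) X X (id \<circ> g) id"
      unfolding id_comp by (rule homotopic_with_symD, rule homot) simp
  qed (fact cg g)+
qed

text \<open>The image \<open>C\<close> of the closed disc of radius 1/2 is closed and lies between
  \<open>core\<close> and \<sigma>. Its complement is open, contains the closed set
  \<open>X - \<sigma>\<close> and lies in \<open>X - core\<close>, which is the hypothesis of
  excision.\<close>

lemma iso_excise_outside:
  "hom_induced p (subtopology X \<sigma>) (\<sigma> - core) X (topspace X - core) id \<in>
     iso (relative_homology_group p (subtopology X \<sigma>) (\<sigma> - core)) (relative_homology_group p X (topspace X - core))"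
proof -
  define C where "C = \<phi> ` {x \<in> topspace (closed_disc n). disc_norm n x \<in> {..1/2}}"
  have "closedin (closed_disc n) {x \<in> topspace (closed_disc n). disc_norm n x \<in> {..1/2}}"
    by (rule closedin_continuous_map_preimage [OF continuous_map_disc_norm]) simp
  then have "closedin X C"
    unfolding C_def by (rule closedin_image)
  moreover have "core \<subseteq> C"
    unfolding core_def C_def by (intro image_mono) auto
  ultimately have "topspace X - C \<subseteq> X interior_of (topspace X - core)"
    by (intro interior_of_maximal) auto
  moreover have "C \<subseteq> \<sigma>"
    unfolding C_def image_interior [symmetric] by (intro image_mono) (auto simp: mem_disc_interior)
  ultimately have "topspace X - \<sigma> \<subseteq> X interior_of (topspace X - core)"
    by blast
  moreover have "X closure_of (topspace X - \<sigma>) = topspace X - \<sigma>"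
    using open_cell by (intro closure_of_closedin closedin_diff) auto
  ultimately have "X closure_of (topspace X - \<sigma>) \<subseteq> X interior_of (topspace X - core)"
    by simp
  from homology_excision_axiom [OF this Diff_subset, of p]
  have "hom_induced p (subtopology X (topspace X - (topspace X - \<sigma>))) (topspace X - core - (topspace X - \<sigma>))
      (subtopology X (topspace X)) (topspace X - core) id
    \<in> iso (relative_homology_group p (subtopology X (topspace X - (topspace X - \<sigma>)))
             (topspace X - core - (topspace X - \<sigma>)))
          (relative_homology_group p (subtopology X (topspace X)) (topspace X - core))" .
  moreover have "topspace X - (topspace X - \<sigma>) = \<sigma>"
    using cell_subset by blast
  moreover have "topspace X - core - (topspace X - \<sigma>) = \<sigma> - core"
    using cell_subset by blast
  ultimately show ?thesis
    by (simp only: subtopology_topspace)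
qed

end

section \<open>Comparison of a cell with the standard disc\<close>

lemma openin_disc_interior: "openin (closed_disc n) (disc_interior n)"
proof -
  have "openin (closed_disc n) {x \<in> topspace (closed_disc n). disc_norm n x \<in> {..<1}}"
    by (rule openin_continuous_map_preimage [OF continuous_map_disc_norm]) auto
  moreover have "disc_interior n = {x \<in> topspace (closed_disc n). disc_norm n x \<in> {..<1}}"
    using mem_disc_interior by auto
  ultimately show ?thesis
    by simp
qed

text \<open>The disc is an instance of the same interface, so shrinking and excision are available
  on the source of the characteristic map as well as on its target.\<close>

lemma open_cell_disc: "open_cell (closed_disc n) (disc_interior n) n id"
  by unfold_locales
    (use disc_interior_Int_sphere in \<open>auto simp: Hausdorff_space_closed_disc openin_disc_interior homeomorphic_map_id\<close>)

text \<open>A chase through two adjacent squares: the rows are \<open>A\<close> to \<open>B\<close>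
  from \<open>C\<close> and \<open>A'\<close> to \<open>B'\<close> from \<open>C'\<close>, with
  vertical maps \<open>f\<close>, \<open>g\<close>, \<open>c\<close>. All horizontal maps and
  \<open>c\<close> are bijective, hence so is \<open>g\<close>, and then \<open>f\<close>.\<close>

lemma bij_betw_square:
  assumes "bij_betw a A B" "bij_betw b C B" "bij_betw c C C'" "bij_betw b' C' B'" "bij_betw a' A' B'"
    and "\<And>x. x \<in> C \<Longrightarrow> g (b x) = b' (c x)" "\<And>x. x \<in> A \<Longrightarrow> g (a x) = a' (f x)" "f \<in> A \<rightarrow> A'"
  shows "bij_betw f A A'"
proof -
  have "bij_betw (g \<circ> b) C B'"
    using bij_betw_trans [OF assms(3,4)] assms(6) by (subst bij_betw_cong [where g = "b' \<circ> c"]) auto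
  then have "bij_betw g B B'"
    using assms(2) by (metis bij_betw_comp_iff)
  then have "bij_betw (a' \<circ> f) A B'"
    using bij_betw_trans [OF assms(1)] assms(7) by (subst bij_betw_cong [where g = "g \<circ> a"]) auto
  then show ?thesis
    using assms(5,8) by (metis bij_betw_comp_iff2 funcset_image)
qed

context open_cell
begin

text \<open>Although \<phi> is not a homeomorphism on the disc, it is one on the interior. Shrinking
  and excision on both sides reduce the claim to the interior relative to the complement of the
  core.\<close>

lemma iso_characteristic_map:
  "hom_induced p (closed_disc n) (disc_sphere n) X (topspace X - \<sigma>) \<phi> \<in>
     iso (relative_homology_group p (closed_disc n) (disc_sphere n))
         (relative_homology_group p X (topspace X - \<sigma>))"
proof -
  interpret D: open_cell "closed_disc n" "disc_interior n" n id
    by (rule open_cell_disc)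
  let ?D = "closed_disc n" and ?i = "disc_interior n"
  have sph: "topspace ?D - ?i = disc_sphere n"
    using disc_interior_Un_sphere [of n] disc_interior_Int_sphere [of n] by blast
  have core0: "D.core = {x \<in> topspace ?D. disc_norm n x < 1/2}"
    by (simp add: D.core_def)
  have img: "\<phi> ` (?i - D.core) = \<sigma> - core"
    using image_interior phi_in_core_iff disc_interior_subset [of n] by (fastforce simp: core0)
  have cores: "\<phi> \<in> topspace ?D - D.core \<rightarrow> topspace X - core"
    using image_subset by (auto simp: core0 phi_in_core_iff)
  have spheres: "\<phi> \<in> disc_sphere n \<rightarrow> topspace X - \<sigma>"
    using image_subset sphere disc_sphere_subset [of n] by auto
  have conti: "continuous_map (subtopology ?D ?i) (subtopology X \<sigma>) \<phi>"
    by (rule homeomorphic_imp_continuous_map [OF homeomorphic])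
  have contid: "continuous_map (subtopology Y S) Y id" for Y :: "'z topology" and S
    by (simp add: continuous_map_from_subtopology)
  have "bij_betw (hom_induced p ?D (disc_sphere n) X (topspace X - \<sigma>) \<phi>)
      (carrier (relative_homology_group p ?D (disc_sphere n))) (carrier (relative_homology_group p X (topspace X - \<sigma>)))"
  proof (rule bij_betw_square)
    show "bij_betw (hom_induced p ?D (disc_sphere n) ?D (topspace ?D - D.core) id)
        (carrier (relative_homology_group p ?D (disc_sphere n)))
        (carrier (relative_homology_group p ?D (topspace ?D - D.core)))"
      using D.iso_shrink_cell [of p] by (simp add: iso_def sph)
    show "bij_betw (hom_induced p (subtopology ?D ?i) (?i - D.core) ?D (topspace ?D - D.core) id)
        (carrier (relative_homology_group p (subtopology ?D ?i) (?i - D.core)))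
        (carrier (relative_homology_group p ?D (topspace ?D - D.core)))"
      using D.iso_excise_outside [of p] by (simp add: iso_def)
    show "bij_betw (hom_induced p (subtopology ?D ?i) (?i - D.core) (subtopology X \<sigma>) (\<sigma> - core) \<phi>)
        (carrier (relative_homology_group p (subtopology ?D ?i) (?i - D.core)))
        (carrier (relative_homology_group p (subtopology X \<sigma>) (\<sigma> - core)))"
      using homeomorphic_map_relative_homology_iso [OF homeomorphic, of "?i - D.core"] img
        disc_interior_subset [of n] by (auto simp: iso_def)
    show "bij_betw (hom_induced p (subtopology X \<sigma>) (\<sigma> - core) X (topspace X - core) id)
        (carrier (relative_homology_group p (subtopology X \<sigma>) (\<sigma> - core)))
        (carrier (relative_homology_group p X (topspace X - core)))"
      using iso_excise_outside [of p] by (simp add: iso_def)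
    show "bij_betw (hom_induced p X (topspace X - \<sigma>) X (topspace X - core) id)
        (carrier (relative_homology_group p X (topspace X - \<sigma>)))
        (carrier (relative_homology_group p X (topspace X - core)))"
      using iso_shrink_cell [of p] by (simp add: iso_def)
    show "hom_induced p ?D (topspace ?D - D.core) X (topspace X - core) \<phi>
         (hom_induced p (subtopology ?D ?i) (?i - D.core) ?D (topspace ?D - D.core) id x) =
        hom_induced p (subtopology X \<sigma>) (\<sigma> - core) X (topspace X - core) id
         (hom_induced p (subtopology ?D ?i) (?i - D.core) (subtopology X \<sigma>) (\<sigma> - core) \<phi> x)" for x
      using cores img cell_subset disc_interior_subset [of n]
      by (subst (1 2) hom_induced_compose') (auto simp: continuous conti contid)
    show "hom_induced p ?D (topspace ?D - D.core) X (topspace X - core) \<phi>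
         (hom_induced p ?D (disc_sphere n) ?D (topspace ?D - D.core) id x) =
        hom_induced p X (topspace X - \<sigma>) X (topspace X - core) id
         (hom_induced p ?D (disc_sphere n) X (topspace X - \<sigma>) \<phi> x)" for x
      using cores spheres core_subset D.core_subset sph
      by (subst (1 2) hom_induced_compose') (auto simp: continuous)
    show "hom_induced p ?D (disc_sphere n) X (topspace X - \<sigma>) \<phi> \<in>
        carrier (relative_homology_group p ?D (disc_sphere n)) \<rightarrow>
        carrier (relative_homology_group p X (topspace X - \<sigma>))"
      by (intro Pi_I) (rule hom_in_carrier [OF hom_induced_hom])
  qed
  then show ?thesis
    by (simp add: iso_def hom_induced_hom)
qed

end

section \<open>Homology of the disc relative to its sphere\<close>

lemma contractible_space_closed_disc: "contractible_space (closed_disc n)"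
proof -
  let ?D = "closed_disc n"
  have "homotopic_with (\<lambda>h. True) ?D ?D (\<lambda>x i. 0) id"
    unfolding homotopic_with_def
  proof (intro exI conjI allI ballI)
    let ?P = "prod_topology (top_of_set {0..1::real}) ?D"
    show "continuous_map ?P ?D (\<lambda>(s, x) i. s * x i)"
    proof (rule continuous_map_into_closed_disc)
      have f: "continuous_map ?P euclideanreal fst"
        using continuous_map_fst continuous_map_into_fulltopology by blast
      have x: "continuous_map ?P euclideanreal (\<lambda>z. snd z i)" for i
        using continuous_map_compose [OF continuous_map_snd continuous_map_closed_disc_component]
        by (simp add: o_def)
      show "continuous_map ?P euclideanreal (\<lambda>z. (case z of (s, x) \<Rightarrow> \<lambda>i. s * x i) i)" for i
        using continuous_map_real_mult [OF f x] by (simp add: case_prod_unfold)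
      show "(\<lambda>(s, x) i. s * x i) ` topspace ?P \<subseteq> topspace ?D"
        by (auto simp: mem_closed_disc disc_norm_scale mult_le_one)
    qed
  qed auto
  then show ?thesis
    unfolding contractible_space_def using homotopic_with_symD by fastforce
qed

lemma subtopology_disc_sphere: "subtopology (closed_disc (Suc n)) (disc_sphere (Suc n)) = nsphere n"
proof -
  have "subtopology (closed_disc (Suc n)) (disc_sphere (Suc n)) =
      subtopology (Euclidean_space (Suc n)) ({x. (\<Sum>i<Suc n. (x i)\<^sup>2) \<le> 1} \<inter> disc_sphere (Suc n))"
    by (simp add: closed_disc_def subtopology_subtopology)
  also have "\<dots> = subtopology (Euclidean_space (Suc n)) {x. (\<Sum>i\<le>n. (x i)\<^sup>2) = 1}"
    by (subst (1 2) subtopology_restrict [symmetric], rule arg_cong [of _ _ "subtopology _"])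
      (auto simp: disc_sphere_def closed_disc_def lessThan_Suc_atMost)
  finally show ?thesis
    by (simp add: nsphere_def)
qed

lemma relative_homology_disc_sphere:
  "relative_homology_group (int n) (closed_disc n) (disc_sphere n) \<cong> integer_group"
proof (cases n)
  \<comment> \<open>In dimension 0 the disc is a point and its sphere is empty, so the group is the
    homology of a point; the comparison with the reduced homology of a sphere starts in dimension
    1.\<close>
  case 0
  have "topspace (closed_disc 0) = {\<lambda>i. 0}"
    by (auto simp: topspace_closed_disc)
  moreover have "disc_sphere 0 = {}"
    by (auto simp: disc_sphere_def)
  ultimately show ?thesis
    using 0 homology_coefficients by fastforce
next
  case (Suc m)
  \<comment> \<open>A unit vector: the isomorphism for a contractible space relative to a subspace
    requires the subspace to be nonempty.\<close>
  have "(\<lambda>i. if i = 0 then 1 else 0) \<in> disc_sphere (Suc m)"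
    by (auto simp: disc_sphere_def topspace_closed_disc if_distrib [of "\<lambda>x. x ^ 2"] cong: if_cong)
  then have "topspace (closed_disc n) \<inter> disc_sphere n \<noteq> {}"
    using disc_sphere_subset Suc by blast
  then have "relative_homology_group (int n) (closed_disc n) (disc_sphere n) \<cong> reduced_homology_group (int m) (nsphere m)"
    using isomorphic_group_relative_homology_of_contractible [OF contractible_space_closed_disc, of n "disc_sphere n" "int n"]
      Suc by (simp add: subtopology_disc_sphere)
  then show ?thesis
    using reduced_homology_group_nsphere(1) iso_trans by blast
qed

section \<open>Orientations and incidence coefficients of a finite CW complex\<close>

text \<open>Under an isomorphism \<open>h\<close> to the integers the powers of \<open>e\<close>
  become the multiples of \<open>h e\<close>. This number is nonzero because 1 is among its
  multiples.\<close>

lemma infinite_cyclic_powers: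
  assumes "group G" "G \<cong> integer_group" "e \<in> carrier G" "generate G {e} = carrier G"
  shows "\<And>x. x \<in> carrier G \<Longrightarrow> \<exists>m::int. x = e [^]\<^bsub>G\<^esub> m"
    and "\<And>m k :: int. e [^]\<^bsub>G\<^esub> m = e [^]\<^bsub>G\<^esub> k \<Longrightarrow> m = k"
proof -
  interpret group G by fact
  show ex: "\<exists>m::int. x = e [^]\<^bsub>G\<^esub> m" if "x \<in> carrier G" for x
    using that unfolding assms(4) [symmetric] generate_pow [OF assms(3)] by blast
  obtain h where h: "h \<in> iso G integer_group"
    using assms(2) by (auto simp: is_iso_def)
  have pow: "h (e [^]\<^bsub>G\<^esub> m) = m * h e" for m :: int
    using hom_int_pow [of h G integer_group e m] h assms(1,3)
    by (simp add: iso_def)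
  have "1 \<in> h ` carrier G"
    using h by (simp add: iso_def bij_betw_def)
  then obtain x where "x \<in> carrier G" "h x = 1"
    by auto
  moreover from this obtain k :: int where "x = e [^]\<^bsub>G\<^esub> k"
    using ex by blast
  ultimately have "1 = k * h e"
    using pow [of k] by simp
  then have "h e \<noteq> 0"
    by auto
  then show "m = k" if "e [^]\<^bsub>G\<^esub> m = e [^]\<^bsub>G\<^esub> k" for m k :: int
  proof -
    have "m * h e = k * h e"
      unfolding pow [symmetric] that ..
    with \<open>h e \<noteq> 0\<close> show ?thesis
      by simp
  qed
qed

text \<open>Two out of three: the characteristic map induces isomorphisms into both spaces, and the
  second factors through the first by the inclusion.\<close>

lemma iso_inclusion_open_cell:
  assumes "open_cell Y \<sigma> n \<phi>" "open_cell Z \<sigma> n \<phi>" "continuous_map Y Z id"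
  shows "hom_induced p Y (topspace Y - \<sigma>) Z (topspace Z - \<sigma>) id \<in>
    iso (relative_homology_group p Y (topspace Y - \<sigma>)) (relative_homology_group p Z (topspace Z - \<sigma>))"
proof -
  interpret Y: open_cell Y \<sigma> n \<phi> by fact
  interpret Z: open_cell Z \<sigma> n \<phi> by fact
  let ?H = "relative_homology_group p (closed_disc n) (disc_sphere n)"
  let ?f = "hom_induced p (closed_disc n) (disc_sphere n) Y (topspace Y - \<sigma>) \<phi>"
  let ?g = "hom_induced p Y (topspace Y - \<sigma>) Z (topspace Z - \<sigma>) id"
  have sub: "topspace Y \<subseteq> topspace Z"
    using assms(3) by (metis continuous_map_image_subset_topspace image_id id_apply)
  have "\<phi> \<in> disc_sphere n \<rightarrow> topspace Y - \<sigma>"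
    using Y.image_subset Y.sphere disc_sphere_subset [of n] by blast
  moreover have "id \<in> topspace Y - \<sigma> \<rightarrow> topspace Z - \<sigma>"
    using sub by auto
  ultimately have "hom_induced p (closed_disc n) (disc_sphere n) Z (topspace Z - \<sigma>) \<phi> = ?g \<circ> ?f"
    using hom_induced_compose [OF Y.continuous _ assms(3), of "disc_sphere n" "topspace Y - \<sigma>" "topspace Z - \<sigma>" p]
    by simp
  then have "bij_betw (?g \<circ> ?f) (carrier ?H) (carrier (relative_homology_group p Z (topspace Z - \<sigma>)))"
    using Z.iso_characteristic_map [of p] by (simp add: iso_def)
  moreover have "bij_betw ?f (carrier ?H) (carrier (relative_homology_group p Y (topspace Y - \<sigma>)))"
    using Y.iso_characteristic_map [of p] by (simp add: iso_def)
  ultimately show ?thesis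
    by (simp add: iso_def hom_induced_hom bij_betw_comp_iff)
qed

text \<open>Every point x of the disc is the limit of the interior points t x as t tends to 1 from
  below.\<close>

lemma closure_of_disc_interior: "closed_disc n closure_of disc_interior n = topspace (closed_disc n)"
proof (rule antisym [OF closure_of_subset_topspace subsetI])
  fix x assume x: "x \<in> topspace (closed_disc n)"
  let ?I = "top_of_set {0..1::real}" and ?f = "\<lambda>t i. t * x i"
  have cont: "continuous_map ?I (closed_disc n) ?f"
  proof (rule continuous_map_into_closed_disc)
    show "continuous_map ?I euclideanreal (\<lambda>t. t * x i)" for i
      by (simp add: continuous_map_iff_continuous continuous_intros)
    show "?f ` topspace ?I \<subseteq> topspace (closed_disc n)"
      using x by (auto simp: mem_closed_disc disc_norm_scale mult_le_one)
  qed
  have "1 \<in> closure {0..<1::real}"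
    by (simp add: closure_atLeastLessThan)
  then have "1 \<in> ?I closure_of {0..<1}"
    by (simp add: closure_of_subtopology Int_absorb1 atLeastLessThan_subseteq_atLeastAtMost_iff)
  then have "?f 1 \<in> closed_disc n closure_of (?f ` {0..<1})"
    using continuous_map_image_closure_subset [OF cont, of "{0..<1}"] by blast
  moreover have "?f ` {0..<1} \<subseteq> disc_interior n"
  proof clarify
    fix t :: real assume t: "t \<in> {0..<1}"
    then have "t * disc_norm n x < 1"
      using x mult_left_le [of "disc_norm n x" t] by (simp add: mem_closed_disc)
    then show "?f t \<in> disc_interior n"
      using t x by (auto simp: mem_disc_interior mem_closed_disc disc_norm_scale)
  qed
  ultimately have "?f 1 \<in> closed_disc n closure_of disc_interior n"
    using closure_of_mono by blast
  then show "x \<in> closed_disc n closure_of disc_interior n"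
    by simp
qed

lemma continuous_map_subtopology_id:
  "S \<subseteq> T \<Longrightarrow> continuous_map (subtopology Y S) (subtopology Y T) id"
  by (auto simp: continuous_map_in_subtopology continuous_map_from_subtopology)

section \<open>Cells of a fixed complex, their closures and orientations\<close>

locale oriented_complex =
  fixes K :: "('a, 'm) cw_complex_scheme"
  assumes cw: "finite_cw_complex K" and oriented: "oriented_cells K"
begin

definition chi :: "'a set \<Rightarrow> (nat \<Rightarrow> real) \<Rightarrow> 'a" where
  "chi \<sigma> = (SOME \<phi>. characteristic_map K \<sigma> \<phi>)"

lemma finite_cells: "finite (cw_cells K)"
  and Hausdorff: "Hausdorff_space (cw_space K)"
  and Union_cells: "\<Union>(cw_cells K) = topspace (cw_space K)"
  using cw by (auto simp: finite_cw_complex_def)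

lemma cells_disjoint: "\<sigma> \<in> cw_cells K \<Longrightarrow> \<tau> \<in> cw_cells K \<Longrightarrow> x \<in> \<sigma> \<Longrightarrow> x \<in> \<tau> \<Longrightarrow> \<sigma> = \<tau>"
  using cw by (meson disjnt_iff finite_cw_complex_def pairwiseD)

lemma cell_subset: "\<sigma> \<in> cw_cells K \<Longrightarrow> \<sigma> \<subseteq> topspace (cw_space K)"
  using Union_cells by blast

context
  fixes \<sigma> assumes cell: "\<sigma> \<in> cw_cells K"
begin

lemma characteristic_map_chi: "characteristic_map K \<sigma> (chi \<sigma>)"
proof -
  obtain \<phi> where "characteristic_map K \<sigma> \<phi>"
    using cw cell unfolding finite_cw_complex_def by blast
  then show ?thesis
    unfolding chi_def by (rule someI [of "characteristic_map K \<sigma>"])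
qed

lemma continuous_chi: "continuous_map (closed_disc (cw_dim K \<sigma>)) (cw_space K) (chi \<sigma>)"
  and homeomorphic_chi:
    "homeomorphic_map (subtopology (closed_disc (cw_dim K \<sigma>)) (disc_interior (cw_dim K \<sigma>)))
       (subtopology (cw_space K) \<sigma>) (chi \<sigma>)"
  and chi_sphere: "chi \<sigma> ` disc_sphere (cw_dim K \<sigma>) \<subseteq> \<Union>{\<tau> \<in> cw_cells K. cw_dim K \<tau> < cw_dim K \<sigma>}"
  using characteristic_map_chi by (auto simp: characteristic_map_def)

lemma chi_interior: "chi \<sigma> ` disc_interior (cw_dim K \<sigma>) = \<sigma>"
  using homeomorphic_imp_surjective_map [OF homeomorphic_chi] cell_subset [OF cell]
    disc_interior_subset [of "cw_dim K \<sigma>"]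
  by (simp add: Int_absorb1)

text \<open>Together with disjointness this makes containment of a cell in a union of cells
  equivalent to membership in the family.\<close>

lemma cell_nonempty: "\<sigma> \<noteq> {}"
proof -
  have "(\<lambda>i. 0) \<in> disc_interior (cw_dim K \<sigma>)"
    by (simp add: disc_interior_def topspace_closed_disc)
  then show ?thesis
    using chi_interior by blast
qed

lemma chi_sphere_disjoint: "chi \<sigma> ` disc_sphere (cw_dim K \<sigma>) \<inter> \<sigma> = {}"
proof -
  have "False" if "x \<in> \<sigma>" "x \<in> \<tau>" "\<tau> \<in> cw_cells K" "cw_dim K \<tau> < cw_dim K \<sigma>" for x \<tau>
    using cells_disjoint [OF cell that(3,1,2)] that(4) by simp
  then show ?thesis
    using chi_sphere by blast
qed

lemma closedin_chi_image:
  "closedin (closed_disc (cw_dim K \<sigma>)) S \<Longrightarrow> closedin (cw_space K) (chi \<sigma> ` S)"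
  using closed_map_compact_Hausdorff [OF compact_space_closed_disc Hausdorff continuous_chi]
  unfolding closed_map_def by blast

text \<open>One inclusion holds because the image of the compact disc is closed, the other because
  the interior is dense in the disc. The frontier is therefore the image of the sphere.\<close>

lemma cell_closure_eq: "cell_closure K \<sigma> = chi \<sigma> ` topspace (closed_disc (cw_dim K \<sigma>))"
proof
  show "cell_closure K \<sigma> \<subseteq> chi \<sigma> ` topspace (closed_disc (cw_dim K \<sigma>))"
    unfolding cell_closure_def
    by (rule closure_of_minimal)
      (use chi_interior disc_interior_subset in \<open>blast intro: closedin_chi_image closedin_topspace\<close>)+
  show "chi \<sigma> ` topspace (closed_disc (cw_dim K \<sigma>)) \<subseteq> cell_closure K \<sigma>"
    using continuous_map_image_closure_subset [OF continuous_chi, of "disc_interior (cw_dim K \<sigma>)"]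
    unfolding cell_closure_def closure_of_disc_interior chi_interior .
qed

lemma cell_subset_closure: "\<sigma> \<subseteq> cell_closure K \<sigma>"
  unfolding cell_closure_def by (rule closure_of_subset [OF cell_subset [OF cell]])

lemma cell_frontier_eq: "cell_frontier K \<sigma> = chi \<sigma> ` disc_sphere (cw_dim K \<sigma>)"
  unfolding cell_frontier_def cell_closure_eq disc_interior_Un_sphere [symmetric] image_Un chi_interior
  using chi_sphere_disjoint by blast

lemma closedin_cell_frontier: "closedin (cw_space K) (cell_frontier K \<sigma>)"
proof -
  have "disc_sphere n = topspace (closed_disc n) - disc_interior n" for n
    using disc_interior_Un_sphere [of n] disc_interior_Int_sphere [of n] by blast
  then have "closedin (closed_disc n) (disc_sphere n)" for n
    using openin_disc_interior [of n] by (simp add: closedin_diff)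
  then show ?thesis
    unfolding cell_frontier_eq by (rule closedin_chi_image)
qed

lemma closedin_cell_closure: "closedin (cw_space K) (cell_closure K \<sigma>)"
  by (simp add: cell_closure_def)

text \<open>The last hypothesis makes \<sigma> open in the subspace \<open>M\<close>; in the whole
  complex it need not be open, since cells of higher dimension may accumulate at it.\<close>

lemma open_cell_subtopology:
  assumes "cell_closure K \<sigma> \<subseteq> M" "M \<subseteq> topspace (cw_space K)" "closedin (cw_space K) (M - \<sigma>)"
  shows "open_cell (subtopology (cw_space K) M) \<sigma> (cw_dim K \<sigma>) (chi \<sigma>)"
proof
  have sM: "\<sigma> \<subseteq> M"
    using assms(1) cell_subset_closure by blast
  show "Hausdorff_space (subtopology (cw_space K) M)"
    by (simp add: Hausdorff Hausdorff_space_subtopology)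
  have "closedin (subtopology (cw_space K) M) (M - \<sigma>)"
    using assms by (simp add: closedin_subset_topspace)
  then show "openin (subtopology (cw_space K) M) \<sigma>"
    using sM assms(2) by (simp add: openin_closedin_eq Int_absorb1)
  show "continuous_map (closed_disc (cw_dim K \<sigma>)) (subtopology (cw_space K) M) (chi \<sigma>)"
    using continuous_chi assms(1) by (auto simp: continuous_map_in_subtopology cell_closure_eq)
  show "homeomorphic_map (subtopology (closed_disc (cw_dim K \<sigma>)) (disc_interior (cw_dim K \<sigma>)))
     (subtopology (subtopology (cw_space K) M) \<sigma>) (chi \<sigma>)"
    using homeomorphic_chi sM by (simp add: subtopology_subtopology Int_absorb1)
qed (rule chi_sphere_disjoint)

lemma open_cell_closure: "open_cell (subtopology (cw_space K) (cell_closure K \<sigma>)) \<sigma> (cw_dim K \<sigma>) (chi \<sigma>)"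
  using closedin_cell_frontier closedin_subset [OF closedin_cell_closure]
  by (intro open_cell_subtopology) (auto simp: cell_frontier_def)

text \<open>Inside its own closure the cell is open and its complement is the frontier, so the
  orientation group is the relative homology of the disc and its sphere.\<close>

lemma cell_homology_group_infinite_cyclic: "cell_homology_group K \<sigma> \<cong> integer_group"
proof -
  interpret open_cell "subtopology (cw_space K) (cell_closure K \<sigma>)" \<sigma> "cw_dim K \<sigma>" "chi \<sigma>"
    by (rule open_cell_closure)
  have "relative_homology_group (int (cw_dim K \<sigma>)) (closed_disc (cw_dim K \<sigma>)) (disc_sphere (cw_dim K \<sigma>))
      \<cong> cell_homology_group K \<sigma>"
    using iso_characteristic_map [of "int (cw_dim K \<sigma>)"] closedin_subset [OF closedin_cell_closure]
    by (auto simp: is_iso_def cell_homology_group_def cell_frontier_def Int_absorb1)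
  then show ?thesis
    using relative_homology_disc_sphere group.iso_sym iso_trans group_relative_homology_group by blast
qed

lemma orientation_powers:
  defines "G \<equiv> cell_homology_group K \<sigma>"
  shows "x \<in> carrier G \<Longrightarrow> \<exists>m::int. x = cw_orient K \<sigma> [^]\<^bsub>G\<^esub> m"
    and "cw_orient K \<sigma> [^]\<^bsub>G\<^esub> (m::int) = cw_orient K \<sigma> [^]\<^bsub>G\<^esub> k \<Longrightarrow> m = k"
  using infinite_cyclic_powers [of G "cw_orient K \<sigma>"] cell_homology_group_infinite_cyclic oriented cell
  by (auto simp: oriented_cells_def G_def cell_homology_group_def)

lemma orientation_carrier: "cw_orient K \<sigma> \<in> carrier (cell_homology_group K \<sigma>)"
  using oriented cell by (simp add: oriented_cells_def)

end


section \<open>Unions of cells that contain all cells of lower dimension\<close>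

lemma cell_frontier_subset:
  "\<sigma> \<in> cw_cells K \<Longrightarrow> cell_frontier K \<sigma> \<subseteq> \<Union>{\<tau> \<in> cw_cells K. cw_dim K \<tau> < cw_dim K \<sigma>}"
  using chi_sphere cell_frontier_eq by simp

lemma cell_closure_Un: "\<sigma> \<in> cw_cells K \<Longrightarrow> cell_closure K \<sigma> = \<sigma> \<union> cell_frontier K \<sigma>"
  using cell_subset_closure by (auto simp: cell_frontier_def)

text \<open>Frontiers are controlled only by dimension, so a family needs all lower-dimensional
  cells for its union to contain the closures of its members. Skeleta have this property, and keep
  it when cells of top dimension are removed.\<close>

definition dimension_closed :: "'a set set \<Rightarrow> bool" where
  "dimension_closed \<C> \<longleftrightarrow> \<C> \<subseteq> cw_cells K \<and>
     (\<forall>\<sigma>\<in>\<C>. \<forall>\<tau>\<in>cw_cells K. cw_dim K \<tau> < cw_dim K \<sigma> \<longrightarrow> \<tau> \<in> \<C>)"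

lemma cell_closure_subset_Union:
  assumes "dimension_closed \<C>" "\<sigma> \<in> \<C>" shows "cell_closure K \<sigma> \<subseteq> \<Union>\<C>"
proof -
  have "\<sigma> \<in> cw_cells K" "{\<tau> \<in> cw_cells K. cw_dim K \<tau> < cw_dim K \<sigma>} \<subseteq> \<C>"
    using assms by (auto simp: dimension_closed_def)
  then show ?thesis
    using cell_frontier_subset [of \<sigma>] cell_closure_Un [of \<sigma>] assms(2) by blast
qed

lemma closedin_Union_cells:
  assumes "dimension_closed \<C>" shows "closedin (cw_space K) (\<Union>\<C>)"
proof -
  have sub: "\<C> \<subseteq> cw_cells K"
    using assms by (simp add: dimension_closed_def)
  have "\<Union>\<C> = (\<Union>\<sigma>\<in>\<C>. cell_closure K \<sigma>)"
    using cell_closure_subset_Union [OF assms] cell_subset_closure sub by blast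
  moreover have "closedin (cw_space K) (\<Union>\<sigma>\<in>\<C>. cell_closure K \<sigma>)"
    using finite_subset [OF sub finite_cells] sub closedin_cell_closure
    by (intro closedin_Union) auto
  ultimately show ?thesis
    by simp
qed

lemma Union_minus_cell:
  assumes "\<C> \<subseteq> cw_cells K" "\<D> \<subseteq> cw_cells K" shows "\<Union>\<C> - \<Union>\<D> = \<Union>(\<C> - \<D>)"
  using cells_disjoint assms by blast

text \<open>Removing a cell of maximal dimension leaves a dimension closed family, whose union is
  closed; hence the cell is open in the union.\<close>

lemma open_cell_Union:
  assumes "dimension_closed \<C>" "\<sigma> \<in> \<C>" "\<And>\<tau>. \<tau> \<in> \<C> \<Longrightarrow> cw_dim K \<tau> \<le> cw_dim K \<sigma>"
  shows "open_cell (subtopology (cw_space K) (\<Union>\<C>)) \<sigma> (cw_dim K \<sigma>) (chi \<sigma>)"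
proof (rule open_cell_subtopology)
  show cell: "\<sigma> \<in> cw_cells K"
    using assms by (auto simp: dimension_closed_def)
  show "cell_closure K \<sigma> \<subseteq> \<Union>\<C>" "\<Union>\<C> \<subseteq> topspace (cw_space K)"
    using cell_closure_subset_Union closedin_subset [OF closedin_Union_cells] assms by auto
  have "dimension_closed (\<C> - {\<sigma>})"
    using assms by (fastforce simp: dimension_closed_def)
  moreover have "\<Union>\<C> - \<sigma> = \<Union>(\<C> - {\<sigma>})"
    using Union_minus_cell [of \<C> "{\<sigma>}"] cell assms(1) by (simp add: dimension_closed_def)
  ultimately show "closedin (cw_space K) (\<Union>\<C> - \<sigma>)"
    using closedin_Union_cells by simp
qed

lemma Union_subset_topspace: "dimension_closed \<C> \<Longrightarrow> \<Union>\<C> \<subseteq> topspace (cw_space K)"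
  using closedin_subset [OF closedin_Union_cells] .

lemma iso_cell_inclusion_Union:
  assumes "dimension_closed \<C>" "\<sigma> \<in> \<C>" "\<And>\<tau>. \<tau> \<in> \<C> \<Longrightarrow> cw_dim K \<tau> \<le> cw_dim K \<sigma>"
  shows "hom_induced p (subtopology (cw_space K) (cell_closure K \<sigma>)) (cell_frontier K \<sigma>)
       (subtopology (cw_space K) (\<Union>\<C>)) (\<Union>\<C> - \<sigma>) id \<in>
     iso (relative_homology_group p (subtopology (cw_space K) (cell_closure K \<sigma>)) (cell_frontier K \<sigma>))
         (relative_homology_group p (subtopology (cw_space K) (\<Union>\<C>)) (\<Union>\<C> - \<sigma>))"
proof -
  have cell: "\<sigma> \<in> cw_cells K"
    using assms by (auto simp: dimension_closed_def)
  from iso_inclusion_open_cell [OF open_cell_closure [OF cell] open_cell_Union [OF assms]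
      continuous_map_subtopology_id [OF cell_closure_subset_Union [OF assms(1,2)]], of p]
  show ?thesis
    using Union_subset_topspace [OF assms(1)] closedin_subset [OF closedin_cell_closure [OF cell]]
    by (simp add: Int_absorb1 cell_frontier_def)
qed

text \<open>Homology local at \<sigma> is insensitive to the other cells: both groups are identified
  with that of the same disc. This allows top cells to be removed one at a time.\<close>

lemma iso_Union_inclusion:
  assumes "dimension_closed \<C>" "dimension_closed \<D>" "\<C> \<subseteq> \<D>" "\<sigma> \<in> \<C>"
    and "\<And>\<tau>. \<tau> \<in> \<D> \<Longrightarrow> cw_dim K \<tau> \<le> cw_dim K \<sigma>"
  shows "hom_induced p (subtopology (cw_space K) (\<Union>\<C>)) (\<Union>\<C> - \<sigma>)
       (subtopology (cw_space K) (\<Union>\<D>)) (\<Union>\<D> - \<sigma>) id \<in>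
     iso (relative_homology_group p (subtopology (cw_space K) (\<Union>\<C>)) (\<Union>\<C> - \<sigma>))
         (relative_homology_group p (subtopology (cw_space K) (\<Union>\<D>)) (\<Union>\<D> - \<sigma>))"
proof -
  have C: "open_cell (subtopology (cw_space K) (\<Union>\<C>)) \<sigma> (cw_dim K \<sigma>) (chi \<sigma>)"
    using assms by (intro open_cell_Union) auto
  have D: "open_cell (subtopology (cw_space K) (\<Union>\<D>)) \<sigma> (cw_dim K \<sigma>) (chi \<sigma>)"
    using assms by (intro open_cell_Union) auto
  from iso_inclusion_open_cell [OF C D continuous_map_subtopology_id [OF Union_mono [OF assms(3)]], of p]
  show ?thesis
    using Union_subset_topspace [OF assms(1)] Union_subset_topspace [OF assms(2)]
    by (simp add: Int_absorb1)
qed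

section \<open>Local homology in skeleta and the incidence coefficients\<close>

definition skeleton_cells :: "nat \<Rightarrow> 'a set set" where
  "skeleton_cells n = {\<sigma> \<in> cw_cells K. cw_dim K \<sigma> \<le> n}"

lemma skeleton_eq: "skeleton K n = \<Union>(skeleton_cells n)"
  by (simp add: skeleton_def skeleton_cells_def)

lemma dimension_closed_skeleton: "dimension_closed (skeleton_cells n)"
  by (auto simp: dimension_closed_def skeleton_cells_def)

abbreviation skel :: "nat \<Rightarrow> 'a topology" where
  "skel n \<equiv> subtopology (cw_space K) (skeleton K n)"

definition local_group :: "'a set \<Rightarrow> 'a chain set monoid" where
  "local_group \<sigma> = relative_homology_group (int (cw_dim K \<sigma>)) (skel (cw_dim K \<sigma>)) (skeleton K (cw_dim K \<sigma>) - \<sigma>)"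

definition local_orient :: "'a set \<Rightarrow> 'a chain set" where
  "local_orient \<sigma> =
     hom_induced (int (cw_dim K \<sigma>)) (subtopology (cw_space K) (cell_closure K \<sigma>)) (cell_frontier K \<sigma>)
       (skel (cw_dim K \<sigma>)) (skeleton K (cw_dim K \<sigma>) - \<sigma>) id (cw_orient K \<sigma>)"

lemma group_local_group [simp]: "group (local_group \<sigma>)"
  by (simp add: local_group_def)

lemma local_orient_carrier: "local_orient \<sigma> \<in> carrier (local_group \<sigma>)"
  unfolding local_orient_def local_group_def
  using hom_induced_carrier by blast

text \<open>The inclusion of the closed cell into its skeleton induces an isomorphism onto
  \<open>local_group\<close>, taking powers of the orientation to powers of
  \<open>local_orient\<close>.\<close>

lemma local_orient_powers:
  assumes "\<sigma> \<in> cw_cells K"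
  shows "x \<in> carrier (local_group \<sigma>) \<Longrightarrow> \<exists>m::int. x = local_orient \<sigma> [^]\<^bsub>local_group \<sigma>\<^esub> m"
    and "local_orient \<sigma> [^]\<^bsub>local_group \<sigma>\<^esub> (m::int) = local_orient \<sigma> [^]\<^bsub>local_group \<sigma>\<^esub> k \<Longrightarrow> m = k"
proof -
  let ?G = "cell_homology_group K \<sigma>"
  define h where "h = hom_induced (int (cw_dim K \<sigma>)) (subtopology (cw_space K) (cell_closure K \<sigma>)) (cell_frontier K \<sigma>)
       (skel (cw_dim K \<sigma>)) (skeleton K (cw_dim K \<sigma>) - \<sigma>) id"
  have iso: "h \<in> iso ?G (local_group \<sigma>)"
    unfolding h_def skeleton_eq cell_homology_group_def local_group_def
    using assms dimension_closed_skeleton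
    by (intro iso_cell_inclusion_Union) (auto simp: skeleton_cells_def)
  have [simp]: "group ?G"
    by (simp add: cell_homology_group_def)
  have pow: "h (cw_orient K \<sigma> [^]\<^bsub>?G\<^esub> m) = local_orient \<sigma> [^]\<^bsub>local_group \<sigma>\<^esub> m" for m :: int
    using hom_int_pow [of h ?G "local_group \<sigma>" "cw_orient K \<sigma>" m] iso orientation_carrier [OF assms]
    by (simp add: iso_def local_orient_def h_def)
  show "\<exists>m::int. x = local_orient \<sigma> [^]\<^bsub>local_group \<sigma>\<^esub> m" if x: "x \<in> carrier (local_group \<sigma>)"
  proof -
    have "x \<in> h ` carrier ?G"
      using iso x by (simp add: iso_def bij_betw_def)
    then obtain y where "y \<in> carrier ?G" "x = h y"
      by blast
    then show ?thesis
      using orientation_powers(1) [OF assms, of y] pow by auto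
  qed
  show "m = k" if eq: "local_orient \<sigma> [^]\<^bsub>local_group \<sigma>\<^esub> m = local_orient \<sigma> [^]\<^bsub>local_group \<sigma>\<^esub> k"
  proof -
    have "inj_on h (carrier ?G)"
      using iso by (simp add: iso_def bij_betw_def)
    moreover have "cw_orient K \<sigma> [^]\<^bsub>?G\<^esub> i \<in> carrier ?G" for i :: int
      by (simp add: group.int_pow_closed orientation_carrier [OF assms])
    moreover have "h (cw_orient K \<sigma> [^]\<^bsub>?G\<^esub> m) = h (cw_orient K \<sigma> [^]\<^bsub>?G\<^esub> k)"
      by (simp only: pow eq)
    ultimately have "cw_orient K \<sigma> [^]\<^bsub>?G\<^esub> m = cw_orient K \<sigma> [^]\<^bsub>?G\<^esub> k"
      by (blast dest: inj_onD)
    then show ?thesis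
      by (rule orientation_powers(2) [OF assms])
  qed
qed

definition attaching_class :: "'a set \<Rightarrow> 'a chain set" where
  "attaching_class \<tau> =
     hom_boundary (int (cw_dim K \<tau>)) (subtopology (cw_space K) (cell_closure K \<tau>)) (cell_frontier K \<tau>) (cw_orient K \<tau>)"

definition local_attaching_class :: "'a set \<Rightarrow> 'a set \<Rightarrow> 'a chain set" where
  "local_attaching_class \<tau> \<sigma> =
     hom_induced (int (cw_dim K \<sigma>)) (subtopology (cw_space K) (cell_frontier K \<tau>)) {}
       (skel (cw_dim K \<sigma>)) (skeleton K (cw_dim K \<sigma>) - \<sigma>) id (attaching_class \<tau>)"

text \<open>\<open>local_orient\<close> has infinite order, so the exponent in the definite
  description is unique.\<close>

lemma incidence_eqI:
  assumes "\<sigma> \<in> cw_cells K" "cw_dim K \<tau> = Suc (cw_dim K \<sigma>)"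
    and "local_attaching_class \<tau> \<sigma> = local_orient \<sigma> [^]\<^bsub>local_group \<sigma>\<^esub> (m::int)"
  shows "incidence K \<tau> \<sigma> = m"
proof -
  have "incidence K \<tau> \<sigma> = (THE m::int. local_attaching_class \<tau> \<sigma> = local_orient \<sigma> [^]\<^bsub>local_group \<sigma>\<^esub> m)"
    using assms(2) by (simp add: incidence_def local_attaching_class_def local_orient_def local_group_def attaching_class_def Let_def)
  also have "\<dots> = m"
    using assms(3) local_orient_powers(2) [OF assms(1)] by (intro the_equality) auto
  finally show ?thesis .
qed

lemma local_attaching_class_eq:
  assumes "\<sigma> \<in> cw_cells K" "cw_dim K \<tau> = Suc (cw_dim K \<sigma>)"
  shows "local_attaching_class \<tau> \<sigma> = local_orient \<sigma> [^]\<^bsub>local_group \<sigma>\<^esub> incidence K \<tau> \<sigma>"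
proof -
  have "local_attaching_class \<tau> \<sigma> \<in> carrier (local_group \<sigma>)"
    unfolding local_attaching_class_def local_group_def using hom_induced_carrier by blast
  then obtain m :: int where "local_attaching_class \<tau> \<sigma> = local_orient \<sigma> [^]\<^bsub>local_group \<sigma>\<^esub> m"
    using local_orient_powers(1) [OF assms(1)] by blast
  moreover from this have "incidence K \<tau> \<sigma> = m"
    by (rule incidence_eqI [OF assms])
  ultimately show ?thesis
    by simp
qed

lemma incidence_dim: "incidence K \<tau> \<sigma> \<noteq> 0 \<Longrightarrow> cw_dim K \<tau> = Suc (cw_dim K \<sigma>)"
  by (simp add: incidence_def split: if_splits)

end

section \<open>The cellular boundary squares to zero\<close>

text \<open>The map factors through the pair \<open>(F, F)\<close>, whose relative homology is
  trivial.\<close>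

lemma hom_induced_into_subspace:
  assumes "continuous_map F Y f" "S \<subseteq> topspace F" "f ` topspace F \<subseteq> A"
  shows "hom_induced p F S Y A f x = \<one>\<^bsub>relative_homology_group p Y A\<^esub>"
proof -
  let ?T = "relative_homology_group p F (topspace F)"
  have "hom_induced p F S Y A f x =
      hom_induced p F (topspace F) Y A f (hom_induced p F S F (topspace F) id x)"
    using assms by (subst hom_induced_compose') auto
  also have "hom_induced p F S F (topspace F) id x \<in> carrier ?T"
    using hom_induced_carrier by blast
  then have "hom_induced p F S F (topspace F) id x = \<one>\<^bsub>?T\<^esub>"
    using trivial_relative_homology_group_topspace [of p F] by (simp add: trivial_group_def)
  also have "hom_induced p F (topspace F) Y A f \<one>\<^bsub>?T\<^esub> = \<one>\<^bsub>relative_homology_group p Y A\<^esub>"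
    by (rule hom_one [OF hom_induced_hom]) simp_all
  finally show ?thesis .
qed

lemma hom_finprod:
  assumes "comm_group G" "comm_group H" "h \<in> hom G H" "f \<in> A \<rightarrow> carrier G"
  shows "h (finprod G f A) = finprod H (\<lambda>i. h (f i)) A"
proof -
  interpret G: comm_group G by fact
  interpret H: comm_group H by fact
  have one: "h \<one>\<^bsub>G\<^esub> = \<one>\<^bsub>H\<^esub>"
    using hom_one [OF assms(3) G.is_group H.is_group] .
  show ?thesis
    using assms(4)
  proof (induction A rule: infinite_finite_induct)
    case (insert a A)
    then have "(\<lambda>i. h (f i)) \<in> insert a A \<rightarrow> carrier H"
      using hom_in_carrier [OF assms(3)] by auto
    then show ?case
      using insert hom_mult [OF assms(3)] by (simp add: Pi_iff)
  qed (simp_all add: one)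
qed

lemma (in comm_group) finprod_int_pow:
  assumes "a \<in> carrier G"
  shows "finprod G (\<lambda>i. a [^] (k i :: int)) A = a [^] (\<Sum>i\<in>A. k i)"
  by (induction A rule: infinite_finite_induct) (use assms in \<open>auto simp: int_pow_mult\<close>)

context oriented_complex
begin

lemma cell_frontier_subset_skeleton:
  assumes "\<tau> \<in> cw_cells K" "cw_dim K \<tau> = Suc n" shows "cell_frontier K \<tau> \<subseteq> skeleton K n"
  using cell_frontier_subset [OF assms(1)] assms(2) by (auto simp: skeleton_def less_Suc_eq_le)

lemma skeleton_subset: "skeleton K n \<subseteq> topspace (cw_space K)"
  unfolding skeleton_eq by (rule Union_subset_topspace [OF dimension_closed_skeleton])

lemma topspace_skel: "topspace (skel n) = skeleton K n"
  using skeleton_subset by (simp add: Int_absorb1)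

text \<open>If \<sigma> misses \<open>L\<close>, then so does it miss the frontier of \<tau>. The
  attaching class then comes from the skeleton without \<sigma> and dies in the local group at
  \<sigma>.\<close>

lemma incidence_support:
  assumes "\<sigma> \<in> cw_cells K" "\<tau> \<in> cw_cells K" "incidence K \<tau> \<sigma> \<noteq> 0"
    and "cw_subcomplex K L" "\<tau> \<subseteq> L"
  shows "\<sigma> \<subseteq> L"
proof (rule ccontr)
  assume "\<not> \<sigma> \<subseteq> L"
  obtain \<C> where \<C>: "\<C> \<subseteq> cw_cells K" "L = \<Union>\<C>" "\<And>\<sigma>. \<sigma> \<in> \<C> \<Longrightarrow> cell_closure K \<sigma> \<subseteq> L"
    using assms(4) by (auto simp: cw_subcomplex_def)
  have "\<sigma> \<inter> L = {}"
    using \<open>\<not> \<sigma> \<subseteq> L\<close> \<C> cells_disjoint [OF assms(1)] by blast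
  have "\<tau> \<in> \<C>"
    using cell_nonempty [OF assms(2)] assms(2,5) \<C> cells_disjoint [OF assms(2)] by blast
  then have "cell_frontier K \<tau> \<subseteq> L"
    using \<C>(3) by (auto simp: cell_frontier_def)
  have dim: "cw_dim K \<tau> = Suc (cw_dim K \<sigma>)"
    by (rule incidence_dim [OF assms(3)])
  define n where "n = cw_dim K \<sigma>"
  have "cell_frontier K \<tau> \<subseteq> skeleton K n - \<sigma>"
    using \<open>cell_frontier K \<tau> \<subseteq> L\<close> \<open>\<sigma> \<inter> L = {}\<close> cell_frontier_subset_skeleton [OF assms(2) dim]
    by (auto simp: n_def)
  then have "local_attaching_class \<tau> \<sigma> = \<one>\<^bsub>local_group \<sigma>\<^esub>"
    unfolding local_attaching_class_def local_group_def n_def [symmetric]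
    by (intro hom_induced_into_subspace continuous_map_subtopology_id) auto
  then have "incidence K \<tau> \<sigma> = 0"
    using assms(1) dim by (intro incidence_eqI) simp_all
  then show False
    using assms(3) by simp
qed

definition top_cells :: "nat \<Rightarrow> 'a set set" where
  "top_cells n = {\<sigma> \<in> cw_cells K. cw_dim K \<sigma> = n}"

text \<open>Induction on a set \<U> of top cells removed from the skeleton, showing that the image
  of \<open>y\<close> relative to the remaining space is trivial. For empty \<U> the pair is a space
  relative to itself; when all top cells are removed the remaining space is the lower
  skeleton.\<close>

lemma relative_class_eq_one:
  assumes y: "y \<in> carrier (relative_homology_group p (skel (Suc m)) (skeleton K m))"
    and loc: "\<And>\<sigma>. \<sigma> \<in> top_cells (Suc m) \<Longrightarrow>
      hom_induced p (skel (Suc m)) (skeleton K m) (skel (Suc m)) (skeleton K (Suc m) - \<sigma>) id y =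
      \<one>\<^bsub>relative_homology_group p (skel (Suc m)) (skeleton K (Suc m) - \<sigma>)\<^esub>"
  shows "y = \<one>\<^bsub>relative_homology_group p (skel (Suc m)) (skeleton K m)\<^esub>"
proof -
  define M where "M = skeleton K (Suc m)"
  define A where "A = skeleton K m"
  define Y where "Y = skel (Suc m)"
  have topY: "topspace Y = M"
    by (simp only: Y_def M_def topspace_skel)
  have fin: "finite (top_cells (Suc m))"
    using finite_cells by (simp add: top_cells_def)
  have AM: "A = M - \<Union>(top_cells (Suc m))"
  proof -
    have "skeleton_cells (Suc m) - top_cells (Suc m) = skeleton_cells m"
      by (auto simp: skeleton_cells_def top_cells_def)
    then show ?thesis
      unfolding A_def M_def skeleton_eq
      by (subst Union_minus_cell) (auto simp: skeleton_cells_def top_cells_def)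
  qed
  have contY: "continuous_map Y Y id"
    by simp
  have "hom_induced p Y A Y (M - \<Union>\<U>) id y = \<one>\<^bsub>relative_homology_group p Y (M - \<Union>\<U>)\<^esub>"
    if "finite \<U>" "\<U> \<subseteq> top_cells (Suc m)" for \<U>
    using that
  proof (induction \<U> rule: finite_induct)
    case empty
    show ?case
      using AM topY by (intro hom_induced_into_subspace) auto
  next
    case (insert \<sigma> \<U>)
    define W where "W = M - \<Union>\<U>"
    define \<C> where "\<C> = skeleton_cells (Suc m) - \<U>"
    have \<sigma>: "\<sigma> \<in> \<C>" "\<sigma> \<in> cw_cells K" "cw_dim K \<sigma> = Suc m"
      using insert by (auto simp: \<C>_def skeleton_cells_def top_cells_def)
    have W: "W = \<Union>\<C>"
      unfolding W_def \<C>_def M_def skeleton_eq using insert.prems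
      by (intro Union_minus_cell) (auto simp: skeleton_cells_def top_cells_def)
    have W': "M - \<Union>(insert \<sigma> \<U>) = W - \<sigma>"
      by (auto simp: W_def)
    have AW: "A \<subseteq> W - \<sigma>" "W \<subseteq> M"
      using insert.prems by (auto simp: AM W_def)
    define x where "x = hom_induced p Y A Y (W - \<sigma>) id y"
    have xc: "x \<in> carrier (relative_homology_group p Y (W - \<sigma>))"
      unfolding x_def using hom_induced_carrier by blast
    have "hom_induced p Y (W - \<sigma>) Y W id x = hom_induced p Y A Y W id y"
      unfolding x_def using AW by (subst hom_induced_compose') auto
    also have "\<dots> = \<one>\<^bsub>relative_homology_group p Y W\<^esub>"
      unfolding W_def by (rule insert.IH) (use insert.prems in simp)
    finally have "hom_induced p Y (W - \<sigma>) Y W id x = \<one>\<^bsub>relative_homology_group p Y W\<^esub>" .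
    \<comment> \<open>Exactness for the triple \<open>Y\<close>, \<open>W\<close>,
      \<open>W - \<sigma>\<close>: by the induction hypothesis \<open>x\<close> dies relative to
      \<open>W\<close>, so it comes from the pair \<open>(W, W - \<sigma>)\<close>.\<close>
    moreover have "Coset.kernel (relative_homology_group p Y (W - \<sigma>)) (relative_homology_group p Y W)
          (hom_induced p Y (W - \<sigma>) Y W id) =
        hom_induced p (subtopology Y W) (W - \<sigma>) Y (W - \<sigma>) id `
          carrier (relative_homology_group p (subtopology Y W) (W - \<sigma>))"
      using homology_exactness_triple_3 [of "W - \<sigma>" W p Y] by simp
    ultimately obtain z where z: "z \<in> carrier (relative_homology_group p (subtopology Y W) (W - \<sigma>))"
      "x = hom_induced p (subtopology Y W) (W - \<sigma>) Y (W - \<sigma>) id z"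
      using xc unfolding Coset.kernel_def by blast
    have sub: "subtopology Y W = subtopology (cw_space K) W"
      using AW by (simp add: Y_def M_def subtopology_subtopology Int_absorb1)
    \<comment> \<open>The local homology at \<sigma> is the same in \<open>W\<close> and in
      \<open>Y\<close>. So \<open>z\<close> is determined by its image there, which is the local
      image of \<open>y\<close> and trivial by assumption.\<close>
    let ?i = "hom_induced p (subtopology Y W) (W - \<sigma>) Y (M - \<sigma>) id"
    have "?i \<in> iso (relative_homology_group p (subtopology Y W) (W - \<sigma>)) (relative_homology_group p Y (M - \<sigma>))"
      unfolding sub unfolding W M_def Y_def skeleton_eq
    proof (rule iso_Union_inclusion)
      show "dimension_closed \<C>"
        using insert.prems dimension_closed_skeleton [of "Suc m"]
        by (fastforce simp: \<C>_def dimension_closed_def skeleton_cells_def top_cells_def)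
    qed (use \<sigma> dimension_closed_skeleton in \<open>auto simp: \<C>_def skeleton_cells_def\<close>)
    then have inj: "inj_on ?i (carrier (relative_homology_group p (subtopology Y W) (W - \<sigma>)))"
      by (simp add: iso_def bij_betw_def)
    have "?i z = hom_induced p Y (W - \<sigma>) Y (M - \<sigma>) id x"
      unfolding z using AW by (subst hom_induced_compose') (auto simp: continuous_map_from_subtopology)
    also have "\<dots> = hom_induced p Y A Y (M - \<sigma>) id y"
      unfolding x_def using AW by (subst hom_induced_compose') auto
    also have "\<dots> = \<one>\<^bsub>relative_homology_group p Y (M - \<sigma>)\<^esub>"
      unfolding Y_def A_def M_def using insert.prems by (intro loc) auto
    also have "\<dots> = ?i \<one>\<^bsub>relative_homology_group p (subtopology Y W) (W - \<sigma>)\<^esub>"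
      by (rule hom_one [OF hom_induced_hom, symmetric]) simp_all
    finally have "z = \<one>\<^bsub>relative_homology_group p (subtopology Y W) (W - \<sigma>)\<^esub>"
      using inj z(1) group.is_monoid [OF group_relative_homology_group] monoid.one_closed
      by (metis inj_onD)
    then have "x = \<one>\<^bsub>relative_homology_group p Y (W - \<sigma>)\<^esub>"
      unfolding z(2) by (simp add: hom_one [OF hom_induced_hom])
    then show ?case
      unfolding W' by (simp add: x_def id_def)
  qed
  from this [OF fin order_refl] show ?thesis
    using hom_induced_id [OF y] by (simp add: AM [symmetric] A_def Y_def)
qed


lemma incidence_incidence:
  assumes \<rho>: "\<rho> \<in> cw_cells K" and \<tau>: "\<tau> \<in> cw_cells K" and dims: "cw_dim K \<tau> = Suc (Suc (cw_dim K \<rho>))"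
  shows "(\<Sum>\<sigma>\<in>cw_cells K. incidence K \<tau> \<sigma> * incidence K \<sigma> \<rho>) = 0"
proof -
  define m where "m = cw_dim K \<rho>"
  define n where "n = Suc m"
  define A where "A = skeleton K m"
  define M where "M = skeleton K n"
  define Y where "Y = skel n"
  define S where "S = top_cells n"
  define G where "G = relative_homology_group (int n) Y A"
  define P where "P = local_group \<rho>"
  have finS: "finite S"
    using finite_cells by (simp add: S_def top_cells_def)
  have topY: "topspace Y = M"
    by (simp only: Y_def M_def topspace_skel)
  have AM: "A \<subseteq> M"
    by (auto simp: A_def M_def n_def skeleton_def)
  have S: "\<sigma> \<in> cw_cells K" "cw_dim K \<sigma> = n" if "\<sigma> \<in> S" for \<sigma>
    using that by (auto simp: S_def top_cells_def)
  have A\<sigma>: "A \<subseteq> M - \<sigma>" if "\<sigma> \<in> S" for \<sigma>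
  proof -
    have "\<sigma> \<inter> A = {}"
    proof (rule ccontr)
      assume "\<sigma> \<inter> A \<noteq> {}"
      then obtain z \<upsilon> where "z \<in> \<sigma>" "z \<in> \<upsilon>" "\<upsilon> \<in> cw_cells K" "cw_dim K \<upsilon> \<le> m"
        by (auto simp: A_def skeleton_def)
      then have "\<sigma> = \<upsilon>"
        using cells_disjoint [OF S(1) [OF that]] by blast
      then show False
        using S [OF that] \<open>cw_dim K \<upsilon> \<le> m\<close> by (simp add: n_def)
    qed
    then show ?thesis
      using AM by auto
  qed
  interpret G: comm_group G
    by (simp add: G_def)
  interpret P: comm_group P
    by (simp add: P_def local_group_def)
  define F where "F = subtopology (cw_space K) (cell_frontier K \<tau>)"
  have frM: "cell_frontier K \<tau> \<subseteq> M"
    unfolding M_def using dims \<tau> by (intro cell_frontier_subset_skeleton) (auto simp: n_def m_def)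
  have contF: "continuous_map F Y id"
    unfolding F_def Y_def by (intro continuous_map_subtopology_id) (use frM in \<open>simp add: M_def\<close>)
  define x where "x = hom_induced (int n) F {} Y A id (attaching_class \<tau>)"
  have xG: "x \<in> carrier G"
    unfolding x_def G_def using hom_induced_carrier by blast
  define E where "E = (\<lambda>\<sigma>. subtopology (cw_space K) (cell_closure K \<sigma>))"
  define e where "e = (\<lambda>\<sigma>. hom_induced (int n) (E \<sigma>) (cell_frontier K \<sigma>) Y A id (cw_orient K \<sigma>))"
  have eG: "e \<sigma> \<in> carrier G" for \<sigma>
    unfolding e_def G_def using hom_induced_carrier by blast
  have frA: "cell_frontier K \<sigma> \<subseteq> A" if "\<sigma> \<in> S" for \<sigma>
    unfolding A_def using S [OF that] by (intro cell_frontier_subset_skeleton) (auto simp: n_def)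
  have clM: "cell_closure K \<sigma> \<subseteq> M" if "\<sigma> \<in> S" for \<sigma>
    using cell_closure_Un [OF S(1) [OF that]] frA [OF that] AM S [OF that]
    by (auto simp: M_def skeleton_def)
  have topE: "topspace (E \<sigma>) = cell_closure K \<sigma>" if "\<sigma> \<in> S" for \<sigma>
    using closedin_subset [OF closedin_cell_closure [OF S(1) [OF that]]] by (simp add: E_def Int_absorb1)
  have contE: "continuous_map (E \<sigma>) Y id" if "\<sigma> \<in> S" for \<sigma>
    unfolding E_def Y_def by (intro continuous_map_subtopology_id) (use clM [OF that] in \<open>simp add: M_def\<close>)
  define pr where "pr = (\<lambda>\<sigma>. hom_induced (int n) Y A Y (M - \<sigma>) id)"
  have loc: "local_group \<sigma> = relative_homology_group (int n) Y (M - \<sigma>)" if "\<sigma> \<in> S" for \<sigma>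
    using S [OF that] by (simp add: local_group_def Y_def M_def)
  have prhom: "pr \<sigma> \<in> hom G (local_group \<sigma>)" if "\<sigma> \<in> S" for \<sigma>
    unfolding loc [OF that] pr_def G_def by (rule hom_induced_hom)
  have pr_x: "pr \<sigma> x = local_attaching_class \<tau> \<sigma>" if "\<sigma> \<in> S" for \<sigma>
    unfolding pr_def x_def local_attaching_class_def using S [OF that] A\<sigma> [OF that] contF
    by (subst hom_induced_compose') (auto simp: F_def Y_def M_def)
  have pr_e: "pr \<sigma> (e \<sigma>) = local_orient \<sigma>" if "\<sigma> \<in> S" for \<sigma>
    unfolding pr_def e_def local_orient_def
    using S [OF that] A\<sigma> [OF that] contE [OF that] frA [OF that]
    by (subst hom_induced_compose') (auto simp: E_def Y_def M_def)
  \<comment> \<open>The closure of another n-cell misses \<sigma>, because its frontier lies in the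
    lower skeleton. So the local projections take the classes \<open>e\<close> to a diagonal matrix
    with the orientations on the diagonal.\<close>
  have pr_e_other: "pr \<sigma> (e \<sigma>') = \<one>\<^bsub>local_group \<sigma>\<^esub>" if "\<sigma> \<in> S" "\<sigma>' \<in> S" "\<sigma>' \<noteq> \<sigma>" for \<sigma> \<sigma>'
  proof -
    have "pr \<sigma> (e \<sigma>') = hom_induced (int n) (E \<sigma>') (cell_frontier K \<sigma>') Y (M - \<sigma>) id (cw_orient K \<sigma>')"
      unfolding pr_def e_def
      using A\<sigma> [OF that(1)] contE [OF that(2)] frA [OF that(2)]
      by (subst hom_induced_compose') auto
    also have "\<dots> = \<one>\<^bsub>local_group \<sigma>\<^esub>"
      unfolding loc [OF that(1)]
    proof (rule hom_induced_into_subspace)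
      have "\<sigma>' \<subseteq> M - \<sigma>"
        using cells_disjoint [OF S(1) [OF that(1)] S(1) [OF that(2)]] that(3) clM [OF that(2)]
          cell_subset_closure [OF S(1) [OF that(2)]] by blast
      then have "cell_closure K \<sigma>' \<subseteq> M - \<sigma>"
        using cell_closure_Un [OF S(1) [OF that(2)]] frA [OF that(2)] A\<sigma> [OF that(1)] by blast
      then show "id ` topspace (E \<sigma>') \<subseteq> M - \<sigma>"
        by (simp add: topE [OF that(2)])
      show "cell_frontier K \<sigma>' \<subseteq> topspace (E \<sigma>')"
        by (simp add: topE [OF that(2)] cell_frontier_def)
    qed (rule contE [OF that(2)])
    finally show ?thesis .
  qed
  \<comment> \<open>The candidate for the attaching class as an integral combination of cells. It is
    compared with \<open>x\<close> through all local projections, which together detect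
    equality.\<close>
  define y where "y = finprod G (\<lambda>\<sigma>. e \<sigma> [^]\<^bsub>G\<^esub> incidence K \<tau> \<sigma>) S"
  have eyG: "(\<lambda>\<sigma>. e \<sigma> [^]\<^bsub>G\<^esub> incidence K \<tau> \<sigma>) \<in> S \<rightarrow> carrier G"
    using eG by auto
  have yG: "y \<in> carrier G"
    unfolding y_def by (rule G.finprod_closed [OF eyG])
  have pr_pow: "pr \<sigma> (e \<sigma>' [^]\<^bsub>G\<^esub> k) = pr \<sigma> (e \<sigma>') [^]\<^bsub>local_group \<sigma>\<^esub> k" if "\<sigma> \<in> S" for \<sigma> \<sigma>' and k :: int
    using hom_int_pow [OF prhom [OF that] eG G.is_group group_local_group] .
  have pr_y: "pr \<sigma> y = local_attaching_class \<tau> \<sigma>" if "\<sigma> \<in> S" for \<sigma>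
  proof -
    interpret L: comm_group "local_group \<sigma>"
      by (simp add: local_group_def)
    have "pr \<sigma> y = finprod (local_group \<sigma>) (\<lambda>\<sigma>'. pr \<sigma> (e \<sigma>' [^]\<^bsub>G\<^esub> incidence K \<tau> \<sigma>')) S"
      unfolding y_def by (rule hom_finprod [OF G.comm_group_axioms L.comm_group_axioms prhom [OF that] eyG])
    also have "\<dots> = finprod (local_group \<sigma>)
        (\<lambda>\<sigma>'. if \<sigma> = \<sigma>' then local_orient \<sigma> [^]\<^bsub>local_group \<sigma>\<^esub> incidence K \<tau> \<sigma> else \<one>\<^bsub>local_group \<sigma>\<^esub>) S"
      using that pr_e pr_e_other local_orient_carrier [of \<sigma>]
      by (intro L.finprod_cong') (auto simp: pr_pow)
    also have "\<dots> = local_orient \<sigma> [^]\<^bsub>local_group \<sigma>\<^esub> incidence K \<tau> \<sigma>"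
      using L.finprod_singleton [OF that finS, of "\<lambda>_. local_orient \<sigma> [^]\<^bsub>local_group \<sigma>\<^esub> incidence K \<tau> \<sigma>"]
        local_orient_carrier [of \<sigma>] by simp
    also have "\<dots> = local_attaching_class \<tau> \<sigma>"
      using S [OF that] dims by (intro local_attaching_class_eq [symmetric]) (auto simp: n_def m_def)
    finally show ?thesis .
  qed
  have "x \<otimes>\<^bsub>G\<^esub> inv\<^bsub>G\<^esub> y = \<one>\<^bsub>G\<^esub>"
    unfolding G_def Y_def A_def n_def
  proof (rule relative_class_eq_one)
    show "x \<otimes>\<^bsub>relative_homology_group (int (Suc m)) (skel (Suc m)) (skeleton K m)\<^esub>
        inv\<^bsub>relative_homology_group (int (Suc m)) (skel (Suc m)) (skeleton K m)\<^esub> y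
        \<in> carrier (relative_homology_group (int (Suc m)) (skel (Suc m)) (skeleton K m))"
      using xG yG G.m_closed G.inv_closed by (simp add: G_def Y_def A_def n_def)
    fix \<sigma> assume "\<sigma> \<in> top_cells (Suc m)"
    then have \<sigma>: "\<sigma> \<in> S"
      by (simp add: S_def n_def)
    have *: "group_hom G (local_group \<sigma>) (pr \<sigma>)"
      using prhom [OF \<sigma>] by (simp add: group_hom_def group_hom_axioms_def G.is_group)
    have "pr \<sigma> (x \<otimes>\<^bsub>G\<^esub> inv\<^bsub>G\<^esub> y) = \<one>\<^bsub>local_group \<sigma>\<^esub>"
      using xG yG group.r_inv [OF group_local_group] hom_in_carrier [OF prhom [OF \<sigma>] xG]
      by (simp add: group_hom.hom_mult [OF *] group_hom.hom_inv [OF *] pr_x [OF \<sigma>] pr_y [OF \<sigma>])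
    then show "hom_induced (int (Suc m)) (skel (Suc m)) (skeleton K m) (skel (Suc m)) (skeleton K (Suc m) - \<sigma>) id
        (x \<otimes>\<^bsub>relative_homology_group (int (Suc m)) (skel (Suc m)) (skeleton K m)\<^esub>
         inv\<^bsub>relative_homology_group (int (Suc m)) (skel (Suc m)) (skeleton K m)\<^esub> y) =
        \<one>\<^bsub>relative_homology_group (int (Suc m)) (skel (Suc m)) (skeleton K (Suc m) - \<sigma>)\<^esub>"
      by (simp add: loc [OF \<sigma>] pr_def G_def Y_def M_def A_def n_def)
  qed
  then have xy: "x = y"
    using xG yG G.inv_equality G.inv_inv by (metis G.inv_closed)
  have subA: "subtopology Y A = skel m"
    using AM by (simp add: Y_def M_def A_def subtopology_subtopology Int_absorb1)
  have nm: "int n - 1 = int m"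
    by (simp add: n_def)
  define j where "j = hom_induced (int m) (skel m) {} (skel m) (A - \<rho>) id"
  \<comment> \<open>The connecting map to the homology of the (n-1)-skeleton, followed by
    localization at \<rho>. It is evaluated on both expressions of the same class: trivially on
    \<open>x\<close>, by incidence numbers on \<open>y\<close>.\<close>
  define \<delta> where "\<delta> = j \<circ> hom_boundary (int n) Y A"
  have bd: "hom_boundary (int n) Y A \<in> hom G (homology_group (int m) (skel m))"
    using hom_boundary_hom [of "int n" Y A] by (simp add: G_def subA nm)
  have jhom: "j \<in> hom (homology_group (int m) (skel m)) P"
    unfolding j_def P_def local_group_def m_def [symmetric] A_def by (rule hom_induced_hom)
  have \<delta>hom: "\<delta> \<in> hom G P"
    unfolding \<delta>_def by (rule hom_compose [OF bd jhom])
  \<comment> \<open>The class \<open>x\<close> comes from absolute homology, so by naturality its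
    boundary comes from the homology of the empty space.\<close>
  have \<delta>x: "\<delta> x = \<one>\<^bsub>P\<^esub>"
  proof -
    have "hom_boundary (int n) Y A x =
        hom_induced (int n - 1) (subtopology F {}) {} (subtopology Y A) {} id (hom_boundary (int n) F {} (attaching_class \<tau>))"
      unfolding x_def using fun_cong [OF naturality_hom_induced [OF contF, of "{}" A "int n"]] by simp
    also have "hom_boundary (int n) F {} (attaching_class \<tau>) = \<one>\<^bsub>homology_group (int n - 1) (subtopology F {})\<^esub>"
      using hom_boundary_carrier [of "int n" F "{}" "attaching_class \<tau>"]
        trivial_homology_group_empty [of "subtopology F {}" "int n - 1"]
      by (simp add: trivial_group_def)
    also have "hom_induced (int n - 1) (subtopology F {}) {} (subtopology Y A) {} id \<dots> =
        \<one>\<^bsub>homology_group (int m) (skel m)\<^esub>"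
      unfolding subA nm by (rule hom_one [OF hom_induced_hom]) simp_all
    finally have "hom_boundary (int n) Y A x = \<one>\<^bsub>homology_group (int m) (skel m)\<^esub>" .
    then show ?thesis
      using hom_one [OF jhom] by (simp add: \<delta>_def)
  qed
  \<comment> \<open>Naturality of the connecting map for the inclusion of the closed cell turns the
    boundary of \<open>e \<sigma>\<close> into the attaching class of \<sigma>.\<close>
  have \<delta>e: "\<delta> (e \<sigma>) = local_orient \<rho> [^]\<^bsub>P\<^esub> incidence K \<sigma> \<rho>" if "\<sigma> \<in> S" for \<sigma>
  proof -
    have fr: "id \<in> cell_frontier K \<sigma> \<rightarrow> A"
      using frA [OF that] by auto
    have sub: "subtopology (E \<sigma>) (cell_frontier K \<sigma>) = subtopology (cw_space K) (cell_frontier K \<sigma>)"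
      by (simp add: E_def subtopology_subtopology Int_absorb1 cell_frontier_def)
    have cont: "continuous_map (subtopology (cw_space K) (cell_frontier K \<sigma>)) (skel m) id"
      using frA [OF that] by (intro continuous_map_subtopology_id) (simp add: A_def)
    have "hom_boundary (int n) Y A (e \<sigma>) =
        hom_induced (int m) (subtopology (cw_space K) (cell_frontier K \<sigma>)) {} (skel m) {} id (attaching_class \<sigma>)"
      unfolding e_def attaching_class_def
      using fun_cong [OF naturality_hom_induced [OF contE [OF that] fr, of "int n"], of "cw_orient K \<sigma>"] S [OF that]
      by (simp add: sub subA nm) (simp add: E_def)
    then have "\<delta> (e \<sigma>) = local_attaching_class \<sigma> \<rho>"
      unfolding \<delta>_def j_def local_attaching_class_def m_def [symmetric] A_def
      using cont by (simp add: hom_induced_compose')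
    then show ?thesis
      using local_attaching_class_eq [OF \<rho>, of \<sigma>] S [OF that] by (simp add: P_def n_def m_def)
  qed
  have oP: "local_orient \<rho> \<in> carrier P"
    by (simp add: P_def local_orient_carrier)
  have "\<one>\<^bsub>P\<^esub> = finprod P (\<lambda>\<sigma>. \<delta> (e \<sigma> [^]\<^bsub>G\<^esub> incidence K \<tau> \<sigma>)) S"
    using hom_finprod [OF G.comm_group_axioms P.comm_group_axioms \<delta>hom eyG] \<delta>x xy by (simp add: y_def)
  also have "\<dots> = finprod P (\<lambda>\<sigma>. local_orient \<rho> [^]\<^bsub>P\<^esub> (incidence K \<tau> \<sigma> * incidence K \<sigma> \<rho>)) S"
    using hom_int_pow [OF \<delta>hom eG G.is_group P.is_group] oP
    by (intro P.finprod_cong') (auto simp: \<delta>e P.int_pow_pow mult.commute)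
  also have "\<dots> = local_orient \<rho> [^]\<^bsub>P\<^esub> (\<Sum>\<sigma>\<in>S. incidence K \<tau> \<sigma> * incidence K \<sigma> \<rho>)"
    by (rule P.finprod_int_pow [OF oP])
  finally have "local_orient \<rho> [^]\<^bsub>P\<^esub> (\<Sum>\<sigma>\<in>S. incidence K \<tau> \<sigma> * incidence K \<sigma> \<rho>) = local_orient \<rho> [^]\<^bsub>P\<^esub> (0::int)"
    by simp
  then have "(\<Sum>\<sigma>\<in>S. incidence K \<tau> \<sigma> * incidence K \<sigma> \<rho>) = 0"
    unfolding P_def by (rule local_orient_powers(2) [OF \<rho>])
  moreover have "(\<Sum>\<sigma>\<in>cw_cells K. incidence K \<tau> \<sigma> * incidence K \<sigma> \<rho>) = (\<Sum>\<sigma>\<in>S. incidence K \<tau> \<sigma> * incidence K \<sigma> \<rho>)"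
    using finite_cells incidence_dim [of _ \<rho>]
    by (intro sum.mono_neutral_right) (auto simp: S_def top_cells_def n_def m_def)
  ultimately show ?thesis
    by simp
qed

end

section \<open>Column reduction\<close>

text \<open>The paper's \<open>low(c) = l\<close>, as a relation that fails for \<open>c = 0\<close>.\<close>

definition leads :: "'c list \<Rightarrow> ('c \<Rightarrow> 'k::zero) \<Rightarrow> nat \<Rightarrow> bool" where
  "leads cs c l \<longleftrightarrow> l < length cs \<and> c (cs ! l) \<noteq> 0 \<and> (\<forall>k<length cs. l < k \<longrightarrow> c (cs ! k) = 0)"

lemma leads_unique: "leads cs c l \<Longrightarrow> leads cs c l' \<Longrightarrow> l = l'"
  unfolding leads_def by (metis nat_neq_iff)

text \<open>Among the summands with nonzero coefficient, the one with the largest leading index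
  cannot be cancelled: at that index all others vanish.\<close>

lemma leads_sum:
  fixes x :: "'i \<Rightarrow> 'c \<Rightarrow> 'k::field"
  assumes "finite I" "\<And>i. i \<in> I \<Longrightarrow> leads cs (x i) (l i)" "inj_on l I" "\<exists>i\<in>I. \<gamma> i \<noteq> 0"
  obtains i where "i \<in> I" "\<gamma> i \<noteq> 0" "leads cs (\<lambda>\<sigma>. \<Sum>i\<in>I. \<gamma> i * x i \<sigma>) (l i)"
proof -
  let ?J = "{i \<in> I. \<gamma> i \<noteq> 0}"
  have "finite (l ` ?J)" "l ` ?J \<noteq> {}"
    using assms by auto
  then have "Max (l ` ?J) \<in> l ` ?J" and le: "\<And>j. j \<in> ?J \<Longrightarrow> l j \<le> Max (l ` ?J)"
    by (auto intro: Max_in)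
  then obtain i where i: "i \<in> ?J" "l i = Max (l ` ?J)"
    by auto
  have zero: "\<gamma> j * x j (cs ! k) = 0"
    if "j \<in> I" "k < length cs" "l i < k \<or> (k = l i \<and> j \<noteq> i)" for j k
  proof (cases "\<gamma> j = 0")
    case False
    then have "l j \<le> l i"
      using le [of j] i that by simp
    moreover have "l j \<noteq> l i" if "j \<noteq> i"
      using inj_onD [OF assms(3), of j i] i \<open>j \<in> I\<close> that by auto
    ultimately have "l j < k"
      using that by auto
    then show ?thesis
      using assms(2) [OF \<open>j \<in> I\<close>] \<open>k < length cs\<close> by (simp add: leads_def)
  qed simp
  have li: "leads cs (x i) (l i)"
    using assms(2) i(1) by blast
  have "(\<Sum>j\<in>I. \<gamma> j * x j (cs ! l i)) = (\<Sum>j\<in>I. if j = i then \<gamma> i * x i (cs ! l i) else 0)"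
    by (intro sum.cong) (use zero li in \<open>auto simp: leads_def\<close>)
  then have "(\<Sum>j\<in>I. \<gamma> j * x j (cs ! l i)) = \<gamma> i * x i (cs ! l i)"
    using assms(1) i by simp
  moreover have "(\<Sum>j\<in>I. \<gamma> j * x j (cs ! k)) = 0" if "k < length cs" "l i < k" for k
    using zero that by (intro sum.neutral) auto
  ultimately have "leads cs (\<lambda>\<sigma>. \<Sum>i\<in>I. \<gamma> i * x i \<sigma>) (l i)"
    using li i by (auto simp: leads_def)
  then show ?thesis
    using that i by blast
qed

locale persistence = oriented_complex K
  for K :: "('a, 'm) cw_complex_scheme" +
  fixes f :: "'a set \<Rightarrow> real" and cs :: "'a set list" and R V :: "'k::field mat"
  assumes order: "compatible_order K f cs"
    and subcomplexes: "filtration_by_subcomplexes K f cs"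
    and V_carrier: "V \<in> carrier_mat (length cs) (length cs)"
    and R_eq: "R = boundary_matrix K cs * V"
    and reduced: "reduced R"
    and unitriangular: "upper_unitriangular V"
    and dim_preserving: "dimension_preserving K cs V"
begin

abbreviation N :: nat where "N \<equiv> length cs"

text \<open>The chains \<open>b i\<close> and \<open>r i\<close> are the columns \<open>V\<^sub>i\<close> and \<open>R\<^sub>i\<close>.\<close>

definition b :: "nat \<Rightarrow> 'a set \<Rightarrow> 'k" where
  "b i = birth_cycle cs V i"

definition r :: "nat \<Rightarrow> 'a set \<Rightarrow> 'k" where
  "r i = cell_boundary K (b i)"

text \<open>Coefficient functions live on all indices, and restrictions on the support are separate
  hypotheses. Thus expansions over different index sets can be added and compared without changing
  the summation range.\<close>

definition comb :: "(nat \<Rightarrow> 'k) \<Rightarrow> 'a set \<Rightarrow> 'k" where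
  "comb \<gamma> = (\<lambda>\<sigma>. \<Sum>i<N. \<gamma> i * b i \<sigma>)"

lemma distinct: "distinct cs" and set_cs: "set cs = cw_cells K"
  using order by (auto simp: compatible_order_def)

lemma nth_cell: "i < N \<Longrightarrow> cs ! i \<in> cw_cells K"
  using set_cs nth_mem by blast

lemma ex_index: "\<sigma> \<in> cw_cells K \<Longrightarrow> \<exists>i<N. cs ! i = \<sigma>"
  using set_cs by (metis in_set_conv_nth)

lemma sum_cells: "(\<Sum>\<sigma>\<in>cw_cells K. g \<sigma>) = (\<Sum>i<N. g (cs ! i))"
  using sum.reindex_bij_betw [OF bij_betw_nth [OF distinct refl set_cs [symmetric]], of g] by simp

lemma chain_of_vec_nth: "i < N \<Longrightarrow> chain_of_vec cs c (cs ! i) = c $ i"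
  using distinct by (simp add: chain_of_vec_def nth_eq_iff_index_eq sum.delta' cong: if_cong)

lemma chain_of_vec_outside: "\<sigma> \<notin> cw_cells K \<Longrightarrow> chain_of_vec cs c \<sigma> = 0"
  using nth_cell by (auto simp: chain_of_vec_def intro!: sum.neutral)

lemma b_nth: "i < N \<Longrightarrow> k < N \<Longrightarrow> b i (cs ! k) = V $$ (k, i)"
  using V_carrier by (simp add: b_def birth_cycle_def chain_of_vec_nth)

lemma b_outside: "\<sigma> \<notin> cw_cells K \<Longrightarrow> b i \<sigma> = 0"
  by (simp add: b_def birth_cycle_def chain_of_vec_outside)

lemma leads_b: "i < N \<Longrightarrow> leads cs (b i) i"
  using unitriangular V_carrier
  by (auto simp: leads_def b_nth upper_unitriangular_def upper_triangular_def)

lemma b_diag: "i < N \<Longrightarrow> b i (cs ! i) = 1"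
  using unitriangular V_carrier by (simp add: b_nth upper_unitriangular_def)

lemma b_nonzero_dim:
  assumes "i < N" "b i \<sigma> \<noteq> 0" shows "cw_dim K \<sigma> = cw_dim K (cs ! i)"
proof -
  have "\<sigma> \<in> cw_cells K"
    using assms(2) b_outside by blast
  then obtain k where "k < N" "\<sigma> = cs ! k"
    using ex_index by blast
  then show ?thesis
    using dim_preserving assms by (simp add: dimension_preserving_def b_nth)
qed

lemma R_carrier: "R \<in> carrier_mat N N"
  unfolding R_eq by (rule mult_carrier_mat [OF _ V_carrier]) (simp add: boundary_matrix_def)

text \<open>A column of \<open>R = D V\<close> is the boundary of the corresponding column of
  \<open>V\<close>; from here on lows are handled as leading indices of chains.\<close>

lemma r_nth:
  assumes "i < N" "k < N" shows "r i (cs ! k) = R $$ (k, i)"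
proof -
  have "R $$ (k, i) = (\<Sum>j<N. of_int (incidence K (cs ! j) (cs ! k)) * V $$ (j, i))"
    using assms V_carrier
    by (simp add: R_eq boundary_matrix_def scalar_prod_def lessThan_atLeast0)
  also have "\<dots> = r i (cs ! k)"
    using assms by (simp add: r_def cell_boundary_def sum_cells b_nth nth_cell mult.commute)
  finally show ?thesis ..
qed

lemma r_outside: "\<sigma> \<notin> cw_cells K \<Longrightarrow> r i \<sigma> = 0"
  by (simp add: r_def cell_boundary_def)

lemma chain_eqI:
  assumes "\<And>\<sigma>. \<sigma> \<notin> cw_cells K \<Longrightarrow> c \<sigma> = d \<sigma>" "\<And>k. k < N \<Longrightarrow> c (cs ! k) = d (cs ! k)"
  shows "c = d"
proof
  fix \<sigma> show "c \<sigma> = d \<sigma>"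
  proof (cases "\<sigma> \<in> cw_cells K")
    case True
    then obtain k where "k < N" "cs ! k = \<sigma>"
      using ex_index by blast
    then show ?thesis
      using assms(2) by blast
  qed (rule assms(1))
qed

lemma col_R_nth: "i < N \<Longrightarrow> k < N \<Longrightarrow> col R i $ k = r i (cs ! k)"
  using R_carrier by (simp add: r_nth)

lemma col_R_eq_0_iff:
  assumes "i < N" shows "col R i = 0\<^sub>v N \<longleftrightarrow> r i = (\<lambda>\<sigma>. 0)"
proof
  assume "col R i = 0\<^sub>v N"
  then have "r i (cs ! k) = 0" if "k < N" for k
    using col_R_nth [OF assms that] that by simp
  then show "r i = (\<lambda>\<sigma>. 0)"
    by (intro chain_eqI) (auto simp: r_outside)
next
  assume "r i = (\<lambda>\<sigma>. 0)"
  then have "col R i $ k = 0" if "k < N" for k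
    using col_R_nth [OF assms that] by simp
  then show "col R i = 0\<^sub>v N"
    using R_carrier by (intro eq_vecI) auto
qed

lemma positive_iff: "positive R i \<longleftrightarrow> i < N \<and> r i = (\<lambda>\<sigma>. 0)"
  using R_carrier col_R_eq_0_iff by (auto simp: positive_def)

lemma leads_low:
  assumes "j < N" "col R j \<noteq> 0\<^sub>v N" shows "leads cs (r j) (low (col R j))"
proof -
  let ?S = "{i. i < dim_vec (col R j) \<and> col R j $ i \<noteq> 0}"
  have dim: "dim_vec (col R j) = N"
    using R_carrier by simp
  have "\<exists>k<N. col R j $ k \<noteq> 0"
  proof (rule ccontr)
    assume "\<not> (\<exists>k<N. col R j $ k \<noteq> 0)"
    then have "col R j = 0\<^sub>v N"
      using dim by (intro eq_vecI) auto
    then show False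
      using assms(2) by simp
  qed
  then have "?S \<noteq> {}"
    using dim by auto
  then have low: "low (col R j) \<in> ?S"
    unfolding low_def by (intro Max_in) simp_all
  have "r j (cs ! k) = 0" if "low (col R j) < k" "k < N" for k
  proof (rule ccontr)
    assume "r j (cs ! k) \<noteq> 0"
    then have "k \<in> ?S"
      using that assms(1) dim by (simp add: col_R_nth)
    then have "k \<le> low (col R j)"
      unfolding low_def by (intro Max_ge) simp_all
    then show False
      using that by simp
  qed
  moreover have "low (col R j) < N" "r j (cs ! low (col R j)) \<noteq> 0"
    using low dim col_R_nth [OF assms(1), of "low (col R j)"] by simp_all
  ultimately show ?thesis
    unfolding leads_def by blast
qed

lemma is_pair_iff: "is_pair R i j \<longleftrightarrow> j < N \<and> leads cs (r j) i"
proof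
  assume "is_pair R i j"
  then show "j < N \<and> leads cs (r j) i"
    using leads_low R_carrier by (auto simp: is_pair_def)
next
  assume *: "j < N \<and> leads cs (r j) i"
  then have nz: "col R j \<noteq> 0\<^sub>v N"
    using col_R_eq_0_iff by (auto simp: leads_def)
  then have "low (col R j) = i"
    using * leads_low leads_unique by blast
  then show "is_pair R i j"
    using * nz R_carrier by (simp add: is_pair_def)
qed

lemma pair_unique:
  assumes "is_pair R i j" "is_pair R i j'" shows "j = j'"
  using assms reduced by (auto simp: is_pair_def reduced_def)

lemma pair_eq: "is_pair R i j \<Longrightarrow> pair R i = enat j"
  using pair_unique by (auto simp: pair_def intro!: the_equality)

lemma death_eq: "is_pair R i j \<Longrightarrow> death f cs R i = ereal (f (cs ! j))"
  by (simp add: death_def pair_eq)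

lemma death_infinite: "(\<And>j. \<not> is_pair R i j) \<Longrightarrow> death f cs R i = \<infinity>"
  by (simp add: death_def pair_def)

section \<open>The cellular boundary operator over the field\<close>

lemma boundary_lincomb:
  "cell_boundary K (\<lambda>\<sigma>. \<Sum>i\<in>I. \<gamma> i * x i \<sigma>) = (\<lambda>\<sigma>. \<Sum>i\<in>I. \<gamma> i * cell_boundary K (x i) \<sigma> :: 'k)"
proof
  fix \<sigma>
  show "cell_boundary K (\<lambda>\<sigma>. \<Sum>i\<in>I. \<gamma> i * x i \<sigma>) \<sigma> = (\<Sum>i\<in>I. \<gamma> i * cell_boundary K (x i) \<sigma>)"
    by (simp add: cell_boundary_def sum_distrib_right sum_distrib_left mult.assoc)
      (subst sum.swap, simp)
qed

lemma boundary_comb: "cell_boundary K (comb \<gamma>) = (\<lambda>\<sigma>. \<Sum>i<N. \<gamma> i * r i \<sigma>)"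
  unfolding comb_def r_def by (rule boundary_lincomb)

lemma boundary_add: "cell_boundary K (\<lambda>\<sigma>. c \<sigma> + d \<sigma>) = (\<lambda>\<sigma>. cell_boundary K c \<sigma> + (cell_boundary K d \<sigma> :: 'k))"
  by (auto simp: cell_boundary_def sum.distrib algebra_simps)

lemma boundary_smult: "cell_boundary K (\<lambda>\<sigma>. a * c \<sigma>) = (\<lambda>\<sigma>. a * (cell_boundary K c \<sigma> :: 'k))"
  by (auto simp: cell_boundary_def sum_distrib_left mult.assoc)

lemma boundary_diff: "cell_boundary K (\<lambda>\<sigma>. c \<sigma> - d \<sigma>) = (\<lambda>\<sigma>. cell_boundary K c \<sigma> - (cell_boundary K d \<sigma> :: 'k))"
  by (auto simp: cell_boundary_def sum_subtractf algebra_simps)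

text \<open>A product of two incidence numbers vanishes by itself unless the dimensions drop by one
  twice; in that case the topological identity for the integers is mapped into the field.\<close>

lemma boundary_boundary: "cell_boundary K (cell_boundary K c) = (\<lambda>\<sigma>. 0 :: 'k)"
proof
  fix \<rho>
  show "cell_boundary K (cell_boundary K c) \<rho> = 0"
  proof (cases "\<rho> \<in> cw_cells K")
    case True
    have zero: "(\<Sum>\<sigma>\<in>cw_cells K. incidence K \<tau> \<sigma> * incidence K \<sigma> \<rho>) = 0" if "\<tau> \<in> cw_cells K" for \<tau>
    proof (cases "cw_dim K \<tau> = Suc (Suc (cw_dim K \<rho>))")
      case False
      then have "incidence K \<tau> \<sigma> * incidence K \<sigma> \<rho> = 0" for \<sigma>
        using incidence_dim [of \<tau> \<sigma>] incidence_dim [of \<sigma> \<rho>] by fastforce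
      then show ?thesis
        by simp
    qed (use incidence_incidence True that in blast)
    have "cell_boundary K (cell_boundary K c) \<rho> =
        (\<Sum>\<sigma>\<in>cw_cells K. \<Sum>\<tau>\<in>cw_cells K. c \<tau> * of_int (incidence K \<tau> \<sigma> * incidence K \<sigma> \<rho>))"
      using True by (simp add: cell_boundary_def sum_distrib_right mult.assoc)
    also have "\<dots> = (\<Sum>\<tau>\<in>cw_cells K. c \<tau> * of_int (\<Sum>\<sigma>\<in>cw_cells K. incidence K \<tau> \<sigma> * incidence K \<sigma> \<rho>))"
      by (subst sum.swap) (simp add: sum_distrib_left)
    also have "\<dots> = 0"
      using zero by simp
    finally show ?thesis .
  qed (simp add: cell_boundary_def)
qed

end

lemma in_cell_chains: "c \<in> carrier (cell_chains K q L) \<longleftrightarrow> (\<forall>\<sigma>. c \<sigma> \<noteq> 0 \<longrightarrow> \<sigma> \<in> cw_cells K \<and> \<sigma> \<subseteq> L \<and> cw_dim K \<sigma> = q)"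
  by (simp add: cell_chains_def)

lemma cell_chains_add:
  "c \<in> carrier (cell_chains K q L) \<Longrightarrow> d \<in> carrier (cell_chains K q L) \<Longrightarrow> (\<lambda>\<sigma>. c \<sigma> + d \<sigma>) \<in> carrier (cell_chains K q L)"
  unfolding in_cell_chains by (metis add.right_neutral)

lemma cell_chains_smult:
  "c \<in> carrier (cell_chains K q L) \<Longrightarrow> (\<lambda>\<sigma>. a * c \<sigma>) \<in> carrier (cell_chains K q L)"
  unfolding in_cell_chains by auto

lemma cell_chains_diff:
  "c \<in> carrier (cell_chains K q L) \<Longrightarrow> d \<in> carrier (cell_chains K q L) \<Longrightarrow> (\<lambda>\<sigma>. c \<sigma> - d \<sigma>) \<in> carrier (cell_chains K q L)"
  using cell_chains_add [of c K q L "\<lambda>\<sigma>. (-1) * d \<sigma>"] cell_chains_smult [of d K q L "-1"] by simp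

lemma cell_chains_zero: "(\<lambda>\<sigma>. 0) \<in> carrier (cell_chains K q L)"
  by (simp add: in_cell_chains)

lemma cell_chains_mono: "L \<subseteq> L' \<Longrightarrow> carrier (cell_chains K q L) \<subseteq> carrier (cell_chains K q L')"
  by (auto simp: cell_chains_def)

context persistence
begin

definition idx :: "'a set \<Rightarrow> nat set" where
  "idx L = {i. i < N \<and> cs ! i \<subseteq> L}"

text \<open>What the reduction needs of K_t and of its strict counterpart: a subcomplex whose cells
  form an initial segment of the order. The basis of homology is obtained once for all stages and
  then used at both.\<close>

definition stage :: "'a set \<Rightarrow> bool" where
  "stage L \<longleftrightarrow> cw_subcomplex K L \<and> (\<forall>i j. i \<le> j \<longrightarrow> j \<in> idx L \<longrightarrow> i \<in> idx L)"

lemma idx_less: "i \<in> idx L \<Longrightarrow> i < N"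
  by (simp add: idx_def)

lemma idx_down: "stage L \<Longrightarrow> j \<in> idx L \<Longrightarrow> i \<le> j \<Longrightarrow> i \<in> idx L"
  by (auto simp: stage_def)

lemma boundary_chain:
  assumes "cw_subcomplex K L" "c \<in> carrier (cell_chains K (Suc q) L)"
  shows "cell_boundary K c \<in> carrier (cell_chains K q L)"
  unfolding in_cell_chains
proof (intro allI impI)
  fix \<sigma> assume nz: "cell_boundary K c \<sigma> \<noteq> 0"
  then have \<sigma>: "\<sigma> \<in> cw_cells K"
    by (auto simp: cell_boundary_def split: if_splits)
  then have "(\<Sum>\<tau>\<in>cw_cells K. c \<tau> * of_int (incidence K \<tau> \<sigma>)) \<noteq> 0"
    using nz by (simp add: cell_boundary_def)
  then obtain \<tau> where \<tau>: "\<tau> \<in> cw_cells K" "c \<tau> * of_int (incidence K \<tau> \<sigma>) \<noteq> 0"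
    by (rule sum.not_neutral_contains_not_neutral)
  then have "c \<tau> \<noteq> 0" and inc: "incidence K \<tau> \<sigma> \<noteq> 0"
    by auto
  then have "\<tau> \<subseteq> L" "cw_dim K \<tau> = Suc q"
    using assms(2) by (auto simp: in_cell_chains)
  then show "\<sigma> \<in> cw_cells K \<and> \<sigma> \<subseteq> L \<and> cw_dim K \<sigma> = q"
    using incidence_support [OF \<sigma> \<tau>(1) inc assms(1)] incidence_dim [OF inc] \<sigma> by simp
qed

text \<open>Triangularity of \<open>V\<close> puts the support of column \<open>i\<close> at indices
  up to \<open>i\<close>, and these belong to the initial segment of the stage.\<close>

lemma b_chain:
  assumes "stage L" "i \<in> idx L" shows "b i \<in> carrier (cell_chains K (cw_dim K (cs ! i)) L)"
  unfolding in_cell_chains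
proof (intro allI impI)
  fix \<sigma> assume nz: "b i \<sigma> \<noteq> 0"
  have i: "i < N"
    using assms(2) by (rule idx_less)
  have \<sigma>: "\<sigma> \<in> cw_cells K"
    using nz b_outside by blast
  then obtain k where k: "k < N" "cs ! k = \<sigma>"
    using ex_index by blast
  then have "k \<le> i"
    using nz leads_b [OF i] unfolding leads_def by (meson not_le)
  then have "k \<in> idx L"
    using idx_down assms by blast
  then show "\<sigma> \<in> cw_cells K \<and> \<sigma> \<subseteq> L \<and> cw_dim K \<sigma> = cw_dim K (cs ! i)"
    using k \<sigma> b_nonzero_dim [OF i nz] by (simp add: idx_def)
qed

lemma leads_chain:
  assumes "c \<in> carrier (cell_chains K q L)" "leads cs c l"
  shows "l \<in> idx L" "cw_dim K (cs ! l) = q"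
  using assms by (auto simp: in_cell_chains leads_def idx_def)

lemma comb_update:
  assumes "j < N" "\<gamma> j = 0"
  shows "comb (\<gamma>(j := a)) = (\<lambda>\<sigma>. comb \<gamma> \<sigma> + a * b j \<sigma>)"
proof
  fix \<sigma>
  have "comb (\<gamma>(j := a)) \<sigma> = (\<Sum>i<N. \<gamma> i * b i \<sigma> + (if i = j then a * b j \<sigma> else 0))"
    unfolding comb_def using assms(2) by (intro sum.cong) auto
  then show "comb (\<gamma>(j := a)) \<sigma> = comb \<gamma> \<sigma> + a * b j \<sigma>"
    using assms(1) by (simp add: sum.distrib comb_def)
qed

lemma comb_zero: "(\<And>i. \<gamma> i = 0) \<Longrightarrow> comb \<gamma> = (\<lambda>\<sigma>. 0)"
  by (simp add: comb_def)

lemma chain_bound_0: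
  assumes "c \<in> carrier (cell_chains K q L)" "\<And>k. k < N \<Longrightarrow> c (cs ! k) = 0"
  shows "c = (\<lambda>\<sigma>. 0)"
  using assms by (intro chain_eqI) (auto simp: in_cell_chains)

text \<open>Elimination from the top. The number \<open>p\<close> is an exclusive bound on the
  support, so \<open>p = N\<close> covers all chains; the leading entry at \<open>p\<close> is
  removed with \<open>b p\<close>, which has coefficient 1 there.\<close>

lemma chain_expansion:
  fixes c :: "'a set \<Rightarrow> 'k"
  assumes "stage L" "c \<in> carrier (cell_chains K q L)" "\<And>k. k < N \<Longrightarrow> p \<le> k \<Longrightarrow> c (cs ! k) = 0"
  shows "\<exists>\<gamma>. (\<forall>i. \<gamma> i \<noteq> 0 \<longrightarrow> i \<in> idx L \<and> cw_dim K (cs ! i) = q \<and> i < p) \<and> c = comb \<gamma>"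
  using assms(2,3)
proof (induction p arbitrary: c)
  case 0
  have "c = (\<lambda>\<sigma>. 0)"
    by (rule chain_bound_0 [OF "0.prems"(1)]) (use "0.prems"(2) in simp)
  then have "c = comb (\<lambda>i. 0)"
    by (simp add: comb_zero)
  then show ?case
    by (intro exI [of _ "\<lambda>i. 0"] conjI) simp_all
next
  case (Suc p)
  show ?case
  proof (cases "p < N \<and> c (cs ! p) \<noteq> 0")
    case False
    then have "\<And>k. k < N \<Longrightarrow> p \<le> k \<Longrightarrow> c (cs ! k) = 0"
      using Suc.prems(2) by (metis le_antisym not_less_eq_eq)
    from Suc.IH [OF Suc.prems(1) this] show ?thesis
      using less_SucI by blast
  next
    case True
    then have "leads cs c p"
      using Suc.prems(2) by (auto simp: leads_def)
    then have p: "p \<in> idx L" "cw_dim K (cs ! p) = q"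
      using leads_chain [OF Suc.prems(1)] by auto
    let ?a = "c (cs ! p)"
    let ?d = "\<lambda>\<sigma>. c \<sigma> - ?a * b p \<sigma>"
    have "?d \<in> carrier (cell_chains K q L)"
      using b_chain [OF assms(1) p(1)] p(2) Suc.prems(1) by (intro cell_chains_diff cell_chains_smult) simp_all
    moreover have "?d (cs ! k) = 0" if "k < N" "p \<le> k" for k
    proof (cases "k = p")
      case False
      then show ?thesis
        using that Suc.prems(2) leads_b [of p] True by (simp add: leads_def)
    qed (use True b_diag in simp)
    ultimately obtain \<gamma> where \<gamma>: "\<forall>i. \<gamma> i \<noteq> 0 \<longrightarrow> i \<in> idx L \<and> cw_dim K (cs ! i) = q \<and> i < p" "?d = comb \<gamma>"
      using Suc.IH by blast
    have "c = comb (\<gamma>(p := ?a))"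
    proof -
      have "\<gamma> p = 0"
        using \<gamma>(1) by blast
      then have "comb (\<gamma>(p := ?a)) = (\<lambda>\<sigma>. ?d \<sigma> + ?a * b p \<sigma>)"
        using True by (simp add: comb_update \<gamma>(2) [symmetric])
      then show ?thesis
        by simp
    qed
    moreover have "\<forall>i. (\<gamma>(p := ?a)) i \<noteq> 0 \<longrightarrow> i \<in> idx L \<and> cw_dim K (cs ! i) = q \<and> i < Suc p"
      using \<gamma>(1) p by (auto intro: less_SucI)
    ultimately show ?thesis
      by blast
  qed
qed

lemma leads_comb:
  assumes "\<And>i. \<gamma> i \<noteq> 0 \<Longrightarrow> i < N" "\<gamma> j \<noteq> 0"
  obtains i where "\<gamma> i \<noteq> 0" "leads cs (comb \<gamma>) i"
proof -
  obtain i where "i \<in> {..<N}" "\<gamma> i \<noteq> 0" "leads cs (\<lambda>\<sigma>. \<Sum>i\<in>{..<N}. \<gamma> i * b i \<sigma>) i"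
    by (rule leads_sum [of "{..<N}" cs b "\<lambda>i. i" \<gamma>]) (use leads_b assms in auto)
  then show ?thesis
    using that by (simp add: comb_def)
qed

text \<open>Zero columns contribute nothing and the nonzero reduced columns have distinct lows, so
  the boundary leads at the low of one column that actually occurs.\<close>

lemma leads_boundary_comb:
  assumes "j < N" "\<delta> j \<noteq> 0" "r j \<noteq> (\<lambda>\<sigma>. 0)"
  obtains i l where "i < N" "\<delta> i \<noteq> 0" "leads cs (r i) l" "leads cs (cell_boundary K (comb \<delta>)) l"
proof -
  let ?I = "{i. i < N \<and> r i \<noteq> (\<lambda>\<sigma>. 0)}"
  let ?l = "\<lambda>i. low (col R i)"
  have leads: "leads cs (r i) (?l i)" if "i \<in> ?I" for i
    using that leads_low col_R_eq_0_iff by simp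
  have "inj_on ?l ?I"
  proof (rule inj_onI)
    fix i j assume i: "i \<in> ?I" and j: "j \<in> ?I" and eq: "?l i = ?l j"
    have "is_pair R (?l i) i"
      using leads [OF i] i by (simp add: is_pair_iff)
    moreover have "is_pair R (?l i) j"
      unfolding eq using leads [OF j] j by (simp add: is_pair_iff)
    ultimately show "i = j"
      by (rule pair_unique)
  qed
  moreover have "\<exists>i\<in>?I. \<delta> i \<noteq> 0"
    using assms by blast
  ultimately obtain i where i: "i \<in> ?I" "\<delta> i \<noteq> 0" "leads cs (\<lambda>\<sigma>. \<Sum>i\<in>?I. \<delta> i * r i \<sigma>) (?l i)"
    using leads_sum [of ?I cs r ?l \<delta>] leads by auto
  have "(\<Sum>i\<in>?I. \<delta> i * r i \<sigma>) = (\<Sum>i<N. \<delta> i * r i \<sigma>)" for \<sigma>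
    by (rule sum.mono_neutral_left) auto
  then have "leads cs (cell_boundary K (comb \<delta>)) (?l i)"
    using i(3) by (simp add: boundary_comb)
  then show ?thesis
    using that i leads by blast
qed

text \<open>The expansion of the cycle has a nonzero coefficient at its leading index. If the
  reduced column there were nonzero, the boundary of the cycle would have a leading entry.\<close>

lemma leads_cycle_positive:
  fixes c :: "'a set \<Rightarrow> 'k"
  assumes "stage L" "c \<in> cell_cycles K q L" "leads cs c l"
  shows "positive R l"
proof -
  have c: "c \<in> carrier (cell_chains K q L)" "cell_boundary K c = (\<lambda>\<sigma>. 0)"
    using assms(2) by (auto simp: cell_cycles_def)
  obtain \<gamma> where \<gamma>: "\<forall>i. \<gamma> i \<noteq> 0 \<longrightarrow> i \<in> idx L \<and> cw_dim K (cs ! i) = q \<and> i < N" "c = comb \<gamma>"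
    using chain_expansion [OF assms(1) c(1), of N] by auto
  have "\<exists>j. \<gamma> j \<noteq> 0"
  proof (rule ccontr)
    assume "\<not> (\<exists>j. \<gamma> j \<noteq> 0)"
    then have "c = (\<lambda>\<sigma>. 0)"
      using \<gamma>(2) comb_zero by simp
    then show False
      using assms(3) by (simp add: leads_def)
  qed
  then obtain i where "\<gamma> i \<noteq> 0" "leads cs c i"
    using leads_comb [of \<gamma>] \<gamma> by auto
  then have l: "\<gamma> l \<noteq> 0"
    using leads_unique [OF assms(3)] by blast
  have "r l = (\<lambda>\<sigma>. 0)"
  proof (rule ccontr)
    assume nz: "r l \<noteq> (\<lambda>\<sigma>. 0)"
    have "l < N"
      using assms(3) by (simp add: leads_def)
    from leads_boundary_comb [of l \<gamma>, OF this l nz] obtain k where "leads cs (cell_boundary K c) k"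
      using \<gamma>(2) by blast
    then show False
      by (simp add: c(2) leads_def)
  qed
  then show ?thesis
    using assms(3) by (simp add: positive_iff leads_def)
qed

text \<open>The classes of the \<open>b i\<close> with \<open>i \<in> unpaired q L\<close> form a basis of \<open>H\<^sub>q(L)\<close>.\<close>

definition unpaired :: "nat \<Rightarrow> 'a set \<Rightarrow> nat set" where
  "unpaired q L = {i \<in> idx L. positive R i \<and> cw_dim K (cs ! i) = q \<and> (\<forall>j\<in>idx L. \<not> is_pair R i j)}"

section \<open>Cycles modulo boundaries on a stage\<close>

lemma cell_boundaries_add:
  fixes c d :: "'a set \<Rightarrow> 'k"
  assumes "c \<in> cell_boundaries K q L" "d \<in> cell_boundaries K q L"
  shows "(\<lambda>\<sigma>. c \<sigma> + d \<sigma>) \<in> cell_boundaries K q L"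
  using assms cell_chains_add unfolding cell_boundaries_def
  by (force simp: boundary_add [symmetric])

lemma cell_boundaries_smult:
  fixes c :: "'a set \<Rightarrow> 'k"
  assumes "c \<in> cell_boundaries K q L"
  shows "(\<lambda>\<sigma>. a * c \<sigma>) \<in> cell_boundaries K q L"
  using assms cell_chains_smult unfolding cell_boundaries_def
  by (force simp: boundary_smult [symmetric])

lemma cell_boundaries_diff:
  fixes c d :: "'a set \<Rightarrow> 'k"
  assumes "c \<in> cell_boundaries K q L" "d \<in> cell_boundaries K q L"
  shows "(\<lambda>\<sigma>. c \<sigma> - d \<sigma>) \<in> cell_boundaries K q L"
  using cell_boundaries_add [OF assms(1) cell_boundaries_smult [OF assms(2), of "-1"]] by simp

lemma cell_boundaries_zero: "(\<lambda>\<sigma>. 0 :: 'k) \<in> cell_boundaries K q L"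
proof -
  have "cell_boundary K (\<lambda>\<sigma>. 0) = (\<lambda>\<sigma>. 0 :: 'k)"
    by (auto simp: cell_boundary_def)
  then show ?thesis
    unfolding cell_boundaries_def using cell_chains_zero by (metis imageI)
qed

text \<open>Here the vanishing of \<partial>\<partial> enters the algebra.\<close>

lemma cell_boundaries_subset_cycles:
  "cw_subcomplex K L \<Longrightarrow> (cell_boundaries K q L :: ('a set \<Rightarrow> 'k) set) \<subseteq> cell_cycles K q L"
  by (auto simp: cell_boundaries_def cell_cycles_def boundary_chain boundary_boundary)

lemma cell_cycles_diff:
  fixes c d :: "'a set \<Rightarrow> 'k"
  assumes "c \<in> cell_cycles K q L" "d \<in> cell_cycles K q L"
  shows "(\<lambda>\<sigma>. c \<sigma> - d \<sigma>) \<in> cell_cycles K q L"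
  using assms cell_chains_diff by (force simp: cell_cycles_def boundary_diff)

lemma cell_cycles_smult:
  fixes c :: "'a set \<Rightarrow> 'k"
  assumes "c \<in> cell_cycles K q L"
  shows "(\<lambda>\<sigma>. a * c \<sigma>) \<in> cell_cycles K q L"
  using assms cell_chains_smult by (force simp: cell_cycles_def boundary_smult)

lemma b_cycle:
  assumes "stage L" "i \<in> idx L" "positive R i" "cw_dim K (cs ! i) = q"
  shows "b i \<in> cell_cycles K q L"
  using b_chain [OF assms(1,2)] assms(3,4) by (simp add: cell_cycles_def positive_iff r_def)

text \<open>Elimination from the top, where the leading cell is positive. If it is unpaired on the
  stage, its birth cycle removes the entry; otherwise the boundary \<open>r j\<close> of its partner
  does, which leaves the class unchanged. The bound \<open>i < p\<close> later confines the
  transition coefficients to cells that exist before t.\<close>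

lemma cycle_expansion:
  fixes c :: "'a set \<Rightarrow> 'k"
  assumes "stage L" "c \<in> cell_cycles K q L" "\<And>k. k < N \<Longrightarrow> p \<le> k \<Longrightarrow> c (cs ! k) = 0"
  shows "\<exists>\<gamma>. (\<forall>i. \<gamma> i \<noteq> 0 \<longrightarrow> i \<in> unpaired q L \<and> i < p) \<and> (\<lambda>\<sigma>. c \<sigma> - comb \<gamma> \<sigma>) \<in> cell_boundaries K q L"
  using assms(2,3)
proof (induction p arbitrary: c)
  case 0
  have "c \<in> carrier (cell_chains K q L)"
    using "0.prems"(1) by (simp add: cell_cycles_def)
  then have "c = (\<lambda>\<sigma>. 0)"
    by (rule chain_bound_0) (use "0.prems"(2) in simp)
  then have "(\<lambda>\<sigma>. c \<sigma> - comb (\<lambda>i. 0) \<sigma>) \<in> cell_boundaries K q L"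
    using cell_boundaries_zero by (simp add: comb_zero)
  then show ?case
    by (intro exI [of _ "\<lambda>i. 0"] conjI) simp_all
next
  case (Suc p)
  show ?case
  proof (cases "p < N \<and> c (cs ! p) \<noteq> 0")
    case False
    then have "\<And>k. k < N \<Longrightarrow> p \<le> k \<Longrightarrow> c (cs ! k) = 0"
      using Suc.prems(2) by (metis le_antisym not_less_eq_eq)
    from Suc.IH [OF Suc.prems(1) this] show ?thesis
      using less_SucI by blast
  next
    case True
    then have leads: "leads cs c p"
      using Suc.prems(2) by (auto simp: leads_def)
    have p: "p \<in> idx L" "cw_dim K (cs ! p) = q"
      using leads_chain [OF _ leads] Suc.prems(1) by (auto simp: cell_cycles_def)
    have pos: "positive R p"
      by (rule leads_cycle_positive [OF assms(1) Suc.prems(1) leads])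
    show ?thesis
    proof (cases "p \<in> unpaired q L")
      case unp: True
      let ?a = "c (cs ! p)"
      let ?d = "\<lambda>\<sigma>. c \<sigma> - ?a * b p \<sigma>"
      have "?d \<in> cell_cycles K q L"
        using b_cycle [OF assms(1) p(1) pos p(2)] Suc.prems(1) by (intro cell_cycles_diff cell_cycles_smult)
      moreover have "?d (cs ! k) = 0" if "k < N" "p \<le> k" for k
      proof (cases "k = p")
        case False
        then show ?thesis
          using that Suc.prems(2) leads_b [of p] True by (simp add: leads_def)
      qed (use True b_diag in simp)
      ultimately obtain \<gamma> where \<gamma>: "\<forall>i. \<gamma> i \<noteq> 0 \<longrightarrow> i \<in> unpaired q L \<and> i < p"
        "(\<lambda>\<sigma>. ?d \<sigma> - comb \<gamma> \<sigma>) \<in> cell_boundaries K q L"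
        using Suc.IH by blast
      have "\<gamma> p = 0"
        using \<gamma>(1) by blast
      then have "comb (\<gamma>(p := ?a)) = (\<lambda>\<sigma>. comb \<gamma> \<sigma> + ?a * b p \<sigma>)"
        using True by (simp add: comb_update)
      then have "(\<lambda>\<sigma>. c \<sigma> - comb (\<gamma>(p := ?a)) \<sigma>) \<in> cell_boundaries K q L"
        using \<gamma>(2) by (simp add: algebra_simps)
      moreover have "\<forall>i. (\<gamma>(p := ?a)) i \<noteq> 0 \<longrightarrow> i \<in> unpaired q L \<and> i < Suc p"
        using \<gamma>(1) unp by (auto intro: less_SucI)
      ultimately show ?thesis
        by blast
    next
      case False
      then obtain j where j: "j \<in> idx L" "is_pair R p j"
        using p pos by (auto simp: unpaired_def)
      then have lr: "leads cs (r j) p"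
        by (simp add: is_pair_iff)
      have "r j (cs ! p) \<noteq> 0"
        using lr by (simp add: leads_def)
      \<comment> \<open>A nonzero entry of the reduced column in a row of dimension q forces the
        column to have dimension q + 1, so that \<open>r j\<close> is a q-boundary.\<close>
      then have "(\<Sum>\<tau>\<in>cw_cells K. b j \<tau> * of_int (incidence K \<tau> (cs ! p))) \<noteq> 0"
        using True nth_cell by (simp add: r_def cell_boundary_def)
      then obtain \<tau> where "b j \<tau> * of_int (incidence K \<tau> (cs ! p)) \<noteq> 0"
        by (rule sum.not_neutral_contains_not_neutral)
      then have "b j \<tau> \<noteq> 0" "incidence K \<tau> (cs ! p) \<noteq> 0"
        by auto
      then have "cw_dim K (cs ! j) = Suc q"
        using b_nonzero_dim [OF idx_less [OF j(1)], of \<tau>] incidence_dim [of \<tau> "cs ! p"] p(2) by simp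
      then have rj: "r j \<in> cell_boundaries K q L"
        using b_chain [OF assms(1) j(1)] by (auto simp: cell_boundaries_def r_def)
      \<comment> \<open>Unlike \<open>b p\<close>, the reduced column need not have leading
        coefficient 1.\<close>
      let ?a = "c (cs ! p) / r j (cs ! p)"
      let ?d = "\<lambda>\<sigma>. c \<sigma> - ?a * r j \<sigma>"
      have "r j \<in> cell_cycles K q L"
        using rj cell_boundaries_subset_cycles assms(1) by (auto simp: stage_def)
      then have "?d \<in> cell_cycles K q L"
        using Suc.prems(1) by (intro cell_cycles_diff cell_cycles_smult)
      moreover have "?d (cs ! k) = 0" if "k < N" "p \<le> k" for k
      proof (cases "k = p")
        case False
        then show ?thesis
          using that Suc.prems(2) lr by (simp add: leads_def)
      qed (use \<open>r j (cs ! p) \<noteq> 0\<close> in simp)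
      ultimately obtain \<gamma> where \<gamma>: "\<forall>i. \<gamma> i \<noteq> 0 \<longrightarrow> i \<in> unpaired q L \<and> i < p"
        "(\<lambda>\<sigma>. ?d \<sigma> - comb \<gamma> \<sigma>) \<in> cell_boundaries K q L"
        using Suc.IH by blast
      have "(\<lambda>\<sigma>. (?d \<sigma> - comb \<gamma> \<sigma>) + ?a * r j \<sigma>) \<in> cell_boundaries K q L"
        by (intro cell_boundaries_add \<gamma>(2) cell_boundaries_smult rj)
      then have "(\<lambda>\<sigma>. c \<sigma> - comb \<gamma> \<sigma>) \<in> cell_boundaries K q L"
        by (simp add: algebra_simps)
      then show ?thesis
        using \<gamma>(1) less_SucI by blast
    qed
  qed
qed

text \<open>Two readings of the same leading index. As a combination of birth cycles, the chain
  leads at some \<open>i\<close> with nonzero coefficient; as the boundary of a chain of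
  \<open>L\<close>, it leads at the low of a column of \<open>L\<close>. Hence \<open>i\<close> is
  paired on \<open>L\<close>.\<close>

lemma unpaired_independent:
  fixes \<gamma> :: "nat \<Rightarrow> 'k"
  assumes "stage L" "comb \<gamma> \<in> cell_boundaries K q L" "\<And>i. \<gamma> i \<noteq> 0 \<Longrightarrow> i \<in> unpaired q L"
  shows "\<gamma> j = 0"
proof (rule ccontr)
  assume "\<gamma> j \<noteq> 0"
  have lessN: "\<And>i. \<gamma> i \<noteq> 0 \<Longrightarrow> i < N"
    using assms(3) idx_less by (auto simp: unpaired_def)
  obtain i where i: "\<gamma> i \<noteq> 0" "leads cs (comb \<gamma>) i"
    using leads_comb [of \<gamma> j] lessN \<open>\<gamma> j \<noteq> 0\<close> by blast
  obtain d where d: "d \<in> carrier (cell_chains K (Suc q) L)" "comb \<gamma> = cell_boundary K d"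
    using assms(2) by (auto simp: cell_boundaries_def)
  obtain \<delta> where \<delta>: "\<forall>i. \<delta> i \<noteq> 0 \<longrightarrow> i \<in> idx L \<and> cw_dim K (cs ! i) = Suc q \<and> i < N" "d = comb \<delta>"
    using chain_expansion [OF assms(1) d(1), of N] by auto
  have "\<exists>k<N. \<delta> k \<noteq> 0 \<and> r k \<noteq> (\<lambda>\<sigma>. 0)"
  proof (rule ccontr)
    assume no: "\<not> (\<exists>k<N. \<delta> k \<noteq> 0 \<and> r k \<noteq> (\<lambda>\<sigma>. 0))"
    have "\<delta> k * r k \<sigma> = 0" if "k < N" for k \<sigma>
      using no that by (cases "\<delta> k = 0") auto
    then have "comb \<gamma> = (\<lambda>\<sigma>. 0)"
      unfolding d(2) \<delta>(2) boundary_comb by (intro ext sum.neutral) blast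
    then show False
      using i(2) by (simp add: leads_def)
  qed
  then obtain k where "k < N" "\<delta> k \<noteq> 0" "r k \<noteq> (\<lambda>\<sigma>. 0)"
    by blast
  then obtain m l where m: "m < N" "\<delta> m \<noteq> 0" "leads cs (r m) l" "leads cs (cell_boundary K (comb \<delta>)) l"
    by (rule leads_boundary_comb)
  then have "l = i"
    using i(2) leads_unique d(2) \<delta>(2) by auto
  then have "is_pair R i m" "m \<in> idx L"
    using m \<delta>(1) by (auto simp: is_pair_iff)
  then show False
    using assms(3) [OF i(1)] by (auto simp: unpaired_def)
qed

end

section \<open>Homology classes\<close>

lemma homology_class_eq:
  "homology_class K q L c = (\<lambda>d. (\<lambda>\<sigma>. d \<sigma> + c \<sigma>)) ` cell_boundaries K q L"
  by (auto simp: homology_class_def a_r_coset_def r_coset_def cell_chains_def)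

lemma cell_homology_simps:
  "carrier (cell_homology K q L) = homology_class K q L ` cell_cycles K q L"
  "zero (cell_homology K q L) = cell_boundaries K q L"
  "add (cell_homology K q L) x y = (\<Union>c\<in>x. \<Union>d\<in>y. {\<lambda>\<sigma>. c \<sigma> + d \<sigma>})"
  "smult (cell_homology K q L) a x = (\<Union>c\<in>x. homology_class K q L (\<lambda>\<sigma>. a * c \<sigma>))"
  by (simp_all add: cell_homology_def set_add_def set_mult_def cell_chains_def)

context persistence
begin

lemma mem_homology_class:
  "(d :: 'a set \<Rightarrow> 'k) \<in> homology_class K q L c \<longleftrightarrow> (\<lambda>\<sigma>. d \<sigma> - c \<sigma>) \<in> cell_boundaries K q L"
proof
  assume "(\<lambda>\<sigma>. d \<sigma> - c \<sigma>) \<in> cell_boundaries K q L"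
  then show "d \<in> homology_class K q L c"
    unfolding homology_class_eq by (rule rev_image_eqI) simp
qed (auto simp: homology_class_eq)

lemma homology_class_self: "(c :: 'a set \<Rightarrow> 'k) \<in> homology_class K q L c"
  by (simp add: mem_homology_class cell_boundaries_zero)

lemma homology_class_eq_iff:
  fixes c d :: "'a set \<Rightarrow> 'k"
  shows "homology_class K q L c = homology_class K q L d \<longleftrightarrow> (\<lambda>\<sigma>. c \<sigma> - d \<sigma>) \<in> cell_boundaries K q L"
proof
  assume "homology_class K q L c = homology_class K q L d"
  then show "(\<lambda>\<sigma>. c \<sigma> - d \<sigma>) \<in> cell_boundaries K q L"
    using homology_class_self [of c q L] by (simp add: mem_homology_class)
next
  assume cd: "(\<lambda>\<sigma>. c \<sigma> - d \<sigma>) \<in> cell_boundaries K q L"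
  show "homology_class K q L c = homology_class K q L d"
  proof (intro Set.set_eqI)
    fix e :: "'a set \<Rightarrow> 'k"
    show "e \<in> homology_class K q L c \<longleftrightarrow> e \<in> homology_class K q L d"
      unfolding mem_homology_class
      using cell_boundaries_add [OF _ cd, of "\<lambda>\<sigma>. e \<sigma> - c \<sigma>"] cell_boundaries_diff [OF _ cd, of "\<lambda>\<sigma>. e \<sigma> - d \<sigma>"]
      by auto
  qed
qed

lemma homology_class_zero: "homology_class K q L (\<lambda>\<sigma>. 0) = (cell_boundaries K q L :: ('a set \<Rightarrow> 'k) set)"
  by (auto simp: mem_homology_class)

lemma homology_class_eq_zero_iff:
  "homology_class K q L c = cell_boundaries K q L \<longleftrightarrow> (c :: 'a set \<Rightarrow> 'k) \<in> cell_boundaries K q L"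
  using homology_class_eq_iff [of q L c "\<lambda>\<sigma>. 0"] by (simp add: homology_class_zero)

lemma homology_class_add:
  fixes c d :: "'a set \<Rightarrow> 'k"
  shows "homology_class K q L c \<oplus>\<^bsub>cell_homology K q L\<^esub> homology_class K q L d = homology_class K q L (\<lambda>\<sigma>. c \<sigma> + d \<sigma>)"
proof (intro Set.set_eqI iffI)
  fix e assume "e \<in> homology_class K q L c \<oplus>\<^bsub>cell_homology K q L\<^esub> homology_class K q L d"
  then obtain c' d' where "c' \<in> homology_class K q L c" "d' \<in> homology_class K q L d" "e = (\<lambda>\<sigma>. c' \<sigma> + d' \<sigma>)"
    by (auto simp: cell_homology_simps)
  then show "e \<in> homology_class K q L (\<lambda>\<sigma>. c \<sigma> + d \<sigma>)"
    using cell_boundaries_add [of "\<lambda>\<sigma>. c' \<sigma> - c \<sigma>" q L "\<lambda>\<sigma>. d' \<sigma> - d \<sigma>"]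
    by (simp add: mem_homology_class algebra_simps)
next
  fix e assume "e \<in> homology_class K q L (\<lambda>\<sigma>. c \<sigma> + d \<sigma>)"
  then have "(\<lambda>\<sigma>. e \<sigma> - d \<sigma>) \<in> homology_class K q L c"
    by (simp add: mem_homology_class algebra_simps)
  moreover have "e = (\<lambda>\<sigma>. (e \<sigma> - d \<sigma>) + d \<sigma>)"
    by simp
  ultimately show "e \<in> homology_class K q L c \<oplus>\<^bsub>cell_homology K q L\<^esub> homology_class K q L d"
    unfolding cell_homology_simps using homology_class_self [of d q L] by blast
qed

lemma homology_class_smult:
  fixes c :: "'a set \<Rightarrow> 'k"
  shows "a \<odot>\<^bsub>cell_homology K q L\<^esub> homology_class K q L c = homology_class K q L (\<lambda>\<sigma>. a * c \<sigma>)"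
proof -
  have "homology_class K q L (\<lambda>\<sigma>. a * d \<sigma>) = homology_class K q L (\<lambda>\<sigma>. a * c \<sigma>)"
    if "d \<in> homology_class K q L c" for d
    using cell_boundaries_smult [of "\<lambda>\<sigma>. d \<sigma> - c \<sigma>" q L a] that
    by (simp add: homology_class_eq_iff mem_homology_class algebra_simps)
  then show ?thesis
    unfolding cell_homology_simps using homology_class_self [of c q L] by blast
qed

text \<open>The union defining the induced map runs over cosets that all coincide, since
  representatives of one class differ by a boundary in \<open>L\<close>, which is also one in
  \<open>L'\<close>.\<close>

lemma incl_induced_class:
  fixes c :: "'a set \<Rightarrow> 'k"
  assumes "L \<subseteq> L'"
  shows "incl_induced K q L' (homology_class K q L c) = homology_class K q L' c"
proof -
  have "homology_class K q L' d = homology_class K q L' c" if "d \<in> homology_class K q L c" for d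
    using that cell_chains_mono [OF assms, of K "Suc q"]
    unfolding homology_class_eq_iff mem_homology_class cell_boundaries_def by blast
  then show ?thesis
    unfolding incl_induced_def using homology_class_self [of c q L] by blast
qed

lemma cell_cycles_add:
  fixes c d :: "'a set \<Rightarrow> 'k"
  assumes "c \<in> cell_cycles K q L" "d \<in> cell_cycles K q L"
  shows "(\<lambda>\<sigma>. c \<sigma> + d \<sigma>) \<in> cell_cycles K q L"
  using assms cell_chains_add by (force simp: cell_cycles_def boundary_add)

lemma cell_cycles_zero: "(\<lambda>\<sigma>. 0 :: 'k) \<in> cell_cycles K q L"
  using cell_chains_zero by (force simp: cell_cycles_def cell_boundary_def)

lemma cell_cycles_mono: "L \<subseteq> L' \<Longrightarrow> (cell_cycles K q L :: ('a set \<Rightarrow> 'k) set) \<subseteq> cell_cycles K q L'"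
  using cell_chains_mono by (force simp: cell_cycles_def)

lemma class_carrier:
  "(c :: 'a set \<Rightarrow> 'k) \<in> cell_cycles K q L \<Longrightarrow> homology_class K q L c \<in> carrier (cell_homology K q L)"
  by (simp add: cell_homology_simps)

text \<open>The operations act on representatives, so each axiom reduces to an identity of chains;
  the negative of a class is represented by -1 times a cycle.\<close>

lemma vectorspace_cell_homology:
  "vectorspace class_ring (cell_homology K q L :: ('k, ('a set \<Rightarrow> 'k) set) module)"
proof -
  let ?H = "cell_homology K q L :: ('k, ('a set \<Rightarrow> 'k) set) module"
  have cases: "\<exists>c\<in>cell_cycles K q L. x = homology_class K q L c" if "x \<in> carrier ?H" for x
    using that by (auto simp: cell_homology_simps)
  have zero: "\<zero>\<^bsub>?H\<^esub> = homology_class K q L (\<lambda>\<sigma>. 0)"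
    by (simp add: cell_homology_simps(2) homology_class_zero)
  note ops = homology_class_add homology_class_smult zero class_carrier
    cell_cycles_add cell_cycles_smult cell_cycles_zero
  show ?thesis
  proof (rule vs_criteria)
    show "field (class_ring :: 'k ring)"
      by (rule class_field)
    show "\<forall>v\<in>carrier ?H. \<exists>neg_v\<in>carrier ?H. v \<oplus>\<^bsub>?H\<^esub> neg_v = \<zero>\<^bsub>?H\<^esub>"
    proof
      fix v assume "v \<in> carrier ?H"
      then obtain c where c: "c \<in> cell_cycles K q L" "v = homology_class K q L c"
        using cases by blast
      have "homology_class K q L (\<lambda>\<sigma>. (-1) * c \<sigma>) \<in> carrier ?H"
        by (intro ops c)
      moreover have "v \<oplus>\<^bsub>?H\<^esub> homology_class K q L (\<lambda>\<sigma>. (-1) * c \<sigma>) = \<zero>\<^bsub>?H\<^esub>"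
        by (simp add: c(2) ops)
      ultimately show "\<exists>neg_v\<in>carrier ?H. v \<oplus>\<^bsub>?H\<^esub> neg_v = \<zero>\<^bsub>?H\<^esub>"
        by blast
    qed
  qed (auto dest!: cases simp: ops algebra_simps)
qed

end

section \<open>Persistence intervals and the kernel\<close>

context persistence
begin

lemma Union_index_mem:
  assumes "i < N" shows "cs ! i \<subseteq> \<Union>{\<sigma> \<in> cw_cells K. P \<sigma>} \<longleftrightarrow> P (cs ! i)"
proof
  assume sub: "cs ! i \<subseteq> \<Union>{\<sigma> \<in> cw_cells K. P \<sigma>}"
  obtain x where "x \<in> cs ! i"
    using cell_nonempty [OF nth_cell [OF assms]] by blast
  moreover from this obtain \<sigma> where "\<sigma> \<in> cw_cells K" "P \<sigma>" "x \<in> \<sigma>"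
    using sub by blast
  ultimately show "P (cs ! i)"
    using cells_disjoint [OF nth_cell [OF assms]] by blast
qed (use nth_cell [OF assms] in blast)

lemma idx_sublevel: "idx (sublevel K f t) = {i. i < N \<and> f (cs ! i) \<le> t}"
  unfolding idx_def sublevel_def
  by (rule Collect_cong, rule conj_cong [OF refl], rule Union_index_mem)

lemma idx_strict_sublevel: "idx (strict_sublevel K f t) = {i. i < N \<and> f (cs ! i) < t}"
  unfolding idx_def strict_sublevel_def
  by (rule Collect_cong, rule conj_cong [OF refl], rule Union_index_mem)

lemma order_mono:
  assumes "i \<le> j" "j < N" shows "f (cs ! i) \<le> f (cs ! j)"
proof (rule ccontr)
  assume "\<not> f (cs ! i) \<le> f (cs ! j)"
  moreover have "\<forall>i<N. \<forall>j<N. f (cs ! i) < f (cs ! j) \<longrightarrow> i < j"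
    using order unfolding compatible_order_def by blast
  ultimately have "j < i"
    using assms by (meson le_less_trans not_le)
  then show False
    using assms by simp
qed

lemma stage_sublevel: "stage (sublevel K f t)"
  unfolding stage_def
proof (intro conjI allI impI)
  show "cw_subcomplex K (sublevel K f t)"
    using subcomplexes by (simp add: filtration_by_subcomplexes_def)
  show "i \<in> idx (sublevel K f t)" if "i \<le> j" "j \<in> idx (sublevel K f t)" for i j
    using that order_mono [of i j] by (simp add: idx_sublevel)
qed

lemma stage_strict_sublevel: "stage (strict_sublevel K f t)"
  unfolding stage_def
proof (intro conjI allI impI)
  show "cw_subcomplex K (strict_sublevel K f t)"
    using subcomplexes by (simp add: filtration_by_subcomplexes_def)
  show "i \<in> idx (strict_sublevel K f t)" if "i \<le> j" "j \<in> idx (strict_sublevel K f t)" for i j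
    using that order_mono [of i j] by (simp add: idx_strict_sublevel)
qed

lemma strict_sublevel_subset: "strict_sublevel K f t \<subseteq> sublevel K f t"
  by (auto simp: strict_sublevel_def sublevel_def)

text \<open>There is at most one partner, and its filtration value is the death. Its absence from
  the strict sublevel set gives a weak inequality; for the closed sublevel set the inequality
  becomes strict.\<close>

lemma unpaired_strict_sublevel:
  "(\<forall>j\<in>idx (strict_sublevel K f t). \<not> is_pair R i j) \<longleftrightarrow> ereal t \<le> death f cs R i"
proof (cases "\<exists>j. is_pair R i j")
  case True
  then obtain j where j: "is_pair R i j"
    by blast
  then have "j < N"
    by (simp add: is_pair_iff)
  moreover have "is_pair R i j' \<longleftrightarrow> j' = j" for j'
    using j pair_unique [OF j, of j'] by blast
  ultimately show ?thesis
    by (auto simp: idx_strict_sublevel death_eq [OF j])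
qed (auto simp: death_infinite)

lemma unpaired_sublevel:
  "(\<forall>j\<in>idx (sublevel K f t). \<not> is_pair R i j) \<longleftrightarrow> ereal t < death f cs R i"
proof (cases "\<exists>j. is_pair R i j")
  case True
  then obtain j where j: "is_pair R i j"
    by blast
  then have "j < N"
    by (simp add: is_pair_iff)
  moreover have "is_pair R i j' \<longleftrightarrow> j' = j" for j'
    using j pair_unique [OF j, of j'] by blast
  ultimately show ?thesis
    by (auto simp: idx_sublevel death_eq [OF j])
qed (auto simp: death_infinite)

section \<open>Classes just before and at a fixed value t\<close>

context
  fixes q :: nat and t :: real
begin

abbreviation Lb :: "'a set" where "Lb \<equiv> strict_sublevel K f t"
abbreviation Lt :: "'a set" where "Lt \<equiv> sublevel K f t"
abbreviation D :: "nat set" where "D \<equiv> dying K f cs R q t"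
abbreviation S :: "nat set" where "S \<equiv> surviving K f cs R q t"
abbreviation Hb :: "('k, ('a set \<Rightarrow> 'k) set) module" where "Hb \<equiv> cell_homology K q Lb"
abbreviation Ht :: "('k, ('a set \<Rightarrow> 'k) set) module" where "Ht \<equiv> cell_homology K q Lt"

text \<open>For a birth before t, a death at t or later already makes the interval nonzero; the
  cases of equality and strict inequality are \<open>D\<close> and \<open>S\<close>.\<close>

lemma unpaired_Lb: "unpaired q Lb = D \<union> S"
proof (intro Set.set_eqI)
  fix i
  have "i \<in> unpaired q Lb \<longleftrightarrow>
      (i < N \<and> f (cs ! i) < t) \<and> positive R i \<and> cw_dim K (cs ! i) = q \<and> ereal t \<le> death f cs R i"
    by (simp only: unpaired_def mem_Collect_eq unpaired_strict_sublevel)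
      (simp only: idx_strict_sublevel mem_Collect_eq)
  moreover have "ereal t \<le> death f cs R i \<longleftrightarrow> death f cs R i = ereal t \<or> ereal t < death f cs R i"
    by auto
  moreover have "f (cs ! i) < t \<Longrightarrow> ereal t \<le> death f cs R i \<Longrightarrow> ereal (f (cs ! i)) < death f cs R i"
    by (rule less_le_trans [of _ "ereal t"]) simp_all
  moreover have "positive R i \<Longrightarrow> i < N"
    by (simp add: positive_iff)
  ultimately show "i \<in> unpaired q Lb \<longleftrightarrow> i \<in> D \<union> S"
    unfolding Un_iff dying_def surviving_def intervals_def birth_def mem_Collect_eq by blast
qed

text \<open>The basis of homology at t also contains the unpaired classes born at t; intersecting
  with the earlier indices discards them.\<close>

lemma S_eq: "S = unpaired q Lt \<inter> idx Lb"
proof (intro Set.set_eqI)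
  fix i
  have "i \<in> unpaired q Lt \<longleftrightarrow>
      (i < N \<and> f (cs ! i) \<le> t) \<and> positive R i \<and> cw_dim K (cs ! i) = q \<and> ereal t < death f cs R i"
    by (simp only: unpaired_def mem_Collect_eq unpaired_sublevel)
      (simp only: idx_sublevel mem_Collect_eq)
  moreover have "f (cs ! i) < t \<Longrightarrow> ereal t < death f cs R i \<Longrightarrow> ereal (f (cs ! i)) < death f cs R i"
    by (rule less_trans [of _ "ereal t"]) simp_all
  moreover have "positive R i \<Longrightarrow> i < N"
    by (simp add: positive_iff)
  moreover have "f (cs ! i) < t \<Longrightarrow> f (cs ! i) \<le> t"
    by simp
  ultimately show "i \<in> S \<longleftrightarrow> i \<in> unpaired q Lt \<inter> idx Lb"
    unfolding Int_iff surviving_def intervals_def birth_def idx_strict_sublevel mem_Collect_eq by blast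
qed

lemma D_S_disjoint: "u \<in> D \<Longrightarrow> u \<notin> S"
  by (auto simp: dying_def surviving_def)

lemma D_S_less: "u \<in> D \<union> S \<Longrightarrow> u < N"
  using unpaired_Lb by (auto simp: unpaired_def idx_def)

lemma finite_D: "finite D" and finite_S: "finite S"
  using D_S_less by (auto intro: finite_subset [of _ "{..<N}"])

lemma b_cycle_Lb: "u \<in> D \<union> S \<Longrightarrow> b u \<in> cell_cycles K q Lb"
  unfolding unpaired_Lb [symmetric] unpaired_def by (intro b_cycle [OF stage_strict_sublevel]) auto

lemma b_cycle_Lt: "u \<in> D \<union> S \<Longrightarrow> b u \<in> cell_cycles K q Lt"
  using b_cycle_Lb cell_cycles_mono [OF strict_sublevel_subset] by blast

lemma finsum_class:
  fixes x :: "'i \<Rightarrow> 'a set \<Rightarrow> 'k"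
  assumes "finite A" "\<And>i. i \<in> A \<Longrightarrow> x i \<in> cell_cycles K q L"
  shows "(\<Oplus>\<^bsub>cell_homology K q L\<^esub>i\<in>A. \<gamma> i \<odot>\<^bsub>cell_homology K q L\<^esub> homology_class K q L (x i)) =
    homology_class K q L (\<lambda>\<sigma>. \<Sum>i\<in>A. \<gamma> i * x i \<sigma>)"
proof -
  interpret H: vectorspace class_ring "cell_homology K q L :: ('k, ('a set \<Rightarrow> 'k) set) module"
    by (rule vectorspace_cell_homology)
  show ?thesis
    using assms
  proof (induction A rule: finite_induct)
    case empty
    show ?case
      by (simp add: cell_homology_simps(2) homology_class_zero)
  next
    case (insert i A)
    have "(\<lambda>i. homology_class K q L (\<lambda>\<sigma>. \<gamma> i * x i \<sigma>)) \<in> insert i A \<rightarrow> carrier (cell_homology K q L)"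
      using insert.prems by (auto intro!: class_carrier cell_cycles_smult)
    then show ?case
      using insert by (simp add: homology_class_smult homology_class_add Pi_iff)
  qed
qed

lemma comb_support: "finite A \<Longrightarrow> A \<subseteq> {..<N} \<Longrightarrow> (\<And>i. i \<notin> A \<Longrightarrow> \<gamma> i = 0) \<Longrightarrow> comb \<gamma> = (\<lambda>\<sigma>. \<Sum>i\<in>A. \<gamma> i * b i \<sigma>)"
  unfolding comb_def by (intro ext sum.mono_neutral_right) auto

lemma comb_sum: "comb (\<lambda>i. \<Sum>u\<in>A. a u * g u i) = (\<lambda>\<sigma>. \<Sum>u\<in>A. a u * comb (g u) \<sigma>)"
  unfolding comb_def
  by (simp add: sum_distrib_left sum_distrib_right mult.assoc) (subst sum.swap, simp)

lemma comb_diff: "comb (\<lambda>i. \<gamma> i - \<delta> i) = (\<lambda>\<sigma>. comb \<gamma> \<sigma> - comb \<delta> \<sigma>)"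
  by (simp add: comb_def algebra_simps sum_subtractf)

lemma comb_unit: "u < N \<Longrightarrow> comb (\<lambda>i. if i = u then 1 else 0) = b u"
  by (simp add: comb_def if_distrib [of "\<lambda>x. x * _"] cong: if_cong)

lemma sum_S_class:
  assumes "L = Lb \<or> L = Lt" "\<And>v. v \<notin> S \<Longrightarrow> w v = 0"
  shows "(\<Oplus>\<^bsub>cell_homology K q L\<^esub>v\<in>S. w v \<odot>\<^bsub>cell_homology K q L\<^esub> homology_class K q L (birth_cycle cs V v)) =
    homology_class K q L (comb w)"
proof -
  have "comb w = (\<lambda>\<sigma>. \<Sum>v\<in>S. w v * b v \<sigma>)"
    using finite_S D_S_less assms(2) by (intro comb_support) auto
  then show ?thesis
    using finsum_class [OF finite_S, of b L w] b_cycle_Lb b_cycle_Lt assms(1) by (auto simp: b_def)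
qed

lemma ex1_transition:
  assumes "u \<in> D"
  shows "\<exists>!w. (\<forall>v. v \<notin> S \<longrightarrow> w v = 0) \<and> (\<lambda>\<sigma>. b u \<sigma> - comb w \<sigma>) \<in> cell_boundaries K q Lt"
proof (rule ex_ex1I)
  have u: "u < N" "u \<in> idx Lb"
    using assms D_S_less unpaired_Lb by (auto simp: unpaired_def)
  \<comment> \<open>The bound is \<open>Suc u\<close> because \<open>b u\<close> leads at
    \<open>u\<close>. All indices that occur are then at most \<open>u\<close>, hence before t, and
    so in \<open>S\<close>.\<close>
  obtain \<gamma> where \<gamma>: "\<forall>i. \<gamma> i \<noteq> 0 \<longrightarrow> i \<in> unpaired q Lt \<and> i < Suc u"
    "(\<lambda>\<sigma>. b u \<sigma> - comb \<gamma> \<sigma>) \<in> cell_boundaries K q Lt"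
    using cycle_expansion [OF stage_sublevel b_cycle_Lt, of u "Suc u"] assms leads_b [OF u(1)]
    by (auto simp: leads_def)
  have "\<gamma> v = 0" if "v \<notin> S" for v
  proof (rule ccontr)
    assume "\<gamma> v \<noteq> 0"
    then have "v \<in> unpaired q Lt" "v \<in> idx Lb"
      using \<gamma>(1) idx_down [OF stage_strict_sublevel u(2)] by auto
    then show False
      using that S_eq by blast
  qed
  then show "\<exists>w. (\<forall>v. v \<notin> S \<longrightarrow> w v = 0) \<and> (\<lambda>\<sigma>. b u \<sigma> - comb w \<sigma>) \<in> cell_boundaries K q Lt"
    using \<gamma>(2) by blast
next
  fix w w'
  assume w: "(\<forall>v. v \<notin> S \<longrightarrow> w v = 0) \<and> (\<lambda>\<sigma>. b u \<sigma> - comb w \<sigma>) \<in> cell_boundaries K q Lt"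
    and w': "(\<forall>v. v \<notin> S \<longrightarrow> w' v = 0) \<and> (\<lambda>\<sigma>. b u \<sigma> - comb w' \<sigma>) \<in> cell_boundaries K q Lt"
  have "comb (\<lambda>i. w i - w' i) \<in> cell_boundaries K q Lt"
    using cell_boundaries_diff [OF conjunct2 [OF w'] conjunct2 [OF w]] by (simp add: comb_diff)
  moreover have "i \<in> unpaired q Lt" if "w i - w' i \<noteq> 0" for i
  proof -
    have "i \<in> S"
      using that w w' by (cases "i \<in> S") auto
    then show ?thesis
      using S_eq by blast
  qed
  ultimately have "w i - w' i = 0" for i
    by (rule unpaired_independent [OF stage_sublevel, where \<gamma> = "\<lambda>i. w i - w' i"])
  then show "w = w'"
    by auto
qed

abbreviation w :: "nat \<Rightarrow> nat \<Rightarrow> 'k" where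
  "w \<equiv> transition_coeffs K f cs R V q t"

lemma transition:
  assumes "u \<in> D"
  shows "\<And>v. v \<notin> S \<Longrightarrow> w u v = 0" and "(\<lambda>\<sigma>. b u \<sigma> - comb (w u) \<sigma>) \<in> cell_boundaries K q Lt"
proof -
  let ?P = "\<lambda>w. (\<forall>v. v \<notin> S \<longrightarrow> w v = 0) \<and> (\<lambda>\<sigma>. b u \<sigma> - comb w \<sigma>) \<in> cell_boundaries K q Lt"
  \<comment> \<open>For coefficients vanishing off \<open>S\<close>, the equation of classes in the
    definite description says that a chain is a boundary in K_t, the form in which existence and
    uniqueness are known.\<close>
  have "(\<forall>v. v \<notin> S \<longrightarrow> w v = 0) \<and>
        incl_induced K q Lt (homology_class K q Lb (birth_cycle cs V u)) =
        (\<Oplus>\<^bsub>Ht\<^esub>v\<in>S. w v \<odot>\<^bsub>Ht\<^esub> homology_class K q Lt (birth_cycle cs V v)) \<longleftrightarrow> ?P w" for w :: "nat \<Rightarrow> 'k"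
  proof (cases "\<forall>v. v \<notin> S \<longrightarrow> w v = 0")
    case True
    then show ?thesis
      using sum_S_class [of Lt w]
      by (simp add: incl_induced_class [OF strict_sublevel_subset] homology_class_eq_iff b_def)
  qed blast
  then have "w u = (THE w. ?P w)"
    by (simp add: transition_coeffs_def Let_def)
  then have "?P (w u)"
    using theI' [OF ex1_transition [OF assms]] by simp
  then show "\<And>v. v \<notin> S \<Longrightarrow> w u v = 0" and "(\<lambda>\<sigma>. b u \<sigma> - comb (w u) \<sigma>) \<in> cell_boundaries K q Lt"
    by blast+
qed

definition ker_coeffs :: "nat \<Rightarrow> nat \<Rightarrow> 'k" where
  "ker_coeffs u = (\<lambda>i. (if i = u then 1 else 0) - w u i)"

abbreviation ker_cycle :: "nat \<Rightarrow> 'a set \<Rightarrow> 'k" where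
  "ker_cycle u \<equiv> comb (ker_coeffs u)"

lemma ker_cycle_eq: "u \<in> D \<Longrightarrow> ker_cycle u = (\<lambda>\<sigma>. b u \<sigma> - comb (w u) \<sigma>)"
  using D_S_less by (simp add: ker_coeffs_def comb_diff comb_unit)

text \<open>In the basis of homology before t indexed by \<open>D\<close> and \<open>S\<close>, the
  coordinate matrix of the kernel classes has the identity as its \<open>D\<close> block.
  Independence and the coefficients in the spanning argument are read off from it.\<close>

lemma ker_coeffs_D: "u \<in> D \<Longrightarrow> j \<in> D \<Longrightarrow> ker_coeffs u j = (if j = u then 1 else 0)"
  using transition(1) D_S_disjoint by (simp add: ker_coeffs_def)

lemma ker_coeffs_outside: "u \<in> D \<Longrightarrow> j \<notin> D \<union> S \<Longrightarrow> ker_coeffs u j = 0"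
  using transition(1) by (auto simp: ker_coeffs_def)

lemma ker_cycle_boundary: "u \<in> D \<Longrightarrow> ker_cycle u \<in> cell_boundaries K q Lt"
  using ker_cycle_eq transition(2) by simp

lemma comb_w_cycle: 
  assumes "u \<in> D" shows "comb (w u) \<in> cell_cycles K q Lb"
proof -
  have "comb (w u) = (\<lambda>\<sigma>. \<Sum>v\<in>S. w u v * b v \<sigma>)"
    using finite_S D_S_less transition(1) [OF assms] by (intro comb_support) auto
  moreover have "(\<lambda>\<sigma>. \<Sum>v\<in>A. w u v * b v \<sigma>) \<in> cell_cycles K q Lb" if "A \<subseteq> S" for A
    using finite_subset [OF that finite_S] that
  proof (induction A rule: finite_induct)
    case (insert v A)
    then have "(\<lambda>\<sigma>. w u v * b v \<sigma> + (\<Sum>v\<in>A. w u v * b v \<sigma>)) \<in> cell_cycles K q Lb"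
      using b_cycle_Lb by (intro cell_cycles_add cell_cycles_smult) auto
    then show ?case
      using insert.hyps by simp
  qed (simp add: cell_cycles_zero)
  ultimately show ?thesis
    by simp
qed

lemma ker_cycle_cycle: "u \<in> D \<Longrightarrow> ker_cycle u \<in> cell_cycles K q Lb"
  using ker_cycle_eq comb_w_cycle b_cycle_Lb by (simp add: cell_cycles_diff)

lemma kernel_class_eq:
  assumes "u \<in> D"
  shows "kernel_class K f cs R V q t u = homology_class K q Lb (ker_cycle u)"
proof -
  interpret H: vectorspace class_ring Hb
    by (rule vectorspace_cell_homology)
  let ?c = "comb (w u)"
  have cyc: "(\<lambda>\<sigma>. (-1) * ?c \<sigma>) \<in> cell_cycles K q Lb"
    by (rule cell_cycles_smult [OF comb_w_cycle [OF assms]])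
  have "homology_class K q Lb (\<lambda>\<sigma>. (-1) * ?c \<sigma>) \<oplus>\<^bsub>Hb\<^esub> homology_class K q Lb ?c = \<zero>\<^bsub>Hb\<^esub>"
    by (simp add: homology_class_add cell_homology_simps(2) homology_class_zero)
  then have neg: "\<ominus>\<^bsub>Hb\<^esub> homology_class K q Lb ?c = homology_class K q Lb (\<lambda>\<sigma>. (-1) * ?c \<sigma>)"
    using class_carrier [OF cyc] class_carrier [OF comb_w_cycle [OF assms]] by (intro H.minus_equality)
  have "kernel_class K f cs R V q t u = homology_class K q Lb (b u) \<ominus>\<^bsub>Hb\<^esub> homology_class K q Lb ?c"
    using sum_S_class [of Lb "w u"] transition(1) [OF assms] by (simp add: kernel_class_def Let_def b_def)
  also have "\<dots> = homology_class K q Lb (ker_cycle u)"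
    unfolding a_minus_def neg homology_class_add ker_cycle_eq [OF assms] by simp
  finally show ?thesis .
qed

lemma ker_cycles_independent:
  fixes a :: "nat \<Rightarrow> 'k"
  assumes "(\<lambda>\<sigma>. \<Sum>u\<in>D. a u * ker_cycle u \<sigma>) \<in> cell_boundaries K q Lb" "j \<in> D"
  shows "a j = 0"
proof -
  let ?\<gamma> = "\<lambda>i. \<Sum>u\<in>D. a u * ker_coeffs u i"
  \<comment> \<open>By the identity block, the coordinate at \<open>j\<close> of the combination is
    the coefficient \<open>a j\<close> itself.\<close>
  have "?\<gamma> j = (\<Sum>u\<in>D. if u = j then a j else 0)"
    using assms(2) by (intro sum.cong) (auto simp: ker_coeffs_D)
  then have "?\<gamma> j = a j"
    using assms(2) finite_D by simp
  moreover have "?\<gamma> j = 0"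
  proof (rule unpaired_independent [OF stage_strict_sublevel, where \<gamma> = ?\<gamma>])
    show "comb ?\<gamma> \<in> cell_boundaries K q Lb"
      using assms(1) by (simp add: comb_sum)
    show "i \<in> unpaired q Lb" if "?\<gamma> i \<noteq> 0" for i
    proof (rule ccontr)
      assume "i \<notin> unpaired q Lb"
      then have "?\<gamma> i = 0"
        using unpaired_Lb ker_coeffs_outside by (intro sum.neutral) auto
      then show False
        using that by simp
    qed
  qed
  ultimately show ?thesis
    by simp
qed

lemma ker_cycles_span:
  fixes c :: "'a set \<Rightarrow> 'k"
  assumes "c \<in> cell_cycles K q Lb" "c \<in> cell_boundaries K q Lt"
  shows "\<exists>a. (\<lambda>\<sigma>. c \<sigma> - (\<Sum>u\<in>D. a u * ker_cycle u \<sigma>)) \<in> cell_boundaries K q Lb"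
proof -
  obtain \<gamma> where \<gamma>: "\<forall>i. \<gamma> i \<noteq> 0 \<longrightarrow> i \<in> unpaired q Lb \<and> i < N"
    "(\<lambda>\<sigma>. c \<sigma> - comb \<gamma> \<sigma>) \<in> cell_boundaries K q Lb"
    using cycle_expansion [OF stage_strict_sublevel assms(1), of N] by auto
  \<comment> \<open>The coefficients are the \<open>D\<close> coordinates of \<open>c\<close>;
    subtracting this combination cancels them.\<close>
  let ?s = "\<lambda>\<sigma>. \<Sum>u\<in>D. \<gamma> u * ker_cycle u \<sigma>"
  let ?\<delta> = "\<lambda>i. \<gamma> i - (\<Sum>u\<in>D. \<gamma> u * ker_coeffs u i)"
  have \<delta>: "comb ?\<delta> = (\<lambda>\<sigma>. comb \<gamma> \<sigma> - ?s \<sigma>)"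
    by (simp add: comb_diff comb_sum)
  have "cell_boundaries K q Lb \<subseteq> (cell_boundaries K q Lt :: ('a set \<Rightarrow> 'k) set)"
    unfolding cell_boundaries_def by (intro image_mono cell_chains_mono strict_sublevel_subset)
  then have "(\<lambda>\<sigma>. c \<sigma> - comb \<gamma> \<sigma>) \<in> cell_boundaries K q Lt"
    using \<gamma>(2) by blast
  from cell_boundaries_diff [OF assms(2) this] have "comb \<gamma> \<in> cell_boundaries K q Lt"
    by simp
  moreover have "(\<lambda>\<sigma>. \<Sum>u\<in>A. \<gamma> u * ker_cycle u \<sigma>) \<in> cell_boundaries K q Lt" if "A \<subseteq> D" for A
    using finite_subset [OF that finite_D] that
  proof (induction A rule: finite_induct)
    case (insert v A)
    then have "(\<lambda>\<sigma>. \<gamma> v * ker_cycle v \<sigma> + (\<Sum>u\<in>A. \<gamma> u * ker_cycle u \<sigma>)) \<in> cell_boundaries K q Lt"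
      using ker_cycle_boundary by (intro cell_boundaries_add cell_boundaries_smult) auto
    then show ?case
      using insert.hyps by simp
  qed (simp add: cell_boundaries_zero)
  ultimately have "comb ?\<delta> \<in> cell_boundaries K q Lt"
    unfolding \<delta> by (intro cell_boundaries_diff) simp_all
  \<comment> \<open>On \<open>D\<close> the identity block makes the difference zero, and outside
    \<open>D\<close> and \<open>S\<close> all terms vanish. What remains is supported on
    \<open>S\<close>, which is part of the basis in K_t.\<close>
  moreover have "i \<in> unpaired q Lt" if "?\<delta> i \<noteq> 0" for i
  proof (rule ccontr)
    assume "i \<notin> unpaired q Lt"
    then have "i \<notin> S"
      using S_eq by blast
    have "?\<delta> i = 0"
    proof (cases "i \<in> D")
      case True
      then have "(\<Sum>u\<in>D. \<gamma> u * ker_coeffs u i) = (\<Sum>u\<in>D. if u = i then \<gamma> i else 0)"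
        by (intro sum.cong) (auto simp: ker_coeffs_D)
      then show ?thesis
        using True finite_D by simp
    next
      case False
      then have "\<gamma> i = 0" "(\<Sum>u\<in>D. \<gamma> u * ker_coeffs u i) = 0"
        using \<open>i \<notin> S\<close> \<gamma>(1) unpaired_Lb ker_coeffs_outside by (auto intro!: sum.neutral)
      then show ?thesis
        by simp
    qed
    then show False
      using that by simp
  qed
  ultimately have "?\<delta> i = 0" for i
    by (rule unpaired_independent [OF stage_sublevel, where \<gamma> = ?\<delta>])
  then have "comb ?\<delta> = (\<lambda>\<sigma>. 0)"
    by (rule comb_zero)
  \<comment> \<open>Independence kills the coefficients themselves, so the two combinations agree as
    chains and only the boundary from the expansion of \<open>c\<close> is left over.\<close>
  then have "comb \<gamma> \<sigma> = ?s \<sigma>" for \<sigma>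
    using fun_cong [OF \<delta>, of \<sigma>] by simp
  then show ?thesis
    using \<gamma>(2) by (intro exI [of _ \<gamma>]) simp
qed

lemma linear_map_incl: "linear_map class_ring Hb Ht (incl_induced K q Lt)"
proof -
  interpret Hb: vectorspace class_ring Hb
    by (rule vectorspace_cell_homology)
  interpret Ht: vectorspace class_ring Ht
    by (rule vectorspace_cell_homology)
  have "incl_induced K q Lt \<in> module_hom class_ring Hb Ht"
    using cell_cycles_mono [OF strict_sublevel_subset [of t], of q]
    by (auto simp: module_hom_def cell_homology_simps(1) incl_induced_class [OF strict_sublevel_subset]
        homology_class_add homology_class_smult)
  then show ?thesis
    by (simp add: linear_map_def mod_hom_def mod_hom_axioms_def Hb.vectorspace_axioms Ht.vectorspace_axioms
        Hb.module_axioms Ht.module_axioms)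
qed

text \<open>\<open>basis\<close> speaks of a set of vectors. Injectivity on \<open>D\<close> adds
  that the indexed family has no repetitions.\<close>

lemma kernel_basis:
  defines "\<kappa> \<equiv> kernel_class K f cs R V q t"
  shows "inj_on \<kappa> D \<and>
    vectorspace.basis class_ring (Hb\<lparr>carrier := mod_hom.ker Hb Ht (incl_induced K q Lt)\<rparr>) (\<kappa> ` D)"
proof
  interpret V: vectorspace class_ring Hb
    by (rule vectorspace_cell_homology)
  interpret T: linear_map class_ring Hb Ht "incl_induced K q Lt"
    by (rule linear_map_incl)
  let ?ker = "mod_hom.ker Hb Ht (incl_induced K q Lt)"
  have \<kappa>: "\<kappa> u = homology_class K q Lb (ker_cycle u)" if "u \<in> D" for u
    unfolding \<kappa>_def by (rule kernel_class_eq [OF that])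
  show inj: "inj_on \<kappa> D"
  proof (rule inj_onI, rule ccontr)
    fix u v assume uv: "u \<in> D" "v \<in> D" "\<kappa> u = \<kappa> v" "u \<noteq> v"
    \<comment> \<open>Equal classes for distinct indices would be a relation with coefficients 1 and
      -1.\<close>
    let ?a = "\<lambda>i. if i = u then 1 else if i = v then -1 else (0::'k)"
    have "(\<Sum>i\<in>D. ?a i * ker_cycle i \<sigma>) = ker_cycle u \<sigma> - ker_cycle v \<sigma>" for \<sigma>
    proof -
      have "(\<Sum>i\<in>D. ?a i * ker_cycle i \<sigma>) = (\<Sum>i\<in>D. (if i = u then ker_cycle u \<sigma> else 0) - (if i = v then ker_cycle v \<sigma> else 0))"
        using uv(4) by (intro sum.cong) auto
      then show ?thesis
        using uv finite_D by (simp add: sum_subtractf)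
    qed
    then have "(\<lambda>\<sigma>. \<Sum>i\<in>D. ?a i * ker_cycle i \<sigma>) \<in> cell_boundaries K q Lb"
      using uv(1-3) by (simp add: \<kappa> homology_class_eq_iff)
    from ker_cycles_independent [OF this uv(1)] show False
      by simp
  qed
  have ker_iff: "x \<in> ?ker \<longleftrightarrow> (\<exists>c\<in>cell_cycles K q Lb. x = homology_class K q Lb c \<and> c \<in> cell_boundaries K q Lt)" for x
  proof -
    have "x \<in> ?ker \<longleftrightarrow> (\<exists>c\<in>cell_cycles K q Lb. x = homology_class K q Lb c \<and> incl_induced K q Lt x = cell_boundaries K q Lt)"
      unfolding T.ker_def cell_homology_simps(1,2) by blast
    also have "\<dots> \<longleftrightarrow> (\<exists>c\<in>cell_cycles K q Lb. x = homology_class K q Lb c \<and> c \<in> cell_boundaries K q Lt)"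
      using incl_induced_class [OF strict_sublevel_subset] homology_class_eq_zero_iff by (intro bex_cong refl conj_cong) simp
    finally show ?thesis .
  qed
  have sub: "\<kappa> ` D \<subseteq> ?ker"
  proof
    fix x assume "x \<in> \<kappa> ` D"
    then obtain u where "u \<in> D" "x = homology_class K q Lb (ker_cycle u)"
      using \<kappa> by blast
    then show "x \<in> ?ker"
      unfolding ker_iff using ker_cycle_cycle ker_cycle_boundary by blast
  qed
  have car: "\<kappa> ` D \<subseteq> carrier Hb"
    using \<kappa> ker_cycle_cycle class_carrier by auto
  \<comment> \<open>\<open>lincomb\<close> sums over the set of classes; injectivity of \<kappa>
    turns this into a sum over the indices in \<open>D\<close>.\<close>
  have lincomb: "V.lincomb a (\<kappa> ` D) = homology_class K q Lb (\<lambda>\<sigma>. \<Sum>u\<in>D. a (\<kappa> u) * ker_cycle u \<sigma>)" for a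
  proof -
    have "V.lincomb a (\<kappa> ` D) = (\<Oplus>\<^bsub>Hb\<^esub>u\<in>D. a (\<kappa> u) \<odot>\<^bsub>Hb\<^esub> \<kappa> u)"
      unfolding V.lincomb_def using car inj by (intro V.finsum_reindex) auto
    also have "\<dots> = (\<Oplus>\<^bsub>Hb\<^esub>u\<in>D. a (\<kappa> u) \<odot>\<^bsub>Hb\<^esub> homology_class K q Lb (ker_cycle u))"
      using ker_cycle_cycle class_carrier by (intro V.finsum_cong') (auto simp: \<kappa>)
    also have "\<dots> = homology_class K q Lb (\<lambda>\<sigma>. \<Sum>u\<in>D. a (\<kappa> u) * ker_cycle u \<sigma>)"
      by (rule finsum_class [OF finite_D ker_cycle_cycle])
    finally show ?thesis .
  qed
  have indep: "\<not> V.lin_dep (\<kappa> ` D)"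
  proof (rule V.finite_lin_indpt2)
    fix a assume "V.lincomb a (\<kappa> ` D) = \<zero>\<^bsub>Hb\<^esub>"
    then have "(\<lambda>\<sigma>. \<Sum>u\<in>D. a (\<kappa> u) * ker_cycle u \<sigma>) \<in> cell_boundaries K q Lb"
      by (simp add: lincomb cell_homology_simps(2) homology_class_eq_zero_iff)
    then show "\<forall>v\<in>\<kappa> ` D. a v = \<zero>\<^bsub>class_ring\<^esub>"
      using ker_cycles_independent by auto
  qed (use finite_D car in auto)
  have "?ker \<subseteq> V.span (\<kappa> ` D)"
  proof
    fix x assume "x \<in> ?ker"
    then obtain c where c: "c \<in> cell_cycles K q Lb" "x = homology_class K q Lb c" "c \<in> cell_boundaries K q Lt"
      by (auto simp: ker_iff)
    obtain a where a: "(\<lambda>\<sigma>. c \<sigma> - (\<Sum>u\<in>D. a u * ker_cycle u \<sigma>)) \<in> cell_boundaries K q Lb"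
      using ker_cycles_span [OF c(1,3)] by blast
    \<comment> \<open>The coefficients move from indices to classes along the inverse of
      \<kappa>.\<close>
    let ?a = "\<lambda>y. a (inv_into D \<kappa> y)"
    have "x = homology_class K q Lb (\<lambda>\<sigma>. \<Sum>u\<in>D. ?a (\<kappa> u) * ker_cycle u \<sigma>)"
      using a inj by (simp add: c(2) homology_class_eq_iff cong: sum.cong)
    then have "x = V.lincomb ?a (\<kappa> ` D)"
      by (simp add: lincomb)
    then show "x \<in> V.span (\<kappa> ` D)"
      using V.finite_span [OF finite_imageI [OF finite_D] car] by auto
  qed
  moreover have "V.span (\<kappa> ` D) \<subseteq> ?ker"
    using V.span_is_subset [OF sub T.ker_is_submodule] .
  ultimately have span: "V.span (\<kappa> ` D) = ?ker"
    by blast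
  \<comment> \<open>Span and independence were determined in the ambient homology group; both agree
    with those taken in the kernel as a vector space of its own.\<close>
  interpret Ker: vectorspace class_ring "Hb\<lparr>carrier := ?ker\<rparr>"
    using V.subspace_is_vs [OF T.kerT_is_subspace] .
  show "Ker.basis (\<kappa> ` D)"
    unfolding Ker.basis_def
    using indep span sub V.span_li_not_depend [OF sub T.ker_is_submodule] by simp
qed

end
end

theorem proposition3p2:
  fixes K :: "'a cw_complex"
    and f :: "'a set \<Rightarrow> real"
    and cs :: "'a set list"
    and R V :: "'k::field mat"
    and q :: nat and t :: real
  defines "H\<^sub>b \<equiv> cell_homology K q (strict_sublevel K f t) :: ('k, ('a set \<Rightarrow> 'k) set) module"
    and "H\<^sub>t \<equiv> cell_homology K q (sublevel K f t) :: ('k, ('a set \<Rightarrow> 'k) set) module"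
    and "\<kappa> \<equiv> kernel_class K f cs R V q t"
  assumes "finite_cw_complex K" and "oriented_cells K"
    and "filtration_function K f"
    and "compatible_order K f cs"
    and "filtration_by_subcomplexes K f cs"
    and "V \<in> carrier_mat (length cs) (length cs)"
    and "R = boundary_matrix K cs * V"
    and "reduced R"
    and "upper_unitriangular V"
    and "dimension_preserving K cs V"
    and "t \<in> f ` cw_cells K"
  shows "inj_on \<kappa> (dying K f cs R q t) \<and>
    vectorspace.basis class_ring
      (H\<^sub>b\<lparr>carrier := mod_hom.ker H\<^sub>b H\<^sub>t (incl_induced K q (sublevel K f t))\<rparr>)
      (\<kappa> ` dying K f cs R q t)"
proof -
  interpret persistence K f cs R V
    using assms by unfold_locales
  show ?thesis
    unfolding assms(1-3) by (rule kernel_basis)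
qed

end
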